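(* The symplectic loaves in $GL(n,\mathbb C)$ are precisely the sets $$B^+\omega_1B^+\cap B^-\omega_2B^-,\qquad (\omega_1,\omega_2)\in W\times W.$$
   Context: $B^+$ and $B^-$ are the subgroups of upper and lower triangular matrices in $GL(n,\mathbb C)$, and $W$ is the Weyl group (the symmetric group, realized by permutation matrices). $M(n,\mathbb C)$ with coordinate functions $a_{ij}$ carries the standard (holomorphic) Poisson bracket determined by antisymmetry and $\{a_{ij},a_{ik}\}_0=a_{ij}a_{ik}$ if $j<k$; $\{a_{ij},a_{kj}\}_0=a_{ij}a_{kj}$ if $i<k$; $\{a_{ij},a_{st}\}_0=0$ if $i<s$, $t<j$; $\{a_{ij},a_{st}\}_0=2a_{it}a_{sj}$ if $i<s$, $j<t$; $GL(n,\mathbb C)$ is an open Poisson submanifold. A symplectic leaf is a maximal (connected) integral manifold of the involutive distribution assigning to a point the complex span of the values there of the Hamiltonian vector fields. $\mathcal S_{\rm mult}\cong(\mathbb C^* )^{2n-1}$ is the group of all transformations $(a_{ij})\mapsto(\psi_i\phi_ja_{ij})$ with $\psi_i,\phi_j\in\mathbb C^*$. A symplectic loaf is a set $\mathcal S_{\rm mult}(\mathcal L)$ with $\mathcal L$ a symplectic leaf. *)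

theory Defs
  imports "HOL-Analysis.Analysis"
begin

text \<open>
  The index set \<open>{1, ..., n}\<close> is rendered by a type \<open>'n\<close> of sort \<open>{finite, linorder}\<close>, so that
  \<open>M(n, C)\<close> is \<open>complex^'n^'n\<close> and \<open>A $ i $ j\<close> is the entry \<open>a\<^sub>i\<^sub>j\<close>. The product and the real
  normed structure are those of the library; complex scalar multiplication of matrices is added here.
\<close>

type_synonym 'n cmat = "complex^'n^'n"

definition cscale :: "complex \<Rightarrow> ('n::finite) cmat \<Rightarrow> 'n cmat" where
  "cscale c A = (\<chi> i j. c * A $ i $ j)"

interpretation cmat: vector_space "cscale :: complex \<Rightarrow> ('n::finite) cmat \<Rightarrow> 'n cmat"
  by unfold_locales (simp_all add: cscale_def vec_eq_iff algebra_simps)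

definition GL :: "('n::finite) cmat set" where
  "GL = {A. invertible A}"

definition matrix_unit :: "'n::finite \<Rightarrow> 'n \<Rightarrow> 'n cmat" where
  "matrix_unit i j = (\<chi> k l. if k = i \<and> l = j then 1 else 0)"


section \<open>The standard Poisson bracket\<close>

text \<open>
  The value at \<open>A\<close> of the bracket of the coordinate functions \<open>a\<^sub>i\<^sub>j\<close> and \<open>a\<^sub>s\<^sub>t\<close>. The
  branches with negative sign are those forced by antisymmetry; the last branch covers \<open>i < s\<close>,
  \<open>t < j\<close>, its antisymmetric counterpart \<open>s < i\<close>, \<open>j < t\<close>, and \<open>(i, j) = (s, t)\<close>.
\<close>

definition coordinate_bracket ::
    "'n::{finite,linorder} \<Rightarrow> 'n \<Rightarrow> 'n \<Rightarrow> 'n \<Rightarrow> 'n cmat \<Rightarrow> complex" where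
  "coordinate_bracket i j s t A =
    (if i = s \<and> j < t then A $ i $ j * A $ i $ t
     else if i = s \<and> t < j then - (A $ i $ j * A $ i $ t)
     else if j = t \<and> i < s then A $ i $ j * A $ s $ j
     else if j = t \<and> s < i then - (A $ i $ j * A $ s $ j)
     else if i < s \<and> j < t then 2 * A $ i $ t * A $ s $ j
     else if s < i \<and> t < j then - (2 * A $ i $ t * A $ s $ j)
     else 0)"

definition partial_deriv :: "'n::finite \<Rightarrow> 'n \<Rightarrow> ('n cmat \<Rightarrow> complex) \<Rightarrow> 'n cmat \<Rightarrow> complex" where
  "partial_deriv i j f A = deriv (\<lambda>z. f (A + cscale z (matrix_unit i j))) 0"

text \<open>The extension of the coordinate brackets to a biderivation on holomorphic functions.\<close>

definition poisson_bracket ::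
    "(('n::{finite,linorder}) cmat \<Rightarrow> complex) \<Rightarrow> ('n cmat \<Rightarrow> complex) \<Rightarrow> 'n cmat \<Rightarrow> complex" where
  "poisson_bracket f g A =
    (\<Sum>i\<in>UNIV. \<Sum>j\<in>UNIV. \<Sum>s\<in>UNIV. \<Sum>t\<in>UNIV.
      partial_deriv i j f A * partial_deriv s t g A * coordinate_bracket i j s t A)"

definition holomorphic_on_GL :: "(('n::finite) cmat \<Rightarrow> complex) \<Rightarrow> bool" where
  "holomorphic_on_GL f \<longleftrightarrow>
    (\<forall>A\<in>GL. \<exists>D. (f has_derivative D) (at A) \<and> Vector_Spaces.linear cscale (*) D)"

text \<open>The vector field of \<open>f\<close>, in coordinates: its \<open>(k, l)\<close> component is \<open>{f, a\<^sub>k\<^sub>l}\<close>.\<close>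

definition hamiltonian_field ::
    "(('n::{finite,linorder}) cmat \<Rightarrow> complex) \<Rightarrow> 'n cmat \<Rightarrow> 'n cmat" where
  "hamiltonian_field f A = (\<chi> k l. poisson_bracket f (\<lambda>X. X $ k $ l) A)"

definition hamiltonian_distribution ::
    "('n::{finite,linorder}) cmat \<Rightarrow> 'n cmat set" where
  "hamiltonian_distribution A = cmat.span {hamiltonian_field f A | f. holomorphic_on_GL f}"


section \<open>Symplectic leaves and loaves\<close>

text \<open>
  An integral manifold is an injectively immersed complex submanifold of \<open>GL\<close> all of whose tangent
  spaces are the spaces of the distribution. It is represented by its underlying set \<open>N\<close> together
  with its manifold topology \<open>T\<close>, which may be strictly finer than the subspace topology. Charts
  are inverted: \<open>\<phi>\<close> maps an open subset \<open>V\<close> of a complex vector space \<open>E\<close> onto an open subset of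
  \<open>N\<close>. Taking \<open>E\<close> inside \<open>M(n, C)\<close> loses no generality, as the dimension of \<open>N\<close> is at most
  \<open>n\<^sup>2\<close>. Since the \<open>\<phi>\<close> are holomorphic immersions, the coordinate changes are automatically
  holomorphic.
\<close>

definition integral_chart ::
    "('n::{finite,linorder}) cmat set \<Rightarrow> 'n cmat set \<Rightarrow> ('n cmat \<Rightarrow> 'n cmat) \<Rightarrow> bool" where
  "integral_chart E V \<phi> \<longleftrightarrow>
    cmat.subspace E \<and> openin (top_of_set E) V \<and>
    (\<forall>v\<in>V. \<exists>D. (\<phi> has_derivative D) (at v within V) \<and> Vector_Spaces.linear cscale cscale D \<and>
      inj_on D E \<and> D ` E = hamiltonian_distribution (\<phi> v))"

definition integral_manifold ::
    "('n::{finite,linorder}) cmat set \<Rightarrow> 'n cmat topology \<Rightarrow> bool" where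
  "integral_manifold N T \<longleftrightarrow>
    N \<subseteq> GL \<and> topspace T = N \<and> Hausdorff_space T \<and> second_countable T \<and>
    (\<forall>p\<in>N. \<exists>U E V \<phi>. openin T U \<and> p \<in> U \<and> integral_chart E V \<phi> \<and>
      homeomorphic_map (top_of_set V) (subtopology T U) \<phi>)"

definition connected_integral_manifold :: "('n::{finite,linorder}) cmat set \<Rightarrow> bool" where
  "connected_integral_manifold N \<longleftrightarrow> (\<exists>T. integral_manifold N T \<and> connected_space T)"

definition symplectic_leaf :: "('n::{finite,linorder}) cmat set \<Rightarrow> bool" where
  "symplectic_leaf L \<longleftrightarrow> connected_integral_manifold L \<and>
    (\<forall>N. connected_integral_manifold N \<and> L \<subseteq> N \<longrightarrow> N = L)"

definition S_mult :: "(('n::finite) cmat \<Rightarrow> 'n cmat) set" where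
  "S_mult = {(\<lambda>A. \<chi> i j. \<psi> i * \<phi> j * A $ i $ j) | \<psi> \<phi>. (\<forall>i. \<psi> i \<noteq> 0) \<and> (\<forall>j. \<phi> j \<noteq> 0)}"

definition symplectic_loaf :: "('n::{finite,linorder}) cmat set \<Rightarrow> bool" where
  "symplectic_loaf K \<longleftrightarrow> (\<exists>L. symplectic_leaf L \<and> K = (\<Union>\<sigma>\<in>S_mult. \<sigma> ` L))"


section \<open>Triangular subgroups and the Weyl group\<close>

definition B_plus :: "('n::{finite,linorder}) cmat set" where
  "B_plus = {A \<in> GL. \<forall>i j. j < i \<longrightarrow> A $ i $ j = 0}"

definition B_minus :: "('n::{finite,linorder}) cmat set" where
  "B_minus = {A \<in> GL. \<forall>i j. i < j \<longrightarrow> A $ i $ j = 0}"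

definition permutation_matrix :: "('n::finite \<Rightarrow> 'n) \<Rightarrow> 'n cmat" where
  "permutation_matrix p = (\<chi> i j. if i = p j then 1 else 0)"

definition Weyl_group :: "('n::finite) cmat set" where
  "Weyl_group = {permutation_matrix p | p. p permutes UNIV}"

definition double_coset :: "('n::finite) cmat set \<Rightarrow> 'n cmat \<Rightarrow> 'n cmat set" where
  "double_coset B \<omega> = {b ** \<omega> ** b' | b b'. b \<in> B \<and> b' \<in> B}"


section \<open>The bracket on coordinate functions\<close>

lemma coordinate_bracket_antisym:
  fixes A :: "('n::{finite,linorder}) cmat"
  shows "coordinate_bracket s t i j A = - coordinate_bracket i j s t A"
  by (cases i s rule: linorder_cases; cases j t rule: linorder_cases)
    (auto simp: coordinate_bracket_def)

lemma partial_deriv_coordinate: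
  "partial_deriv i j (\<lambda>X. X $ k $ l) A = (if k = i \<and> l = j then 1 else 0)"
proof -
  have "((\<lambda>z. A $ k $ l + z * c) has_field_derivative c) (at 0)" for c
    by (auto intro!: derivative_eq_intros)
  then have "deriv (\<lambda>z. A $ k $ l + z * c) 0 = c" for c
    by (rule DERIV_imp_deriv)
  then show ?thesis
    unfolding partial_deriv_def cscale_def matrix_unit_def by simp
qed

lemma poisson_bracket_coordinates:
  fixes A :: "('n::{finite,linorder}) cmat"
  shows "poisson_bracket (\<lambda>X. X $ i $ j) (\<lambda>X. X $ s $ t) A = coordinate_bracket i j s t A"
proof -
  have pull: "(\<Sum>x\<in>(UNIV :: 'n set). if P then f x else 0) = (if P then \<Sum>x\<in>UNIV. f x else 0)"
    for P and f :: "'n \<Rightarrow> complex"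
    by simp
  have "partial_deriv a b (\<lambda>X. X $ i $ j) A * partial_deriv c d (\<lambda>X. X $ s $ t) A *
      coordinate_bracket a b c d A =
      (if i = a then if j = b then if s = c then if t = d then coordinate_bracket i j s t A
        else 0 else 0 else 0 else 0)" for a b c d
    by (simp add: partial_deriv_coordinate)
  then have "poisson_bracket (\<lambda>X. X $ i $ j) (\<lambda>X. X $ s $ t) A =
      (\<Sum>a\<in>UNIV. \<Sum>b\<in>UNIV. \<Sum>c\<in>UNIV. \<Sum>d\<in>UNIV.
        (if i = a then if j = b then if s = c then if t = d then coordinate_bracket i j s t A
          else 0 else 0 else 0 else 0))"
    by (simp only: poisson_bracket_def)
  also have "\<dots> = coordinate_bracket i j s t A"
    by (simp add: pull)
  finally show ?thesis .
qed

end

theory Submission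
  imports Defs "HOL-Complex_Analysis.Cauchy_Integral_Formula" "HOL-Combinatorics.Cycles"
begin

text \<open>
  Let \<open>P\<close> and \<open>R\<close> be permutation matrices and \<open>C\<close> the intersection of \<open>B\<^sup>+ P B\<^sup>+\<close> and \<open>B\<^sup>- R B\<^sup>-\<close>. By the
  Bruhat decomposition (\<open>bruhat_plus\<close>, \<open>bruhat_minus\<close>) every invertible matrix lies in such a cell.
  The theorem amounts to three statements: a symplectic leaf that meets a cell stays in it, every
  cell contains a leaf, and the torus translates of one leaf fill the cell.

  The bracket comes from the classical r-matrix. A tangent vector at \<open>A\<close> belongs to the Hamiltonian
  distribution iff it can be written both as \<open>A x - z A\<close> with upper triangular \<open>x\<close>, \<open>z\<close> and as
  \<open>A x' - z' A\<close> with lower triangular \<open>x'\<close>, \<open>z'\<close> that have the opposite diagonals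
  (\<open>hamiltonian_distribution_iff\<close>). This is the infinitesimal form of the relation \<open>dressed\<close>, in which
  \<open>A = u q u' = l q l'\<close> with upper triangular \<open>u\<close>, \<open>u'\<close> and lower triangular \<open>l\<close>, \<open>l'\<close> that have the
  inverse diagonals. Cells are invariant under this relation. So are the functions \<open>KK i\<close> on a
  cell: write \<open>A = \<nu>\<^sup>-\<^sup>1 P \<beta> = \<gamma> R \<mu>\<^sup>-\<^sup>1\<close> with unipotent \<open>\<nu>\<close>, \<open>\<mu>\<close>. A dressing transformation changes
  the numbers \<open>\<kappa> i\<close>, which are products of a diagonal entry of \<open>\<beta>\<close> and one of \<open>\<gamma>\<close>, by a factor
  \<open>b (\<tau> i) / b i\<close>, where \<open>\<tau>\<close> is the permutation of \<open>P R\<^sup>-\<^sup>1\<close>; the product of \<open>\<kappa>\<close> along an orbit of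
  \<open>\<tau>\<close> is unchanged (\<open>dressed_cell\<close>). The leaves are the connected components of the common level sets of
  the functions \<open>KK i\<close>.

  On the one hand, the level sets are embedded complex submanifolds with the Hamiltonian
  distribution as their tangent spaces (\<open>chart_exists\<close>). Indeed \<open>A\<close> is determined by the free entries
  of \<open>\<nu>\<close> and \<open>\<gamma>\<close> and depends holomorphically on them, since it is computed from them by a
  triangular factorization. This is a chart of the cell, and the constraint on \<open>KK\<close> is met by
  multiplication with a diagonal matrix. A curve in a level set has its velocity in the distribution
  (\<open>tangent_in_distribution\<close>), and every vector of the distribution is the velocity of a curve of
  dressing transformations (\<open>distribution_dressing_curve\<close>).

  On the other hand, a connected integral manifold of the distribution cannot leave a level set
  (\<open>connected_integral_manifold_level\<close>). On it the rank of the distribution is constant, so that the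
  velocity of a curve is \<open>A x - z A = A x' - z' A\<close> with matrices that depend continuously on time
  (\<open>constant_rank_lift\<close>). The solutions of the linear differential equations with these matrices as
  coefficients are triangular and show that the points of the curve are related by \<open>dressed\<close>
  (\<open>dressed_along_curve\<close>). Therefore the components of level sets are maximal, and they are all the
  leaves.

  Finally, the cell is connected, because it is a continuous image of the complement of the zero
  set of a nonzero polynomial, which is connected and not empty (\<open>cell_connected_nonempty\<close>). The left torus
  changes \<open>KK i\<close> by squares and so moves a leaf over a neighbourhood of each of its points in the cell
  (\<open>torus_leaf_neighbourhood\<close>). By connectedness its translates fill the cell (\<open>loaf_eq_cell\<close>).
\<close>

section \<open>Triangular matrices\<close>

definition partial_order_rel :: "('a \<Rightarrow> 'a \<Rightarrow> bool) \<Rightarrow> bool" where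
  "partial_order_rel Q \<longleftrightarrow> (\<forall>i. Q i i) \<and> (\<forall>i j. Q i j \<longrightarrow> Q j i \<longrightarrow> i = j) \<and>
    (\<forall>i j k. Q i j \<longrightarrow> Q j k \<longrightarrow> Q i k)"

text \<open>
  Upper and lower triangular matrices and their conjugates by permutation matrices are handled
  together: the order of the indices is a parameter.
\<close>
definition tri :: "('n \<Rightarrow> 'n \<Rightarrow> bool) \<Rightarrow> complex^'n^'n \<Rightarrow> bool" where
  "tri Q A \<longleftrightarrow> (\<forall>i j. A $ i $ j \<noteq> 0 \<longrightarrow> Q i j)"

lemma triD: "tri Q A \<Longrightarrow> \<not> Q i j \<Longrightarrow> A $ i $ j = 0"
  by (auto simp: tri_def)

lemma partial_order_rel_le [simp]:
  "partial_order_rel ((\<le>) :: 'n::order \<Rightarrow> _)" "partial_order_rel ((\<ge>) :: 'n::order \<Rightarrow> _)"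
  by (auto simp: partial_order_rel_def)

lemma partial_order_rel_inj:
  assumes "inj f" "partial_order_rel Q"
  shows "partial_order_rel (\<lambda>i j. Q (f i) (f j))"
  using assms by (auto simp: partial_order_rel_def inj_def)

lemma partial_order_rel_maximal:
  assumes "finite S" "S \<noteq> {}" "partial_order_rel Q"
  shows "\<exists>m\<in>S. \<forall>k\<in>S. Q m k \<longrightarrow> k = m"
  using assms(1,2)
proof (induction S rule: finite_ne_induct)
  case (insert x F)
  then obtain m where m: "m \<in> F" "\<forall>k\<in>F. Q m k \<longrightarrow> k = m" by blast
  show ?case
  proof (cases "Q m x")
    case True
    then have "\<forall>k\<in>insert x F. Q x k \<longrightarrow> k = x"
      using m assms(3) unfolding partial_order_rel_def by blast
    then show ?thesis by blast
  next
    case False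
    then show ?thesis using m by blast
  qed
qed simp

text \<open>
  Back substitution: the equations of a triangular system that belong to an up-closed set of rows
  only involve the unknowns of that set.
\<close>

lemma tri_back_substitution:
  fixes A :: "complex^'n^'n"
  assumes Q: "partial_order_rel Q" and A: "tri Q A" "\<And>i. A $ i $ i \<noteq> 0"
    and Z: "\<And>i k. i \<in> Z \<Longrightarrow> Q i k \<Longrightarrow> k \<in> Z"
    and eq: "\<And>i. i \<in> Z \<Longrightarrow> (A *v y) $ i = 0" and "i \<in> Z"
  shows "y $ i = 0"
proof (rule ccontr)
  assume "y $ i \<noteq> 0"
  then obtain m where m: "m \<in> Z" "y $ m \<noteq> 0" "\<forall>k\<in>{k\<in>Z. y $ k \<noteq> 0}. Q m k \<longrightarrow> k = m"
    using partial_order_rel_maximal[of "{k\<in>Z. y $ k \<noteq> 0}" Q] Q \<open>i \<in> Z\<close> by auto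
  have "A $ m $ k * y $ k = 0" if "k \<noteq> m" for k
  proof (rule ccontr)
    assume "\<not> ?thesis"
    then have "Q m k" "y $ k \<noteq> 0" using A(1) by (auto simp: tri_def)
    then show False using m(3) Z[OF m(1)] that by blast
  qed
  then have "(A *v y) $ m = A $ m $ m * y $ m"
    by (simp add: matrix_vector_mult_def sum.remove[of UNIV m] sum.neutral del: mult_eq_0_iff)
  then show False using eq[OF m(1)] A(2)[of m] m(2) by simp
qed

lemma matrix_add_rdistrib: "(A + B) ** C = A ** C + (B ** C :: ('n::finite) cmat)"
  by (simp add: vec_eq_iff matrix_matrix_mult_def sum.distrib distrib_right)

lemma matrix_diff_ldistrib: "C ** (A - B) = C ** A - (C ** B :: ('n::finite) cmat)"
  by (simp add: vec_eq_iff matrix_matrix_mult_def sum_subtractf right_diff_distrib)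

lemma matrix_diff_rdistrib: "(A - B) ** C = A ** C - (B ** C :: ('n::finite) cmat)"
  by (simp add: vec_eq_iff matrix_matrix_mult_def sum_subtractf left_diff_distrib)

lemma matrix_uminus_mult: "(- A) ** B = - (A ** B :: ('n::finite) cmat)"
  by (simp add: vec_eq_iff matrix_matrix_mult_def sum_negf)

lemma sum_if_outside:
  fixes f :: "'n::finite \<Rightarrow> complex"
  shows "(\<Sum>x\<in>UNIV. if Z then f x else 0) = (if Z then \<Sum>x\<in>UNIV. f x else 0)"
  by simp

lemma matrix_vector_column: "(A *v (\<chi> k. B $ k $ j)) $ i = (A ** B) $ i $ j"
  by (simp add: matrix_vector_mult_def matrix_matrix_mult_def)

lemma tri_mult:
  assumes "partial_order_rel Q" "tri Q A" "tri Q B"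
  shows "tri Q (A ** B)" and "(A ** B) $ i $ i = A $ i $ i * B $ i $ i"
proof -
  show "tri Q (A ** B)"
    unfolding tri_def
  proof (intro allI impI)
    fix i j
    assume "(A ** B) $ i $ j \<noteq> 0"
    then have "(\<Sum>k\<in>UNIV. A $ i $ k * B $ k $ j) \<noteq> 0"
      by (simp add: matrix_matrix_mult_def)
    then obtain k where "A $ i $ k * B $ k $ j \<noteq> 0"
      by (rule sum.not_neutral_contains_not_neutral)
    then show "Q i j" using assms unfolding partial_order_rel_def tri_def by (metis mult_eq_0_iff)
  qed
  have "A $ i $ k * B $ k $ i = 0" if "k \<noteq> i" for k
    using assms that unfolding partial_order_rel_def tri_def by (metis mult_eq_0_iff)
  then show "(A ** B) $ i $ i = A $ i $ i * B $ i $ i"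
    by (simp add: matrix_matrix_mult_def sum.remove[of UNIV i] sum.neutral del: mult_eq_0_iff)
qed

lemma inverse_matrix:
  fixes A :: "'a::field^'n^'n"
  assumes "invertible A"
  shows "A ** matrix_inv A = mat 1" "matrix_inv A ** A = mat 1"
proof -
  have "A ** matrix_inv A = mat 1 \<and> matrix_inv A ** A = mat 1"
    unfolding matrix_inv_def by (rule someI_ex) (use assms in \<open>auto simp: invertible_def\<close>)
  then show "A ** matrix_inv A = mat 1" "matrix_inv A ** A = mat 1" by auto
qed

lemma matrix_inv_eqI:
  fixes A :: "'a::field^'n^'n"
  assumes "A ** B = mat 1"
  shows "matrix_inv A = B"
proof -
  have "invertible A" using assms by (auto simp: invertible_right_inverse)
  have "matrix_inv A = matrix_inv A ** (A ** B)" using assms by simp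
  also have "\<dots> = B" using inverse_matrix(2)[OF \<open>invertible A\<close>] by (simp add: matrix_mul_assoc)
  finally show ?thesis .
qed

lemma invertible_matrix_inv:
  fixes A :: "'a::field^'n^'n"
  shows "invertible A \<Longrightarrow> invertible (matrix_inv A)"
  using inverse_matrix invertible_def by blast

lemma matrix_inv_mult:
  fixes A B :: "'a::field^'n^'n"
  assumes "invertible A" "invertible B"
  shows "matrix_inv (A ** B) = matrix_inv B ** matrix_inv A"
  by (rule matrix_inv_eqI)
    (metis assms inverse_matrix(1) matrix_mul_assoc matrix_mul_rid)

lemma matrix_inv_inv:
  fixes A :: "'a::field^'n^'n"
  shows "invertible A \<Longrightarrow> matrix_inv (matrix_inv A) = A"
  by (simp add: inverse_matrix matrix_inv_eqI)

lemma matrix_cancel: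
  fixes A X :: "'a::field^'n^'n"
  assumes "invertible A"
  shows "A ** (matrix_inv A ** X) = X" "matrix_inv A ** (A ** X) = X"
    "X ** A ** matrix_inv A = X" "X ** matrix_inv A ** A = X"
  by (simp_all only: matrix_mul_assoc inverse_matrix[OF assms] matrix_mul_lid)
    (simp_all only: matrix_mul_assoc[symmetric] inverse_matrix[OF assms] matrix_mul_rid)

lemma mult_inverse_both:
  fixes A u v q :: "'a::field^'n^'n"
  assumes "invertible u" "invertible v" "A = u ** q ** v"
  shows "q = matrix_inv u ** A ** matrix_inv v"
proof -
  have "matrix_inv u ** (u ** (q ** v)) ** matrix_inv v = q"
    by (simp only: matrix_cancel[OF assms(1)] matrix_cancel[OF assms(2)])
  then show ?thesis by (simp add: assms(3) matrix_mul_assoc)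
qed

lemma matrix_solve:
  fixes A n B :: "'a::field^'n^'n"
  assumes "invertible n"
  shows "n ** A = B \<Longrightarrow> A = matrix_inv n ** B" "A ** n = B \<Longrightarrow> A = B ** matrix_inv n"
  using matrix_cancel[OF assms, of A] by auto

lemma tri_invertible:
  fixes A :: "complex^'n^'n"
  assumes "partial_order_rel Q" "tri Q A" "\<And>i. A $ i $ i \<noteq> 0"
  shows "invertible A"
proof -
  have "y = 0" if "A *v y = 0" for y
    using tri_back_substitution[OF assms, of UNIV y] that by (auto simp: vec_eq_iff)
  then show ?thesis
    using invertible_left_inverse matrix_left_invertible_ker by blast
qed

lemma tri_inverse:
  fixes A :: "complex^'n^'n"
  assumes "partial_order_rel Q" "tri Q A" "\<And>i. A $ i $ i \<noteq> 0"
  shows "tri Q (matrix_inv A)" and "matrix_inv A $ i $ i = 1 / A $ i $ i"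
proof -
  note inv = inverse_matrix[OF tri_invertible[OF assms]]
  show tri: "tri Q (matrix_inv A)"
    unfolding tri_def
  proof (intro allI impI, rule ccontr)
    fix i j
    assume *: "matrix_inv A $ i $ j \<noteq> 0" "\<not> Q i j"
    have "(\<chi> k. matrix_inv A $ k $ j) $ i = 0"
    proof (rule tri_back_substitution[OF assms, of "{k. \<not> Q k j}"])
      show "(A *v (\<chi> k. matrix_inv A $ k $ j)) $ k = 0" if "k \<in> {k. \<not> Q k j}" for k
        unfolding matrix_vector_column inv
        using that assms(1) by (auto simp: mat_def partial_order_rel_def)
    qed (use * assms(1) in \<open>auto simp: partial_order_rel_def\<close>)
    then show False using * by simp
  qed
  have "A $ i $ i * matrix_inv A $ i $ i = 1"
    using tri_mult(2)[OF assms(1,2) tri, of i] inv by (simp add: mat_def)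
  then show "matrix_inv A $ i $ i = 1 / A $ i $ i" 
    using assms(3)[of i] by (intro eq_divide_imp) (simp_all add: mult.commute)
qed

lemma tri_mat [simp]: "partial_order_rel Q \<Longrightarrow> tri Q (mat c)"
  by (auto simp: tri_def mat_def partial_order_rel_def)

lemma tri_add: "tri Q A \<Longrightarrow> tri Q B \<Longrightarrow> tri Q (A + B)"
  by (force simp: tri_def)

lemma tri_diff: "tri Q A \<Longrightarrow> tri Q B \<Longrightarrow> tri Q (A - B)"
  by (force simp: tri_def)

lemma tri_uminus: "tri Q A \<Longrightarrow> tri Q (- A)"
  by (force simp: tri_def)

abbreviation upper :: "('n::{finite,linorder}) cmat \<Rightarrow> bool" where "upper \<equiv> tri (\<le>)"
abbreviation lower :: "('n::{finite,linorder}) cmat \<Rightarrow> bool" where "lower \<equiv> tri (\<ge>)"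

definition diagm :: "('n \<Rightarrow> complex) \<Rightarrow> complex^'n^'n" where
  "diagm d = (\<chi> i j. if i = j then d i else 0)"

lemma diagm_nth [simp]: "diagm d $ i $ j = (if i = j then d i else 0)"
  by (simp add: diagm_def)

lemma diagm_mult [simp]:
  "(diagm d ** A) $ i $ j = d i * A $ i $ j" "(A ** diagm d) $ i $ j = A $ i $ j * d j"
  by (simp_all add: matrix_matrix_mult_def if_distrib if_distribR cong: if_cong)

lemma diagm_diagm: "diagm d ** diagm e = diagm (\<lambda>i. d i * e i)"
  by (simp add: vec_eq_iff)

lemma diagm_one: "diagm (\<lambda>i. 1) = mat 1"
  by (simp add: vec_eq_iff mat_def)

lemma tri_diagm [simp]: "partial_order_rel Q \<Longrightarrow> tri Q (diagm d)"
  by (auto simp: tri_def partial_order_rel_def)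

lemma diagm_inverse: "(\<And>i. d i \<noteq> 0) \<Longrightarrow> diagm d ** diagm (\<lambda>i. 1 / d i) = mat 1"
  by (simp add: diagm_diagm flip: diagm_one)

lemma diagm_inverse': "(\<And>i. d i \<noteq> 0) \<Longrightarrow> diagm (\<lambda>i. 1 / d i) ** diagm d = mat 1"
  by (simp add: diagm_diagm flip: diagm_one)

lemma upperD: "upper A \<Longrightarrow> j < i \<Longrightarrow> A $ i $ j = 0"
  by (meson triD not_le)

lemma lowerD: "lower A \<Longrightarrow> i < j \<Longrightarrow> A $ i $ j = 0"
  by (meson triD not_le)

text \<open>
  Let \<open>B\<close> be the inverse of \<open>A\<close>. From the left to the right, column \<open>m\<close> of \<open>B ** A = mat 1\<close> shows that
  \<open>A $ m $ m\<close> does not vanish, and then that \<open>B\<close> has no entries below the diagonal in this column.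
\<close>

lemma upper_invertible_diag:
  fixes A :: "('n::{finite,linorder}) cmat"
  assumes A: "upper A" "invertible A"
  shows "A $ i $ i \<noteq> 0"
proof -
  define B where "B = matrix_inv A"
  define good where "good j \<longleftrightarrow> (\<forall>i\<ge>j. B $ i $ j * A $ j $ j = (if i = j then 1 else 0))" for j
  have "good j" for j
  proof (rule ccontr)
    assume "\<not> good j"
    then have ne: "{j. \<not> good j} \<noteq> {}" by blast
    define m where "m = Min {j. \<not> good j}"
    have less: "good k" if "k < m" for k
    proof (rule ccontr)
      assume "\<not> good k"
      then have "m \<le> k" unfolding m_def by (intro Min_le) auto
      then show False using that by simp
    qed
    have "good m"
      unfolding good_def
    proof (intro allI impI)
      fix i assume i: "m \<le> i"
      have "B $ i $ k * A $ k $ m = 0" if "k \<noteq> m" for k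
      proof (cases "k < m")
        case True
        then have k: "B $ k $ k * A $ k $ k = 1" "B $ i $ k * A $ k $ k = 0"
          using less[OF True] i by (auto simp: good_def)
        then show ?thesis by auto
      next
        case False
        then show ?thesis using that upperD[OF A(1), of m k] by simp
      qed
      then have "(B ** A) $ i $ m = B $ i $ m * A $ m $ m"
        by (simp add: matrix_matrix_mult_def sum.remove[of UNIV m] sum.neutral del: mult_eq_0_iff)
      then show "B $ i $ m * A $ m $ m = (if i = m then 1 else 0)"
        using inverse_matrix(2)[OF A(2)] by (simp add: B_def mat_def)
    qed
    then show False using Min_in[OF _ ne] by (simp add: m_def)
  qed
  then have "B $ i $ i * A $ i $ i = 1" by (simp add: good_def)
  then show ?thesis by auto
qed

lemma lower_invertible_diag:
  fixes A :: "('n::{finite,linorder}) cmat"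
  assumes "lower A" "invertible A"
  shows "A $ i $ i \<noteq> 0"
  using upper_invertible_diag[of "transpose A" i] assms
  by (auto simp: tri_def transpose_def invertible_det_nz simp flip: det_transpose[of A])

lemma B_plus_iff: "A \<in> B_plus \<longleftrightarrow> upper A \<and> (\<forall>i. A $ i $ i \<noteq> 0)"
proof -
  have "(\<forall>i j. j < i \<longrightarrow> A $ i $ j = 0) \<longleftrightarrow> upper A"
    by (auto simp: tri_def) (meson leI linorder_not_le)+
  then show ?thesis
    using upper_invertible_diag[of A] tri_invertible[of "(\<le>)" A]
    by (auto simp: B_plus_def GL_def)
qed

lemma B_minus_iff: "A \<in> B_minus \<longleftrightarrow> lower A \<and> (\<forall>i. A $ i $ i \<noteq> 0)"
proof -
  have "(\<forall>i j. i < j \<longrightarrow> A $ i $ j = 0) \<longleftrightarrow> lower A"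
    by (auto simp: tri_def) (meson leI linorder_not_le)+
  then show ?thesis
    using lower_invertible_diag[of A] tri_invertible[of "(\<ge>)" A]
    by (auto simp: B_minus_def GL_def)
qed

lemma B_plusI: "upper A \<Longrightarrow> invertible A \<Longrightarrow> A \<in> B_plus"
  by (auto simp: B_plus_def GL_def upperD)

lemma upper_lower_eq:
  assumes "upper A" "lower B" "A = B"
  shows "A = diagm (\<lambda>i. A $ i $ i)"
  using assms by (auto simp: vec_eq_iff tri_def) (metis order_antisym)

section \<open>Permutation matrices\<close>

lemma perm_mult_left:
  assumes "p permutes UNIV"
  shows "(permutation_matrix p ** A) $ i $ j = A $ inv p i $ j"
proof -
  have "(if i = p k then 1 else 0) * A $ k $ j = (if k = inv p i then A $ inv p i $ j else 0)" for k
    using assms by (auto simp: permutes_inverses)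
  then show ?thesis by (simp add: matrix_matrix_mult_def permutation_matrix_def)
qed

lemma perm_mult_right:
  fixes p :: "'n::finite \<Rightarrow> 'n" and A :: "'n cmat"
  shows "(A ** permutation_matrix p) $ i $ j = A $ i $ p j"
  by (simp add: matrix_matrix_mult_def permutation_matrix_def if_distrib if_distribR cong: if_cong)

lemma perm_inverse:
  fixes p :: "'n::finite \<Rightarrow> 'n"
  assumes "p permutes UNIV"
  shows "permutation_matrix p ** permutation_matrix (inv p) = mat 1"
    "permutation_matrix (inv p) ** permutation_matrix p = mat 1"
  unfolding vec_eq_iff perm_mult_right
  by (auto simp: permutation_matrix_def mat_def permutes_inverses[OF assms])

lemma invertible_perm:
  fixes p :: "'n::finite \<Rightarrow> 'n"
  shows "p permutes UNIV \<Longrightarrow> invertible (permutation_matrix p)"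
  using perm_inverse invertible_def by blast

lemma matrix_inv_perm:
  fixes p :: "'n::finite \<Rightarrow> 'n"
  shows "p permutes UNIV \<Longrightarrow> matrix_inv (permutation_matrix p) = permutation_matrix (inv p)"
  using perm_inverse matrix_inv_eqI by blast

text \<open>
  Conjugation by a permutation matrix (\<open>pconj_eq\<close>), written in the form that shows its effect on
  triangularity.
\<close>
definition pconj :: "('n::finite \<Rightarrow> 'n) \<Rightarrow> 'n cmat \<Rightarrow> 'n cmat" where
  "pconj p A = (\<chi> i j. A $ p i $ p j)"

lemma pconj_nth [simp]: "pconj p A $ i $ j = A $ p i $ p j"
  by (simp add: pconj_def)

lemma pconj_eq:
  assumes "p permutes UNIV"
  shows "pconj p A = permutation_matrix (inv p) ** A ** permutation_matrix p"
  by (simp add: vec_eq_iff perm_mult_left perm_mult_right permutes_inv[OF assms] permutes_inv_inv[OF assms])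

lemma perm_pconj:
  assumes "p permutes UNIV"
  shows "permutation_matrix p ** pconj p A = A ** permutation_matrix p"
    "permutation_matrix p ** A = pconj (inv p) A ** permutation_matrix p"
    "permutation_matrix (inv p) ** A = pconj p A ** permutation_matrix (inv p)"
    "A ** permutation_matrix (inv p) = permutation_matrix (inv p) ** pconj (inv p) A"
  using assms permutes_inv[OF assms]
  by (auto simp: vec_eq_iff perm_mult_left perm_mult_right permutes_inverses permutes_inv_inv)

lemma pconj_inv [simp]:
  assumes "p permutes UNIV"
  shows "pconj p (pconj (inv p) A) = A" "pconj (inv p) (pconj p A) = A"
  using assms by (simp_all add: vec_eq_iff permutes_inverses)

lemma tri_pconj: "tri Q A \<Longrightarrow> tri (\<lambda>i j. Q (p i) (p j)) (pconj p A)"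
  by (auto simp: tri_def)

section \<open>The factorization into an upper and a lower triangular matrix\<close>

text \<open>
  The determinant of this matrix is the principal minor of \<open>g\<close> with index set \<open>S\<close>. It is padded to
  full size because the type of a matrix fixes its size.
\<close>
definition pad :: "'n set \<Rightarrow> ('n::finite) cmat \<Rightarrow> 'n cmat" where
  "pad S g = (\<chi> i j. if i \<in> S \<and> j \<in> S then g $ i $ j else if i = j then 1 else 0)"

text \<open>
  The set of products of an invertible upper and an invertible lower triangular matrix. Its
  description by minors shows that it is open and the complement of the zero set of a polynomial.
\<close>
definition big_cell :: "('n::{finite,linorder}) cmat set" where
  "big_cell = {g. det g \<noteq> 0 \<and> (\<forall>j. det (pad {j<..} g) \<noteq> 0)}"

text \<open>
  The unipotent lower triangular matrix for which \<open>g ** ul_lower g\<close> is upper triangular, that is,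
  the inverse of the lower factor of \<open>g\<close> (\<open>ul_lower_unique\<close>).
\<close>
definition ul_lower :: "('n::{finite,linorder}) cmat \<Rightarrow> 'n cmat" where
  "ul_lower g = (\<chi> l j. if l = j then 1 else
    det (\<chi> i k. if k = l then (if j < i then - g $ i $ j else 0) else pad {j<..} g $ i $ k) /
    det (pad {j<..} g))"

definition ul_upper :: "('n::{finite,linorder}) cmat \<Rightarrow> 'n cmat" where
  "ul_upper g = g ** ul_lower g"

lemma pad_mult_vec:
  "(pad S g *v y) $ i = (if i \<in> S then \<Sum>k\<in>S. g $ i $ k * y $ k else y $ i)"
proof (cases "i \<in> S")
  case True
  then have "(pad S g *v y) $ i = (\<Sum>k\<in>UNIV. if k \<in> S then g $ i $ k * y $ k else 0)"
    by (auto simp: matrix_vector_mult_def pad_def intro!: sum.cong)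
  then show ?thesis using True by (simp add: sum.If_cases)
next
  case False
  then have "pad S g $ i $ k * y $ k = (if i = k then y $ k else 0)" for k
    by (simp add: pad_def)
  then show ?thesis using False by (simp add: matrix_vector_mult_def)
qed

lemma mult_lower_unipotent:
  fixes g m :: "('n::{finite,linorder}) cmat"
  assumes "lower m" "m $ j $ j = 1"
  shows "(g ** m) $ i $ j = g $ i $ j + (\<Sum>k\<in>{j<..}. g $ i $ k * m $ k $ j)"
proof -
  have "(g ** m) $ i $ j = (\<Sum>k\<in>UNIV. g $ i $ k * m $ k $ j)"
    by (simp add: matrix_matrix_mult_def)
  also have "\<dots> = (\<Sum>k\<in>insert j {j<..}. g $ i $ k * m $ k $ j)"
    using lowerD[OF assms(1), of _ j]
    by (intro sum.mono_neutral_right) (auto simp: not_less_iff_gr_or_eq)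
  finally show ?thesis using assms(2) by simp
qed

text \<open>
  Column \<open>j\<close> of the lower factor \<open>m\<close> is determined below the diagonal by the requirement that
  the entries of \<open>g ** m\<close> below the diagonal in this column vanish. This is a linear system
  with matrix \<open>pad {j<..} g\<close>, and the definition of the factor is Cramer's rule for it. The rows
  up to \<open>j\<close> of the padded system say that the other entries of the column vanish.
\<close>

lemma ul_lower_unique:
  fixes g :: "('n::{finite,linorder}) cmat"
  assumes "g \<in> big_cell"
  shows "lower m \<and> (\<forall>i. m $ i $ i = 1) \<and> upper (g ** m) \<longleftrightarrow> m = ul_lower g"
proof -
  define rhs where "rhs j = (\<chi> i. if j < i then - g $ i $ j else 0)" for j
  define col where "col m j = (\<chi> i. if i = j then 0 else m $ i $ j)" for m :: "'n cmat" and j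
  define sol where "sol j = (\<chi> l. det (\<chi> i k. if k = l then rhs j $ i else pad {j<..} g $ i $ k) /
    det (pad {j<..} g))" for j
  have cramer: "pad {j<..} g *v y = rhs j \<longleftrightarrow> y = sol j" for j y
    unfolding sol_def using assms by (intro cramer) (simp add: big_cell_def)
  have ul: "ul_lower g $ l $ j = (if l = j then 1 else sol j $ l)" for l j
    by (simp add: ul_lower_def sol_def rhs_def cong: if_cong)
  have sys: "pad {j<..} g *v y = rhs j \<longleftrightarrow>
      (\<forall>i. if j < i then (\<Sum>k\<in>{j<..}. g $ i $ k * y $ k) = - g $ i $ j else y $ i = 0)" for j y
    unfolding vec_eq_iff pad_mult_vec by (auto simp: rhs_def)
  have sum_col: "(\<Sum>k\<in>{j<..}. g $ i $ k * col m j $ k) = (\<Sum>k\<in>{j<..}. g $ i $ k * m $ k $ j)"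
    for i j m by (intro sum.cong) (auto simp: col_def)
  show ?thesis
  proof
    assume m: "lower m \<and> (\<forall>i. m $ i $ i = 1) \<and> upper (g ** m)"
    have col: "col m j = sol j" for j
      unfolding cramer[symmetric] sys sum_col
    proof safe
      fix i
      show "if j < i then (\<Sum>k\<in>{j<..}. g $ i $ k * m $ k $ j) = - g $ i $ j else col m j $ i = 0"
        using m mult_lower_unipotent[of m j g i] triD[of "(\<le>)" "g ** m" i j] triD[of "(\<ge>)" m i j]
        by (auto simp: col_def add_eq_0_iff)
    qed
    then have "sol j $ l = (if l = j then 0 else m $ l $ j)" for l j
    proof -
      have "sol j $ l = col m j $ l" by (simp add: col)
      then show ?thesis by (simp add: col_def)
    qed
    then show "m = ul_lower g"
      using m by (auto simp: vec_eq_iff ul)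
  next
    assume m: "m = ul_lower g"
    have "pad {j<..} g *v sol j = rhs j" for j
      by (simp add: cramer)
    note eqs = this[unfolded sys, rule_format]
    have sol: "sol j $ i = 0" if "i \<le> j" for i j using eqs[of j i] that by (auto simp: not_less)
    have low: "lower m"
      unfolding tri_def m ul using sol by (metis linorder_le_cases order_refl)
    have one: "m $ i $ i = 1" for i
      by (simp add: m ul)
    have "(g ** m) $ i $ j = 0" if "j < i" for i j
    proof -
      have "(\<Sum>k\<in>{j<..}. g $ i $ k * m $ k $ j) = (\<Sum>k\<in>{j<..}. g $ i $ k * sol j $ k)"
        by (intro sum.cong) (auto simp: m ul)
      then show ?thesis
        using mult_lower_unipotent[OF low one, of g i j] eqs[of j i] that by simp
    qed
    then have "upper (g ** m)" by (force simp: tri_def)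
    then show "lower m \<and> (\<forall>i. m $ i $ i = 1) \<and> upper (g ** m)"
      using low one by blast
  qed
qed

lemma ul_lower:
  assumes "g \<in> big_cell"
  shows "lower (ul_lower g)" "ul_lower g $ i $ i = 1" "ul_lower g \<in> B_minus"
    "invertible (ul_lower g)" "upper (ul_upper g)" "ul_upper g \<in> B_plus" "invertible g"
    "ul_upper g $ i $ i \<noteq> 0"
proof -
  have *: "lower (ul_lower g)" "\<And>i. ul_lower g $ i $ i = 1" "upper (ul_upper g)"
    using ul_lower_unique[OF assms, of "ul_lower g"] by (auto simp: ul_upper_def)
  then show "lower (ul_lower g)" "ul_lower g $ i $ i = 1" "upper (ul_upper g)" by auto
  show B: "ul_lower g \<in> B_minus" using * by (simp add: B_minus_iff)
  show g: "invertible g" using assms by (simp add: big_cell_def invertible_det_nz)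
  show inv: "invertible (ul_lower g)" using B by (simp add: B_minus_def GL_def)
  have "invertible (ul_upper g)" unfolding ul_upper_def using g inv by (rule invertible_mult)
  then show "ul_upper g \<in> B_plus"
    using *(3) by (intro B_plusI)
  then show "ul_upper g $ i $ i \<noteq> 0" by (simp add: B_plus_iff)
qed

lemma pad_mult:
  assumes "\<And>i k l. i \<in> S \<Longrightarrow> l \<in> S \<Longrightarrow> k \<notin> S \<Longrightarrow> A $ i $ k * B $ k $ l = 0"
  shows "pad S (A ** B) = pad S A ** pad S B"
proof -
  have "(pad S A ** pad S B) $ i $ l = pad S (A ** B) $ i $ l" for i l
  proof -
    have "(pad S A ** pad S B) $ i $ l =
        (if i \<in> S then \<Sum>k\<in>S. A $ i $ k * pad S B $ k $ l else pad S B $ i $ l)"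
      using pad_mult_vec[of S A "\<chi> k. pad S B $ k $ l" i]
      by (simp add: matrix_vector_column del: vec_lambda_eta)
    also have "\<dots> = pad S (A ** B) $ i $ l"
    proof (cases "i \<in> S \<and> l \<in> S")
      case True
      then have "(A ** B) $ i $ l = (\<Sum>k\<in>S. A $ i $ k * B $ k $ l)"
        unfolding matrix_matrix_mult_def using assms[of i l]
        by (auto intro!: sum.mono_neutral_right)
      then show ?thesis using True by (simp add: pad_def)
    qed (auto simp: pad_def intro!: sum.neutral)
    finally show ?thesis .
  qed
  then show ?thesis by (simp add: vec_eq_iff)
qed

lemma tri_pad: "partial_order_rel Q \<Longrightarrow> tri Q g \<Longrightarrow> tri Q (pad S g)"
  by (auto simp: tri_def pad_def partial_order_rel_def)

lemma det_tri_nonzero: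
  fixes g :: "('n::finite) cmat"
  assumes "partial_order_rel Q" "tri Q g" "\<And>i. g $ i $ i \<noteq> 0"
  shows "det (pad S g) \<noteq> 0" "det g \<noteq> 0"
  using tri_invertible[OF assms] tri_invertible[OF assms(1) tri_pad[OF assms(1,2)], of S] assms(3)
  by (auto simp: invertible_det_nz pad_def)

lemma tri_in_big_cell:
  fixes g :: "('n::{finite,linorder}) cmat"
  assumes "partial_order_rel Q" "tri Q g" "\<And>i. g $ i $ i \<noteq> 0"
  shows "g \<in> big_cell"
  using det_tri_nonzero[OF assms] by (simp add: big_cell_def)

lemma big_cell_mult:
  fixes g b m :: "('n::{finite,linorder}) cmat"
  assumes "g \<in> big_cell"
  shows "b \<in> B_plus \<Longrightarrow> b ** g \<in> big_cell" "m \<in> B_minus \<Longrightarrow> g ** m \<in> big_cell"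
proof -
  show "b ** g \<in> big_cell" if "b \<in> B_plus"
  proof -
    have b: "upper b" "\<And>i. b $ i $ i \<noteq> 0" using that by (auto simp: B_plus_iff)
    have "pad {j<..} (b ** g) = pad {j<..} b ** pad {j<..} g" for j
      by (rule pad_mult) (use upperD[OF b(1)] in \<open>auto simp: not_less\<close>)
    then show ?thesis
      using assms det_tri_nonzero[OF partial_order_rel_le(1) b]
      by (simp add: big_cell_def det_mul)
  qed
  show "g ** m \<in> big_cell" if "m \<in> B_minus"
  proof -
    have m: "lower m" "\<And>i. m $ i $ i \<noteq> 0" using that by (auto simp: B_minus_iff)
    have "pad {j<..} (g ** m) = pad {j<..} g ** pad {j<..} m" for j
      by (rule pad_mult) (use lowerD[OF m(1)] in \<open>auto simp: not_less\<close>)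
    then show ?thesis
      using assms det_tri_nonzero[OF partial_order_rel_le(2) m]
      by (simp add: big_cell_def det_mul)
  qed
qed

lemma ul_lower_eqI:
  assumes "g \<in> big_cell" "lower m" "\<And>i. m $ i $ i = 1" "upper (g ** m)"
  shows "ul_lower g = m"
  using assms ul_lower_unique[of g m] by blast

text \<open>
  If \<open>g\<close> is also triangular for another order \<open>Q\<close>, then the entries of a column of the factor at
  which \<open>Q\<close> requires a zero satisfy a homogeneous triangular system. For a conjugate of a triangular
  matrix by a permutation matrix this means that both factors are conjugates of matrices of the
  same triangular shape.
\<close>

lemma tri_ul_lower:
  fixes g :: "('n::{finite,linorder}) cmat"
  assumes Q: "partial_order_rel Q" and g: "tri Q g" "\<And>i. g $ i $ i \<noteq> 0"
  shows "tri Q (ul_lower g)"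
  unfolding tri_def
proof (intro allI impI, rule ccontr)
  fix i j
  assume *: "ul_lower g $ i $ j \<noteq> 0" "\<not> Q i j"
  have big: "g \<in> big_cell" by (rule tri_in_big_cell[OF Q g])
  define y where "y = (\<chi> k. if k = j then 0 else ul_lower g $ k $ j)"
  have "i \<noteq> j" using * Q by (auto simp: partial_order_rel_def)
  have "y $ i = 0"
  proof (rule tri_back_substitution[OF Q tri_pad[OF Q g(1)], of "{j<..}" "{k. \<not> Q k j}"])
    fix k assume "k \<in> {k. \<not> Q k j}"
    then have k: "g $ k $ j = 0" "k \<noteq> j" using g Q by (auto simp: tri_def partial_order_rel_def)
    show "(pad {j<..} g *v y) $ k = 0"
    proof (cases "j < k")
      case True
      have "(\<Sum>l\<in>{j<..}. g $ k $ l * y $ l) = (\<Sum>l\<in>{j<..}. g $ k $ l * ul_lower g $ l $ j)"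
        by (intro sum.cong) (auto simp: y_def)
      also have "\<dots> = ul_upper g $ k $ j - g $ k $ j"
        unfolding ul_upper_def using mult_lower_unipotent[of "ul_lower g" j g k] ul_lower(1,2)[OF big]
        by simp
      finally show ?thesis
        using True k upperD[OF ul_lower(5)[OF big], of j k] by (simp add: pad_mult_vec)
    next
      case False
      then show ?thesis
        using k lowerD[OF ul_lower(1)[OF big], of k j] by (auto simp: pad_mult_vec y_def not_less)
    qed
  qed (use g Q * in \<open>auto simp: pad_def partial_order_rel_def\<close>)
  then show False using * \<open>i \<noteq> j\<close> by (simp add: y_def)
qed

lemma ul_lower_mult:
  fixes g :: "('n::{finite,linorder}) cmat"
  assumes "g \<in> big_cell"
  shows "b \<in> B_plus \<Longrightarrow> ul_lower (b ** g) = ul_lower g"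
    "lower m \<Longrightarrow> (\<And>i. m $ i $ i = 1) \<Longrightarrow> ul_lower (g ** m) = matrix_inv m ** ul_lower g"
proof -
  note ul = ul_lower[OF assms]
  show "ul_lower (b ** g) = ul_lower g" if "b \<in> B_plus"
    using that ul tri_mult(1)[of "(\<le>)" b "ul_upper g"]
    by (intro ul_lower_eqI big_cell_mult assms)
      (auto simp: B_plus_iff ul_upper_def simp flip: matrix_mul_assoc)
  show "ul_lower (g ** m) = matrix_inv m ** ul_lower g" if m: "lower m" "\<And>i. m $ i $ i = 1"
  proof (rule ul_lower_eqI)
    have "m \<in> B_minus" using m by (simp add: B_minus_iff)
    then show "g ** m \<in> big_cell" using big_cell_mult(2)[OF assms] by blast
    have inv: "invertible m" "lower (matrix_inv m)" "matrix_inv m $ i $ i = 1" for i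
      using tri_inverse[OF partial_order_rel_le(2) m(1)] tri_invertible[OF partial_order_rel_le(2) m(1)]
        m(2) by auto
    show "lower (matrix_inv m ** ul_lower g)" "(matrix_inv m ** ul_lower g) $ i $ i = 1" for i
      using tri_mult[OF partial_order_rel_le(2) inv(2) ul(1)] inv(3) ul(2) by auto
    have "g ** m ** (matrix_inv m ** ul_lower g) = ul_upper g"
      unfolding ul_upper_def by (metis inv(1) inverse_matrix(1) matrix_mul_assoc matrix_mul_rid)
    then show "upper (g ** m ** (matrix_inv m ** ul_lower g))" using ul(5) by simp
  qed
qed


section \<open>Complex differentiability\<close>

text \<open>
  Holomorphy in several variables: real differentiability with a complex linear derivative. The
  scalar version is closed under the arithmetic operations and is used for the matrix entries.
\<close>
definition cdiff :: "(('n::finite) cmat \<Rightarrow> complex) \<Rightarrow> 'n cmat \<Rightarrow> bool" where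
  "cdiff f x \<longleftrightarrow> (\<exists>D. (f has_derivative D) (at x) \<and> (\<forall>c y. D (cscale c y) = c * D y))"

definition mdiff :: "(('n::finite) cmat \<Rightarrow> 'n cmat) \<Rightarrow> 'n cmat \<Rightarrow> bool" where
  "mdiff F x \<longleftrightarrow>
    (\<exists>D. (F has_derivative D) (at x) \<and> (\<forall>c y. D (cscale c y) = cscale c (D y)))"

lemma cscale_nth [simp]: "cscale c A $ i $ j = c * A $ i $ j"
  by (simp add: cscale_def)

lemma scaleR_cscale: "a *\<^sub>R A = cscale (of_real a) A"
  unfolding vec_eq_iff vector_scaleR_component cscale_nth by (simp add: scaleR_conv_of_real)

lemma cdiff_const [intro, simp]: "cdiff (\<lambda>x. c) x"
  unfolding cdiff_def by (rule exI[of _ "\<lambda>_. 0"]) auto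

lemma bounded_linear_entry: "bounded_linear (\<lambda>x::('n::finite) cmat. x $ i $ j)"
  using bounded_linear_compose[OF bounded_linear_vec_nth bounded_linear_vec_nth] .

lemma cdiff_entry [intro, simp]: "cdiff (\<lambda>x. x $ i $ j) x"
  unfolding cdiff_def
  by (rule exI[of _ "\<lambda>x. x $ i $ j"])
    (auto intro: bounded_linear_imp_has_derivative bounded_linear_entry)

lemma cdiff_add [intro]: "cdiff f x \<Longrightarrow> cdiff g x \<Longrightarrow> cdiff (\<lambda>x. f x + g x) x"
  unfolding cdiff_def
  apply (elim exE conjE)
  subgoal for D D' by (rule exI[of _ "\<lambda>y. D y + D' y"]) (auto intro: derivative_eq_intros simp: algebra_simps)
  done

lemma cdiff_minus [intro]: "cdiff f x \<Longrightarrow> cdiff (\<lambda>x. - f x) x"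
  unfolding cdiff_def
  apply (elim exE conjE)
  subgoal for D by (rule exI[of _ "\<lambda>y. - D y"]) (auto intro: derivative_eq_intros simp: algebra_simps)
  done

lemma cdiff_diff [intro]: "cdiff f x \<Longrightarrow> cdiff g x \<Longrightarrow> cdiff (\<lambda>x. f x - g x) x"
  using cdiff_add[of f x "\<lambda>x. - g x"] by (simp add: cdiff_minus)

lemma cdiff_mult [intro]: "cdiff f x \<Longrightarrow> cdiff g x \<Longrightarrow> cdiff (\<lambda>x. f x * g x) x"
  unfolding cdiff_def
  apply (elim exE conjE)
  subgoal for D D' by (rule exI[of _ "\<lambda>y. f x * D' y + D y * g x"]) (auto intro: derivative_eq_intros simp: algebra_simps)
  done

lemma cdiff_sum [intro]: "(\<And>i. i \<in> I \<Longrightarrow> cdiff (f i) x) \<Longrightarrow> cdiff (\<lambda>x. \<Sum>i\<in>I. f i x) x"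
  by (induction I rule: infinite_finite_induct) auto

lemma cdiff_prod [intro]: "(\<And>i. i \<in> I \<Longrightarrow> cdiff (f i) x) \<Longrightarrow> cdiff (\<lambda>x. \<Prod>i\<in>I. f i x) x"
  by (induction I rule: infinite_finite_induct) auto

lemma cdiff_compose_field:
  assumes "cdiff f x" "(g has_field_derivative d) (at (f x))"
  shows "cdiff (\<lambda>x. g (f x)) x"
proof -
  obtain D where D: "(f has_derivative D) (at x)" "\<And>c y. D (cscale c y) = c * D y"
    using assms(1) by (auto simp: cdiff_def)
  have "((\<lambda>x. g (f x)) has_derivative (\<lambda>y. d * D y)) (at x)"
    using has_derivative_compose[OF D(1) assms(2)[unfolded has_field_derivative_def]] .
  then show ?thesis unfolding cdiff_def using D(2) by (intro exI) (auto simp: algebra_simps)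
qed

lemma cdiff_inverse: "cdiff f x \<Longrightarrow> f x \<noteq> 0 \<Longrightarrow> cdiff (\<lambda>x. inverse (f x)) x"
  by (erule cdiff_compose_field) (rule DERIV_inverse)

lemma cdiff_divide [intro]: "cdiff f x \<Longrightarrow> cdiff g x \<Longrightarrow> g x \<noteq> 0 \<Longrightarrow> cdiff (\<lambda>x. f x / g x) x"
  by (simp add: divide_inverse cdiff_mult cdiff_inverse)

lemma cdiff_exp [intro]: "cdiff f x \<Longrightarrow> cdiff (\<lambda>x. exp (f x)) x"
  by (erule cdiff_compose_field) (rule DERIV_exp)

lemma cdiff_Ln: "cdiff f x \<Longrightarrow> f x \<notin> \<real>\<^sub>\<le>\<^sub>0 \<Longrightarrow> cdiff (\<lambda>x. Ln (f x)) x"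
  by (erule cdiff_compose_field) (rule has_field_derivative_Ln)

lemma cdiff_if [intro]:
  "(P \<Longrightarrow> cdiff f x) \<Longrightarrow> (\<not> P \<Longrightarrow> cdiff g x) \<Longrightarrow> cdiff (\<lambda>x. if P then f x else g x) x"
  by (cases P) auto

lemma cdiff_isCont: "cdiff f x \<Longrightarrow> isCont f x"
  by (auto simp: cdiff_def intro: has_derivative_continuous)

lemma mdiff_isCont: "mdiff f x \<Longrightarrow> isCont f x"
  by (auto simp: mdiff_def intro: has_derivative_continuous)

lemma has_derivative_matrix_iff:
  fixes F :: "'a::real_normed_vector \<Rightarrow> ('n::finite) cmat"
  shows "(F has_derivative D) (at x within S) \<longleftrightarrow>
    (\<forall>i j. ((\<lambda>y. F y $ i $ j) has_derivative (\<lambda>y. D y $ i $ j)) (at x within S))"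
proof
  assume "(F has_derivative D) (at x within S)"
  then show "\<forall>i j. ((\<lambda>y. F y $ i $ j) has_derivative (\<lambda>y. D y $ i $ j)) (at x within S)"
    using bounded_linear.has_derivative[OF bounded_linear_entry] by blast
next
  assume *: "\<forall>i j. ((\<lambda>y. F y $ i $ j) has_derivative (\<lambda>y. D y $ i $ j)) (at x within S)"
  define E where "E i j c = (\<chi> k l. if k = i \<and> l = j then c else 0)" for i j :: 'n and c :: complex
  have E: "bounded_linear (E i j)" for i j
    by (rule linear_conv_bounded_linear[THEN iffD1], rule linearI)
      (auto simp: E_def vec_eq_iff)
  have sum: "A = (\<Sum>i\<in>UNIV. \<Sum>j\<in>UNIV. E i j (A $ i $ j))" for A :: "'n cmat"
  proof -
    have "(\<Sum>i\<in>UNIV. \<Sum>j\<in>UNIV. E i j (A $ i $ j)) $ k $ l = A $ k $ l" for k l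
    proof -
      have "E i j (A $ i $ j) $ k $ l = (if k = i then if l = j then A $ k $ l else 0 else 0)" for i j
        by (simp add: E_def)
      then show ?thesis by (simp add: sum_if_outside)
    qed
    then show ?thesis by (simp add: vec_eq_iff)
  qed
  have "((\<lambda>y. \<Sum>i\<in>UNIV. \<Sum>j\<in>UNIV. E i j (F y $ i $ j)) has_derivative
      (\<lambda>y. \<Sum>i\<in>UNIV. \<Sum>j\<in>UNIV. E i j (D y $ i $ j))) (at x within S)"
    using * by (intro has_derivative_sum bounded_linear.has_derivative[OF E]) auto
  then show "(F has_derivative D) (at x within S)"
    by (simp flip: sum)
qed

lemma mdiff_iff: "mdiff F x \<longleftrightarrow> (\<forall>i j. cdiff (\<lambda>y. F y $ i $ j) x)"
proof
  assume "mdiff F x"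
  then obtain D where D: "(F has_derivative D) (at x)" "\<And>c y. D (cscale c y) = cscale c (D y)"
    unfolding mdiff_def by auto
  show "\<forall>i j. cdiff (\<lambda>y. F y $ i $ j) x"
    unfolding cdiff_def
  proof (intro allI exI conjI)
    fix i j
    show "((\<lambda>y. F y $ i $ j) has_derivative (\<lambda>y. D y $ i $ j)) (at x)"
      using D(1) has_derivative_matrix_iff by blast
  qed (simp add: D(2))
next
  assume "\<forall>i j. cdiff (\<lambda>y. F y $ i $ j) x"
  then obtain D where D: "\<And>i j. ((\<lambda>y. F y $ i $ j) has_derivative D i j) (at x)"
    "\<And>i j c y. D i j (cscale c y) = c * D i j y"
    unfolding cdiff_def by metis
  have "(F has_derivative (\<lambda>y. \<chi> i j. D i j y)) (at x)"
    unfolding has_derivative_matrix_iff using D(1) by simp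
  then show "mdiff F x"
    unfolding mdiff_def by (intro exI) (auto simp: vec_eq_iff D(2))
qed

lemma cdiff_compose:
  assumes "mdiff F x" "cdiff f (F x)"
  shows "cdiff (\<lambda>x. f (F x)) x"
proof -
  obtain D where D: "(F has_derivative D) (at x)" "\<And>c y. D (cscale c y) = cscale c (D y)"
    using assms(1) by (auto simp: mdiff_def)
  obtain D' where D': "(f has_derivative D') (at (F x))" "\<And>c y. D' (cscale c y) = c * D' y"
    using assms(2) by (auto simp: cdiff_def)
  have "((\<lambda>x. f (F x)) has_derivative (\<lambda>y. D' (D y))) (at x)"
    using has_derivative_compose[OF D(1) D'(1)] .
  then show ?thesis unfolding cdiff_def using D(2) D'(2) by (intro exI) auto
qed

lemma mdiff_compose: "mdiff F x \<Longrightarrow> mdiff G (F x) \<Longrightarrow> mdiff (\<lambda>x. G (F x)) x"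
  unfolding mdiff_iff[of G] mdiff_iff[of "\<lambda>x. G (F x)"] using cdiff_compose by blast

lemma mdiff_entry: "mdiff F x \<Longrightarrow> cdiff (\<lambda>x. F x $ i $ j) x"
  by (simp add: mdiff_iff)

lemma mdiff_ident [intro, simp]: "mdiff (\<lambda>x. x) x"
  by (simp add: mdiff_iff)

lemma mdiff_const [intro, simp]: "mdiff (\<lambda>x. A) x"
  by (simp add: mdiff_iff)

lemma mdiff_add [intro]: "mdiff F x \<Longrightarrow> mdiff G x \<Longrightarrow> mdiff (\<lambda>x. F x + G x) x"
  by (auto simp: mdiff_iff)

lemma mdiff_diff [intro]: "mdiff F x \<Longrightarrow> mdiff G x \<Longrightarrow> mdiff (\<lambda>x. F x - G x) x"
  by (auto simp: mdiff_iff)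

lemma mdiff_mult [intro]: "mdiff F x \<Longrightarrow> mdiff G x \<Longrightarrow> mdiff (\<lambda>x. F x ** G x) x"
  unfolding mdiff_iff matrix_matrix_mult_def
  by (auto intro!: cdiff_sum cdiff_mult)

lemma mdiff_diagm [intro]: "(\<And>i. cdiff (d i) x) \<Longrightarrow> mdiff (\<lambda>x. diagm (\<lambda>i. d i x)) x"
  unfolding mdiff_iff by auto

lemma mdiff_pconj [intro]: "mdiff F x \<Longrightarrow> mdiff (\<lambda>x. pconj p (F x)) x"
  by (auto simp: mdiff_iff)

lemma cdiff_det [intro]: "mdiff F x \<Longrightarrow> cdiff (\<lambda>x. det (F x)) x"
  unfolding det_def by (intro cdiff_sum cdiff_mult cdiff_prod cdiff_const mdiff_entry)

lemma mdiff_pad [intro]: "mdiff F x \<Longrightarrow> mdiff (\<lambda>x. pad S (F x)) x"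
  unfolding mdiff_iff pad_def by (auto intro!: cdiff_if)

lemma mdiff_ul_lower:
  fixes F :: "('n::{finite,linorder}) cmat \<Rightarrow> 'n cmat"
  assumes "mdiff F x" "F x \<in> big_cell"
  shows "mdiff (\<lambda>x. ul_lower (F x)) x"
proof -
  have F: "cdiff (\<lambda>x. F x $ i $ j) x" for i j using assms(1) by (simp add: mdiff_iff)
  have pad: "mdiff (\<lambda>x. pad {j<..} (F x)) x" for j by (rule mdiff_pad[OF assms(1)])
  have num: "mdiff (\<lambda>x. \<chi> i k. if k = l then (if j < i then - F x $ i $ j else 0)
      else pad {j<..} (F x) $ i $ k) x" for l j
    unfolding mdiff_iff
  proof (intro allI)
    fix i k
    show "cdiff (\<lambda>y. (\<chi> i k. if k = l then (if j < i then - F y $ i $ j else 0)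
        else pad {j<..} (F y) $ i $ k) $ i $ k) x"
      using F mdiff_entry[OF pad] by (cases "k = l"; cases "j < i") auto
  qed
  have "cdiff (\<lambda>x. ul_lower (F x) $ l $ j) x" for l j
  proof (cases "l = j")
    case False
    then show ?thesis
      using assms(2) pad num[of l j]
      by (auto simp: ul_lower_def big_cell_def intro!: cdiff_divide cdiff_det)
  qed (simp add: ul_lower_def)
  then show ?thesis by (simp add: mdiff_iff)
qed

lemma mdiff_ul_upper:
  fixes F :: "('n::{finite,linorder}) cmat \<Rightarrow> 'n cmat"
  assumes "mdiff F x" "F x \<in> big_cell"
  shows "mdiff (\<lambda>x. ul_upper (F x)) x"
  unfolding ul_upper_def by (intro mdiff_mult mdiff_ul_lower assms)

lemma matrix_inv_cramer:
  fixes A :: "('n::finite) cmat"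
  assumes "invertible A"
  shows "matrix_inv A $ l $ j =
    det (\<chi> i k. if k = l then (if i = j then 1 else 0) else A $ i $ k) / det A"
proof -
  have "A *v (\<chi> k. matrix_inv A $ k $ j) = (\<chi> i. if i = j then 1 else 0)"
    unfolding vec_eq_iff matrix_vector_column inverse_matrix[OF assms] by (simp add: mat_def)
  then have *: "(\<chi> k. matrix_inv A $ k $ j) =
      (\<chi> l. det (\<chi> i k. if k = l then (\<chi> i. if i = j then 1 else 0) $ i else A $ i $ k) / det A)"
    using assms by (subst (asm) cramer) (auto simp: invertible_det_nz)
  show ?thesis using arg_cong[OF *, of "\<lambda>v. v $ l"] by (simp cong: if_cong)
qed

lemma open_continuous_preimage:
  assumes "open S" "\<And>x. x \<in> S \<Longrightarrow> isCont f x" "open T"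
  shows "open {x \<in> S. f x \<in> T}"
proof -
  have "continuous_on S f" using assms(2) continuous_at_imp_continuous_on by blast
  then have "open (S \<inter> f -` T)" using assms(1,3) continuous_open_preimage by blast
  then show ?thesis by (simp add: Int_def)
qed

lemma open_GL: "open (GL :: ('n::finite) cmat set)"
proof -
  have "open {A \<in> UNIV :: 'n cmat set. det A \<in> - {0}}"
    by (rule open_continuous_preimage) (auto intro!: cdiff_isCont)
  then show ?thesis by (simp add: GL_def invertible_det_nz)
qed

lemma mdiff_matrix_inv:
  fixes F :: "('n::finite) cmat \<Rightarrow> 'n cmat"
  assumes "mdiff F x" "invertible (F x)"
  shows "mdiff (\<lambda>x. matrix_inv (F x)) x"
proof (rule mdiff_compose[OF assms(1)])
  define A where "A = F x"
  have A: "invertible A" using assms by (simp add: A_def)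
  have "cdiff (\<lambda>X. matrix_inv X $ l $ j) A" for l j
  proof -
    let ?g = "\<lambda>X :: 'n cmat. det (\<chi> i k. if k = l then (if i = j then 1 else 0) else X $ i $ k) / det X"
    have "mdiff (\<lambda>X :: 'n cmat. \<chi> i k. if k = l then (if i = j then 1 else 0) else X $ i $ k) A"
      unfolding mdiff_iff by (auto intro!: cdiff_if)
    then have "cdiff ?g A" using A by (intro cdiff_divide cdiff_det) (auto simp: invertible_det_nz)
    then obtain D where D: "(?g has_derivative D) (at A)" "\<forall>c y. D (cscale c y) = c * D y"
      by (auto simp: cdiff_def)
    have "((\<lambda>X. matrix_inv X $ l $ j) has_derivative D) (at A)"
      using A
      by (intro has_derivative_transform_within_open[OF D(1) open_GL])
        (auto simp: GL_def matrix_inv_cramer)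
    then show ?thesis using D(2) by (auto simp: cdiff_def)
  qed
  then show "mdiff matrix_inv (F x)" by (simp add: mdiff_iff A_def)
qed

lemma open_big_cell: "open (big_cell :: ('n::{finite,linorder}) cmat set)"
proof -
  have *: "open {A \<in> UNIV :: 'n cmat set. f A \<in> - {0}}" if "\<And>A. cdiff f A" for f
    by (rule open_continuous_preimage) (use that in \<open>auto intro: cdiff_isCont\<close>)
  have "open {A :: 'n cmat. det A \<noteq> 0}"
    using *[of det] cdiff_det[OF mdiff_ident] by auto
  moreover have "open {A :: 'n cmat. det (pad {j<..} A) \<noteq> 0}" for j
    using *[of "\<lambda>A. det (pad {j<..} A)"] cdiff_det[OF mdiff_pad[OF mdiff_ident]] by auto
  then have "open (\<Inter>j\<in>UNIV. {A :: 'n cmat. det (pad {j<..} A) \<noteq> 0})"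
    by (intro open_INT) auto
  moreover have "big_cell = {A :: 'n cmat. det A \<noteq> 0} \<inter> (\<Inter>j\<in>UNIV. {A. det (pad {j<..} A) \<noteq> 0})"
    by (auto simp: big_cell_def)
  ultimately show ?thesis by (metis open_Int)
qed


section \<open>Linear differential equations and linear systems of constant rank\<close>

lemma integral_in_subspace:
  fixes g :: "real \<Rightarrow> 'a::euclidean_space"
  assumes "subspace V" "g integrable_on S" "\<And>s. s \<in> S \<Longrightarrow> g s \<in> V"
  shows "integral S g \<in> V"
proof -
  have "orthogonal y (integral S g)" if "y \<in> V\<^sup>\<bottom>" for y
  proof -
    have "y \<bullet> integral S g = integral S ((\<bullet>) y \<circ> g)"
      using assms(2) by (simp add: integral_linear bounded_linear_inner_right)
    also have "\<dots> = 0"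
      using that assms(3)
      by (intro integral_eq_0_iff[THEN iffD2] integral_unique has_integral_is_0)
        (auto simp: orthogonal_comp_def orthogonal_def inner_commute)
    finally show ?thesis by (simp add: orthogonal_def)
  qed
  then have "integral S g \<in> V\<^sup>\<bottom>\<^sup>\<bottom>" by (auto simp: orthogonal_comp_def)
  then show ?thesis using orthogonal_comp_self[OF assms(1)] by simp
qed

text \<open>
  Picard iteration on an interval that is so short that the integral operator contracts. The
  operator is restricted to the functions with values in the subspace \<open>V\<close>, which is applied to
  spaces of triangular matrices.
\<close>

lemma linear_ode:
  fixes f :: "real \<Rightarrow> 'a::euclidean_space \<Rightarrow> 'a"
  assumes ab: "a < b" and cont: "continuous_on ({a..b} \<times> UNIV) (\<lambda>(t, x). f t x)"
    and lin: "\<And>t. t \<in> {a..b} \<Longrightarrow> linear (f t)"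
    and K: "\<And>t x. t \<in> {a..b} \<Longrightarrow> norm (f t x) \<le> K * norm x" "0 \<le> K" "K * (b - a) < 1"
    and V: "subspace V" "x0 \<in> V" "\<And>t x. t \<in> {a..b} \<Longrightarrow> x \<in> V \<Longrightarrow> f t x \<in> V"
  obtains X where "X a = x0" "\<And>t. t \<in> {a..b} \<Longrightarrow> X t \<in> V"
    "\<And>t. t \<in> {a..b} \<Longrightarrow> (X has_vector_derivative f t (X t)) (at t within {a..b})"
proof -
  define G where "G u t = x0 + integral {a..t} (\<lambda>s. f s (u s))" for u t
  have cf: "continuous_on {a..b} (\<lambda>s. f s (u s))" if "continuous_on {a..b} u" for u
  proof -
    have "continuous_on {a..b} (\<lambda>s. (\<lambda>(t, x). f t x) (s, u s))"
      by (rule continuous_on_compose2[OF cont]) (auto intro!: continuous_intros that)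
    then show ?thesis by simp
  qed
  have der: "(G u has_vector_derivative f t (u t)) (at t within {a..b})"
    if "continuous_on {a..b} u" "t \<in> {a..b}" for u t
  proof -
    have "((\<lambda>t. x0 + integral {a..t} (\<lambda>s. f s (u s))) has_vector_derivative 0 + f t (u t))
        (at t within {a..b})"
      by (intro has_vector_derivative_add integral_has_vector_derivative cf that) auto
    then show ?thesis by (simp add: G_def[abs_def])
  qed
  have contG: "continuous_on {a..b} (G u)" if "continuous_on {a..b} u" for u
    unfolding continuous_on_eq_continuous_within
    using der[OF that] has_vector_derivative_continuous by blast
  have "\<exists>g. (\<forall>t\<in>{a..b}. apply_bcontfun g t = G u t) \<and> (\<forall>t. apply_bcontfun g t = G u (clamp a b t))"
    if "continuous_on {a..b} u" for u
    using continuous_on_cbox_bcontfunE[of a b "G u"] contG[OF that] by (metis box_real(2))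
  then obtain T where T: "\<And>u t. continuous_on {a..b} u \<Longrightarrow> t \<in> {a..b} \<Longrightarrow> apply_bcontfun (T u) t = G u t"
    "\<And>u t. continuous_on {a..b} u \<Longrightarrow> apply_bcontfun (T u) t = G u (clamp a b t)"
    by metis
  define F where "F u = T (apply_bcontfun u)" for u :: "real \<Rightarrow>\<^sub>C 'a"
  have F: "apply_bcontfun (F u) t = G u (clamp a b t)" for u t
    unfolding F_def by (rule T) auto
  have clamp: "clamp a b t \<in> {a..b}" for t
    using clamp_in_interval[of a b t] ab by simp
  have GV: "G u t \<in> V" if "t \<in> {a..b}" "continuous_on {a..b} u" "\<And>s. u s \<in> V" for u t
  proof -
    have "(\<lambda>s. f s (u s)) integrable_on {a..t}"
      using cf[OF that(2)] that(1) by (intro integrable_continuous_interval) (auto elim: continuous_on_subset)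
    then have "integral {a..t} (\<lambda>s. f s (u s)) \<in> V"
      using that V(3) by (intro integral_in_subspace[OF V(1)]) auto
    then show ?thesis using subspace_add[OF V(1,2)] by (simp add: G_def)
  qed
  have lip: "norm (G u t - G v t) \<le> K * (b - a) * norm (u - v)" if t: "t \<in> {a..b}" for u v :: "real \<Rightarrow>\<^sub>C 'a" and t
  proof -
    have iu: "(\<lambda>s. f s (u s)) integrable_on {a..t}" for u :: "real \<Rightarrow>\<^sub>C 'a"
      using cf[of u] t by (intro integrable_continuous_interval) (auto elim: continuous_on_subset)
    have *: "norm (f s (u s) - f s (v s)) \<le> K * norm (u - v)" if "s \<in> {a..t}" for s
    proof -
      have s: "s \<in> {a..b}" using that t by auto
      have "norm (f s (u s) - f s (v s)) = norm (f s (u s - v s))"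
        using linear_diff[OF lin[OF s]] by simp
      also have "\<dots> \<le> K * norm (u s - v s)" using K(1)[OF s] .
      also have "\<dots> \<le> K * norm (u - v)"
        using norm_bounded[of "u - v" s] K(2) by (intro mult_left_mono) auto
      finally show ?thesis .
    qed
    have "G u t - G v t = integral {a..t} (\<lambda>s. f s (u s) - f s (v s))"
      unfolding G_def using iu by (simp add: Henstock_Kurzweil_Integration.integral_diff)
    also have "norm \<dots> \<le> K * norm (u - v) * (t - a)"
      using t * continuous_on_subset[OF cf[of u]] continuous_on_subset[OF cf[of v]]
      by (intro integral_bound continuous_intros) auto
    also have "\<dots> \<le> K * norm (u - v) * (b - a)"
      using t K(2) by (intro mult_left_mono) auto
    finally show ?thesis by (simp add: mult_ac)
  qed
  have "\<exists>!u\<in>PiC UNIV (\<lambda>_. V). F u = u"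
  proof (rule Banach_fix)
    show "complete (PiC UNIV (\<lambda>_. V) :: (real \<Rightarrow>\<^sub>C 'a) set)"
      using closed_PiC[of UNIV "\<lambda>_. V"] closed_subspace[OF V(1)] by (simp add: complete_eq_closed)
    have "const_bcontfun 0 \<in> (PiC UNIV (\<lambda>_. V) :: (real \<Rightarrow>\<^sub>C 'a) set)"
      using subspace_0[OF V(1)] by (auto simp: mem_PiC_iff)
    then show "(PiC UNIV (\<lambda>_. V) :: (real \<Rightarrow>\<^sub>C 'a) set) \<noteq> {}" by blast
    show "F ` PiC UNIV (\<lambda>_. V) \<subseteq> PiC UNIV (\<lambda>_. V)"
      using GV[OF clamp] by (auto simp: mem_PiC_iff Pi_iff F)
    show "dist (F u) (F v) \<le> K * (b - a) * dist u v" for u v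
      using lip[OF clamp] by (intro dist_bound) (auto simp: F dist_norm)
  qed (use K ab in auto)
  then obtain u where u: "u \<in> PiC UNIV (\<lambda>_. V)" "F u = u" by blast
  have eq: "apply_bcontfun u t = G u t" if "t \<in> {a..b}" for t
    using F[of u t] u(2) that clamp_cancel_cbox[of t a b] by simp
  show ?thesis
  proof (rule that[of u])
    show "apply_bcontfun u a = x0" using eq[of a] ab by (simp add: G_def)
    show "apply_bcontfun u t \<in> V" for t using u(1) by (auto simp: mem_PiC_iff Pi_iff)
    show "(u has_vector_derivative f t (u t)) (at t within {a..b})" if "t \<in> {a..b}" for t
      by (rule has_vector_derivative_transform[OF that eq der[OF _ that]]) auto
  qed
qed

text \<open>
  If the rank of \<open>P s\<close> does not depend on \<open>s\<close>, a complement \<open>W\<close> of the kernel at \<open>s0\<close> remains one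
  nearby. Then the solution of \<open>P s x = y s\<close> in \<open>W\<close> is unique, and the lower bound for \<open>P s\<close>
  on \<open>W\<close> makes it continuous.
\<close>

lemma constant_rank_lift:
  fixes P :: "real \<Rightarrow> 'a::euclidean_space \<Rightarrow> 'b::euclidean_space"
  assumes e: "e > 0" and J: "J = {s0 - e<..<s0 + e}"
    and cont: "\<And>x. continuous_on J (\<lambda>s. P s x)"
    and lin: "\<And>s. s \<in> J \<Longrightarrow> linear (P s)"
    and rank: "\<And>s. s \<in> J \<Longrightarrow> dim (range (P s)) = r"
    and y: "continuous_on J y" "\<And>s. s \<in> J \<Longrightarrow> y s \<in> range (P s)"
  obtains d F where "0 < d" "d < e" "continuous_on {s0 - d..s0 + d} F"
    "\<And>s. s \<in> {s0 - d..s0 + d} \<Longrightarrow> P s (F s) = y s"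
proof -
  have s0: "s0 \<in> J" using e J by auto
  obtain g where g: "linear g" "\<And>v. v \<in> range (P s0) \<Longrightarrow> P s0 (g v) = v"
    using linear_exists_right_inverse_on[OF lin[OF s0] subspace_UNIV] by auto
  define W where "W = g ` range (P s0)"
  have subW: "subspace W"
    unfolding W_def using g(1) lin[OF s0] by (intro linear_subspace_image subspace_UNIV)
  have inj0: "x = 0" if "x \<in> W" "P s0 x = 0" for x
    using that g by (auto simp: W_def linear_0)
  have inj: "inj_on g (range (P s0))" using g(2) by (metis inj_on_inverseI)
  have dimW: "dim W = r"
    unfolding W_def using dim_image_eq[OF g(1), of "range (P s0)"] inj rank[OF s0] lin[OF s0]
    by (metis linear_subspace_image span_eq_iff subspace_UNIV)
  obtain \<kappa> where \<kappa>: "\<kappa> > 0" "\<And>x. x \<in> W \<Longrightarrow> \<kappa> * norm x \<le> norm (P s0 x)"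
    using injective_imp_isometric[OF closed_subspace[OF subW] subW, of "P s0"] inj0
      lin[OF s0] by (auto simp: linear_conv_bounded_linear mult.commute)
  define \<omega> where "\<omega> s t = (\<Sum>b\<in>Basis. norm (P t b - P s b))" for s t
  have \<omega>: "norm (P t x - P s x) \<le> \<omega> s t * norm x" if "s \<in> J" "t \<in> J" for s t x
  proof -
    interpret A: linear "P s" using lin that by blast
    interpret B: linear "P t" using lin that by blast
    have "P t x - P s x = (\<Sum>b\<in>Basis. (x \<bullet> b) *\<^sub>R (P t b - P s b))"
      by (subst (1 2) euclidean_representation[of x, symmetric])
        (simp only: A.sum B.sum A.scaleR B.scaleR sum_subtractf scaleR_diff_right)
    also have "norm \<dots> \<le> (\<Sum>b\<in>Basis. norm x * norm (P t b - P s b))"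
      by (intro sum_norm_le) (auto intro!: mult_right_mono Basis_le_norm)
    finally show ?thesis by (simp add: \<omega>_def sum_distrib_left mult.commute sum_distrib_right)
  qed
  have \<omega>_cont: "continuous_on J (\<omega> s)" for s
    unfolding \<omega>_def by (intro continuous_intros cont)
  have "\<exists>d>0. \<forall>t\<in>J. dist t s0 < d \<longrightarrow> dist (\<omega> s0 t) (\<omega> s0 s0) < \<kappa> / 2"
    using \<omega>_cont[of s0] s0 \<kappa>(1) unfolding continuous_on_iff by (metis half_gt_zero)
  then obtain d0 where d0: "d0 > 0" "\<And>t. t \<in> J \<Longrightarrow> dist t s0 < d0 \<Longrightarrow> \<omega> s0 t < \<kappa> / 2"
    by (force simp: \<omega>_def dist_real_def)
  define d where "d = min d0 e / 2"
  define I where "I = {s0 - d..s0 + d}"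
  have d: "0 < d" "d < e" "d < d0" using d0 e by (auto simp: d_def)
  have IJ: "I \<subseteq> J" using d by (auto simp: I_def J)
  have low: "\<kappa> / 2 * norm x \<le> norm (P s x)" if "s \<in> I" "x \<in> W" for s x
  proof -
    have "\<omega> s0 s < \<kappa> / 2" using d0(2)[of s] that IJ d by (auto simp: I_def dist_real_def)
    then have "norm (P s x - P s0 x) \<le> \<kappa> / 2 * norm x"
      using \<omega>[OF s0, of s x] that IJ by (smt (verit) mult_right_mono norm_ge_zero subsetD)
    moreover have "norm (P s0 x) \<le> norm (P s x) + norm (P s x - P s0 x)"
      by (metis norm_minus_commute norm_triangle_sub add.commute)
    ultimately show ?thesis using \<kappa>(2)[OF that(2)] by simp
  qed
  have img: "P s ` W = range (P s)" if "s \<in> I" for s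
  proof (rule subspace_dim_equal)
    have s: "s \<in> J" using that IJ by auto
    show "subspace (P s ` W)" "subspace (range (P s))"
      using linear_subspace_image[OF lin[OF s]] subW subspace_UNIV by auto
    have "inj_on (P s) W"
    proof (rule inj_onI)
      fix x x' assume *: "x \<in> W" "x' \<in> W" "P s x = P s x'"
      then have "norm (x - x') \<le> 0"
        using low[OF that, of "x - x'"] \<kappa>(1) subspace_diff[OF subW] linear_diff[OF lin[OF s]]
        by (auto simp: mult_le_0_iff)
      then show "x = x'" by simp
    qed
    then show "dim (P s ` W) \<ge> dim (range (P s))"
      using dim_image_eq[OF lin[OF s], of W] subW dimW rank[OF s] by (simp add: span_eq_iff[THEN iffD2])
  qed auto
  have "\<exists>x\<in>W. P s x = y s" if "s \<in> I" for s
    using img[OF that] y(2)[of s] that IJ by (metis image_iff subsetD)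
  then obtain F where F: "\<And>s. s \<in> I \<Longrightarrow> F s \<in> W" "\<And>s. s \<in> I \<Longrightarrow> P s (F s) = y s" by metis
  have "continuous_on I F"
    unfolding continuous_on_def
  proof
    fix s assume s: "s \<in> I"
    have "((\<lambda>t. 2 / \<kappa> * (norm (y t - y s) + \<omega> s t * norm (F s))) \<longlongrightarrow>
        2 / \<kappa> * (norm (y s - y s) + \<omega> s s * norm (F s))) (at s within I)"
      using continuous_on_subset[OF y(1) IJ] continuous_on_subset[OF \<omega>_cont IJ] s
      by (intro tendsto_intros) (auto simp: continuous_on_def)
    then have lim: "((\<lambda>t. 2 / \<kappa> * (norm (y t - y s) + \<omega> s t * norm (F s))) \<longlongrightarrow> 0) (at s within I)"
      by (simp add: \<omega>_def)
    have "norm (F t - F s) \<le> 2 / \<kappa> * (norm (y t - y s) + \<omega> s t * norm (F s))" if t: "t \<in> I" for t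
    proof -
      have "P t (F t - F s) = (y t - y s) - (P t (F s) - P s (F s))"
        using linear_diff[OF lin] t s IJ F(2) by auto
      then have "norm (P t (F t - F s)) \<le> norm (y t - y s) + norm (P t (F s) - P s (F s))"
        using norm_triangle_ineq4 by metis
      moreover have "\<kappa> / 2 * norm (F t - F s) \<le> norm (P t (F t - F s))"
        using low[OF t] F(1) s t subspace_diff[OF subW] by blast
      moreover have "norm (P t (F s) - P s (F s)) \<le> \<omega> s t * norm (F s)"
        using \<omega> s t IJ by blast
      ultimately have "\<kappa> / 2 * norm (F t - F s) \<le> norm (y t - y s) + \<omega> s t * norm (F s)" by linarith
      then show ?thesis using \<kappa>(1) by (simp add: field_simps)
    qed
    then have "((\<lambda>t. F t - F s) \<longlongrightarrow> 0) (at s within I)"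
      by (intro Lim_null_comparison[OF _ lim]) (auto simp: eventually_at_filter)
    then show "(F \<longlongrightarrow> F s) (at s within I)" using LIM_zero_cancel by blast
  qed
  then show ?thesis using that d F unfolding I_def by blast
qed

section \<open>Complements of zero sets of polynomials\<close>

text \<open>
  Functions that are polynomial along every complex line: this property is inherited by
  determinants and is strong enough to control the zero set.
\<close>
definition line_poly :: "(('n::finite) cmat \<Rightarrow> complex) \<Rightarrow> bool" where
  "line_poly f \<longleftrightarrow> (\<forall>a b. \<exists>q :: complex poly. \<forall>z. f (a + cscale z b) = poly q z)"

lemma line_poly_const [intro]: "line_poly (\<lambda>x. c)"
  unfolding line_poly_def by (intro allI exI[of _ "[:c:]"]) auto

lemma line_poly_entry [intro]: "line_poly (\<lambda>x. x $ i $ j)"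
  unfolding line_poly_def
proof (intro allI)
  fix a b :: "'a cmat"
  show "\<exists>q. \<forall>z. (a + cscale z b) $ i $ j = poly q z"
    by (rule exI[of _ "[:a $ i $ j, b $ i $ j:]"]) simp
qed

lemma line_poly_add [intro]: "line_poly f \<Longrightarrow> line_poly g \<Longrightarrow> line_poly (\<lambda>x. f x + g x)"
  unfolding line_poly_def by (metis poly_add)

lemma line_poly_mult [intro]: "line_poly f \<Longrightarrow> line_poly g \<Longrightarrow> line_poly (\<lambda>x. f x * g x)"
  unfolding line_poly_def by (metis poly_mult)

lemma line_poly_sum [intro]: "(\<And>i. i \<in> I \<Longrightarrow> line_poly (f i)) \<Longrightarrow> line_poly (\<lambda>x. \<Sum>i\<in>I. f i x)"
  by (induction I rule: infinite_finite_induct) auto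

lemma line_poly_prod [intro]: "(\<And>i. i \<in> I \<Longrightarrow> line_poly (f i)) \<Longrightarrow> line_poly (\<lambda>x. \<Prod>i\<in>I. f i x)"
  by (induction I rule: infinite_finite_induct) auto

lemma line_poly_det [intro]:
  assumes "\<And>i j. line_poly (\<lambda>x. F x $ i $ j)"
  shows "line_poly (\<lambda>x. det (F x))"
  unfolding det_def by (intro line_poly_sum line_poly_mult line_poly_const line_poly_prod assms)

text \<open>
  On the complex line through \<open>a\<close> and \<open>b\<close> both functions have only finitely many zeros.
\<close>

lemma line_poly_common_nonzero:
  assumes "line_poly f" "line_poly g" "f a \<noteq> 0" "g b \<noteq> 0"
  shows "\<exists>x. f x \<noteq> 0 \<and> g x \<noteq> 0"
proof -
  obtain p where p: "\<And>z. f (a + cscale z (b - a)) = poly p z"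
    using assms(1) unfolding line_poly_def by metis
  obtain q where q: "\<And>z. g (a + cscale z (b - a)) = poly q z"
    using assms(2) unfolding line_poly_def by metis
  have at0: "a + cscale 0 (b - a) = a" and at1: "a + cscale 1 (b - a) = b"
    by (simp_all add: vec_eq_iff)
  have "poly p 0 \<noteq> 0" "poly q 1 \<noteq> 0" using p[of 0] q[of 1] assms(3,4) at0 at1 by auto
  then have "p \<noteq> 0" "q \<noteq> 0" by auto
  then have "finite ({z. poly p z = 0} \<union> {z. poly q z = 0})"
    by (simp add: poly_roots_finite)
  then obtain z where "z \<notin> {z. poly p z = 0} \<union> {z. poly q z = 0}"
    using ex_new_if_finite[OF infinite_UNIV_char_0] by blast
  then have "f (a + cscale z (b - a)) \<noteq> 0 \<and> g (a + cscale z (b - a)) \<noteq> 0" using p q by simp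
  then show ?thesis by blast
qed

text \<open>
  Two points of the set are joined by a complex line, from which only finitely many points have
  to be removed.
\<close>

lemma connected_line_poly_nonzero:
  assumes "line_poly f"
  shows "connected {x. f x \<noteq> 0}"
  unfolding connected_iff_connected_component
proof (intro ballI)
  fix a b assume ab: "a \<in> {x. f x \<noteq> 0}" "b \<in> {x. f x \<noteq> 0}"
  obtain p where p: "\<And>z. f (a + cscale z (b - a)) = poly p z"
    using assms unfolding line_poly_def by metis
  have at0: "a + cscale 0 (b - a) = a" and at1: "a + cscale 1 (b - a) = b"
    by (simp_all add: vec_eq_iff)
  have nz: "poly p 0 \<noteq> 0" "poly p 1 \<noteq> 0" using p[of 0] p[of 1] ab at0 at1 by auto
  then have "countable {z. poly p z = 0}" using poly_roots_finite[of p] countable_finite by fastforce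
  then have "connected (- {z. poly p z = 0})"
    by (intro path_connected_imp_connected path_connected_complement_countable) auto
  moreover have "continuous_on UNIV (\<lambda>z. a + cscale z (b - a))"
    unfolding cscale_def by (intro continuous_intros)
  ultimately have conn: "connected ((\<lambda>z. a + cscale z (b - a)) ` (- {z. poly p z = 0}))"
    by (meson connected_continuous_image continuous_on_subset subset_UNIV)
  show "connected_component {x. f x \<noteq> 0} a b"
    unfolding connected_component_def
  proof (intro exI conjI)
    show "connected ((\<lambda>z. a + cscale z (b - a)) ` (- {z. poly p z = 0}))" by (rule conn)
    show "(\<lambda>z. a + cscale z (b - a)) ` (- {z. poly p z = 0}) \<subseteq> {x. f x \<noteq> 0}" using p by auto
    show "a \<in> (\<lambda>z. a + cscale z (b - a)) ` (- {z. poly p z = 0})"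
      using nz at0 by (intro image_eqI[of _ _ 0]) auto
    show "b \<in> (\<lambda>z. a + cscale z (b - a)) ` (- {z. poly p z = 0})"
      using nz at1 by (intro image_eqI[of _ _ 1]) auto
  qed
qed

section \<open>Sums along the orbits of a permutation\<close>

text \<open>
  This is the solvability criterion for \<open>x (\<tau> i) - x i = f i\<close>; the solution is found by
  summation by parts.
\<close>

lemma cyclic_difference_equation:
  fixes f :: "'a \<Rightarrow> complex"
  assumes N: "N > 0" "\<tau> ^^ N = id" and sum: "(\<Sum>k<N. f ((\<tau> ^^ k) i)) = 0"
  defines "x \<equiv> \<lambda>i. (\<Sum>k<N. of_nat k * f ((\<tau> ^^ k) i)) / of_nat N"
  shows "x (\<tau> i) - x i = f i"
proof -
  define a where "a k = f ((\<tau> ^^ k) i)" for k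
  have aN: "a N = a 0" using N by (simp add: a_def)
  have "(\<Sum>k<N. of_nat (Suc k) * a (Suc k) - of_nat k * a k) = of_nat N * a N"
    using sum_lessThan_telescope[of "\<lambda>k. of_nat k * a k" N] by simp
  moreover have "(\<Sum>k<N. a (Suc k)) = (\<Sum>k<N. a k) + a N - a 0"
    using sum_lessThan_telescope[of a N] by (simp add: sum_subtractf algebra_simps)
  ultimately have "(\<Sum>k<N. of_nat k * a (Suc k)) - (\<Sum>k<N. of_nat k * a k) = of_nat N * a 0"
    using sum aN by (simp add: sum_subtractf algebra_simps sum.distrib a_def)
  moreover have "x (\<tau> i) = (\<Sum>k<N. of_nat k * a (Suc k)) / of_nat N"
    by (simp add: x_def a_def funpow_swap1)
  moreover have "x i = (\<Sum>k<N. of_nat k * a k) / of_nat N" by (simp add: x_def a_def)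
  ultimately have "x (\<tau> i) - x i = of_nat N * a 0 / of_nat N"
    by (simp flip: diff_divide_distrib)
  then show ?thesis using N(1) by (simp add: a_def)
qed

lemma cyclic_prod_shift:
  fixes h :: "'a \<Rightarrow> 'b::comm_monoid_mult"
  assumes "\<tau> ^^ N = id" "N > 0"
  shows "(\<Prod>k<N. h ((\<tau> ^^ k) (\<tau> i))) = (\<Prod>k<N. h ((\<tau> ^^ k) i))"
proof -
  obtain M where M: "N = Suc M" using assms(2) gr0_implies_Suc by blast
  define g where "g k = h ((\<tau> ^^ k) i)" for k
  have "g (Suc M) = g 0" using assms(1) by (simp only: g_def M[symmetric]) simp
  then have "(\<Prod>k<N. g (Suc k)) = (\<Prod>k<N. g k)"
    unfolding M prod.lessThan_Suc_shift[of g] prod.lessThan_Suc[of "\<lambda>k. g (Suc k)"]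
    by (simp add: mult.commute)
  then show ?thesis by (simp add: funpow_swap1 g_def)
qed

lemma cyclic_sum_shift:
  fixes h :: "'a \<Rightarrow> 'b::comm_monoid_add"
  assumes "\<tau> ^^ N = id" "N > 0"
  shows "(\<Sum>k<N. h ((\<tau> ^^ k) (\<tau> i))) = (\<Sum>k<N. h ((\<tau> ^^ k) i))"
proof -
  obtain M where M: "N = Suc M" using assms(2) gr0_implies_Suc by blast
  define g where "g k = h ((\<tau> ^^ k) i)" for k
  have "g (Suc M) = g 0" using assms(1) by (simp only: g_def M[symmetric]) simp
  then have "(\<Sum>k<N. g (Suc k)) = (\<Sum>k<N. g k)"
    unfolding M sum.lessThan_Suc_shift[of g] sum.lessThan_Suc[of "\<lambda>k. g (Suc k)"]
    by (simp add: add.commute)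
  then show ?thesis by (simp add: funpow_swap1 g_def)
qed

lemma invariant_funpow: "(\<And>i. h (\<tau> i) = h i) \<Longrightarrow> h ((\<tau> ^^ k) i) = h i"
  by (induction k) auto

text \<open>
  Near 1 the principal branch of the root inverts the power, as \<open>M\<close> times a small argument does not
  reach the cut of the logarithm.
\<close>

lemma exp_Ln_power_root:
  assumes M: "M > 0"
  shows "\<exists>\<epsilon>>0. \<forall>z. cmod (z - 1) < \<epsilon> \<longrightarrow> z \<noteq> 0 \<and> exp (Ln (z ^ M) / of_nat M) = z"
proof -
  have "isCont (\<lambda>z. Im (Ln z)) 1" by (intro continuous_Im continuous_at_Ln) auto
  then obtain \<delta> where \<delta>: "\<delta> > 0" "\<And>z. dist z 1 < \<delta> \<Longrightarrow> dist (Im (Ln z)) (Im (Ln 1)) < pi / of_nat M"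
    using M pi_gt_zero by (auto simp: continuous_at_eps_delta elim!: allE[of _ "pi / of_nat M"])
  have "z \<noteq> 0 \<and> exp (Ln (z ^ M) / of_nat M) = z" if z: "cmod (z - 1) < min \<delta> 1" for z
  proof -
    have nz: "z \<noteq> 0" using z by auto
    have "\<bar>Im (Ln z)\<bar> < pi / of_nat M" using \<delta>(2)[of z] z by (simp add: dist_norm)
    then have "\<bar>of_nat M * Im (Ln z)\<bar> < pi" using M by (simp add: abs_mult field_simps)
    then have "Ln (exp (of_nat M * Ln z)) = of_nat M * Ln z"
      by (intro Ln_exp) (auto simp: abs_less_iff)
    then have "Ln (z ^ M) = of_nat M * Ln z"
      using nz by (simp add: exp_of_nat_mult)
    then show ?thesis using M nz by simp
  qed
  moreover have "min \<delta> 1 > 0" using \<delta>(1) by simp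
  ultimately show ?thesis by blast
qed

section \<open>The Hamiltonian distribution\<close>

lemma linear_cscale_iff:
  "Vector_Spaces.linear cscale cscale D \<longleftrightarrow>
    (\<forall>x y. D (x + y) = D x + D y) \<and> (\<forall>c x. D (cscale c x) = cscale c (D x))"
  by (simp add: Vector_Spaces.linear_iff cmat.vector_space_axioms)

lemma linear_cscale_mult_iff:
  "Vector_Spaces.linear cscale (*) D \<longleftrightarrow>
    (\<forall>x y. D (x + y) = D x + D y) \<and> (\<forall>c x. D (cscale c x) = c * D x)"
  by (simp add: Vector_Spaces.linear_iff cmat.vector_space_axioms
      vector_space_over_itself.vector_space_axioms)

text \<open>
  Let \<open>\<R>\<close> be the classical r-matrix, which multiplies the entry at \<open>(k, l)\<close> by the sign of \<open>l - k\<close>.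
  These are the maps \<open>\<R> + 1\<close> and \<open>\<R> - 1\<close>, with triangular values.
\<close>
definition r_upper :: "('n::{finite,linorder}) cmat \<Rightarrow> 'n cmat" where
  "r_upper M = (\<chi> k l. if k < l then 2 * M $ k $ l else if k = l then M $ k $ l else 0)"

definition r_lower :: "('n::{finite,linorder}) cmat \<Rightarrow> 'n cmat" where
  "r_lower M = (\<chi> k l. if l < k then - 2 * M $ k $ l else if k = l then - M $ k $ l else 0)"

text \<open>
  The value at \<open>A\<close> of the Hamiltonian field of a function whose differential at \<open>A\<close> is
  \<open>X \<mapsto> trace (F X)\<close>. As \<open>\<R> + 1\<close> and \<open>\<R> - 1\<close> differ by a scalar, they give the same field
  (\<open>hamiltonian_map_lower\<close>).
\<close>
definition hamiltonian_map :: "('n::{finite,linorder}) cmat \<Rightarrow> 'n cmat \<Rightarrow> 'n cmat" where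
  "hamiltonian_map A F = A ** r_upper (F ** A) - r_upper (A ** F) ** A"

lemma tri_r [simp]: "upper (r_upper M)" "lower (r_lower M)"
  by (auto simp: tri_def r_upper_def r_lower_def)

lemma r_diag [simp]: "r_upper M $ i $ i = M $ i $ i" "r_lower M $ i $ i = - M $ i $ i"
  by (auto simp: r_upper_def r_lower_def)

lemma r_upper_minus_r_lower: "r_upper M - r_lower M = M + M"
  by (auto simp: vec_eq_iff r_upper_def r_lower_def)

lemma hamiltonian_map_lower: "hamiltonian_map A F = A ** r_lower (F ** A) - r_lower (A ** F) ** A"
proof -
  have r: "r_upper M = r_lower M + (M + M)" for M :: "'a cmat"
    using r_upper_minus_r_lower[of M] by (simp add: algebra_simps)
  show ?thesis
    unfolding hamiltonian_map_def r matrix_add_ldistrib matrix_add_rdistrib matrix_mul_assoc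
    by (simp only: add_diff_add diff_self add_0_right)
qed

lemma hamiltonian_map_add: "hamiltonian_map A (F + G) = hamiltonian_map A F + hamiltonian_map A G"
proof -
  have "r_upper (M + M') = r_upper M + r_upper M'" for M M' :: "'a cmat"
    by (simp add: vec_eq_iff r_upper_def algebra_simps)
  then show ?thesis
    by (simp add: hamiltonian_map_def matrix_add_ldistrib matrix_add_rdistrib)
qed

lemma cscale_mult: "cscale c A ** B = cscale c (A ** B)" "A ** cscale c B = cscale c (A ** B)"
  by (simp_all add: vec_eq_iff matrix_matrix_mult_def sum_distrib_left mult_ac)

lemma cscale_diff: "cscale c (A - B) = cscale c A - cscale c B"
  by (simp add: vec_eq_iff algebra_simps)

lemma hamiltonian_map_cscale: "hamiltonian_map A (cscale c F) = cscale c (hamiltonian_map A F)"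
proof -
  have "r_upper (cscale c M) = cscale c (r_upper M)" for M :: "'a cmat"
    by (simp add: vec_eq_iff r_upper_def)
  then show ?thesis
    by (simp add: hamiltonian_map_def cscale_mult cscale_diff)
qed

lemma hamiltonian_map_nth:
  "hamiltonian_map A F $ k $ l = (\<Sum>i\<in>UNIV. \<Sum>j\<in>UNIV. F $ j $ i * coordinate_bracket i j k l A)"
proof -
  define w :: "'a \<Rightarrow> 'a \<Rightarrow> complex" where "w j l = (if j < l then 2 else if j = l then 1 else 0)" for j l
  have cb: "coordinate_bracket i j k l A = (w j l - w k i) * A $ i $ l * A $ k $ j" for i j
    by (cases i k rule: linorder_cases; cases j l rule: linorder_cases)
      (auto simp: coordinate_bracket_def w_def)
  have r: "r_upper M $ j $ l = w j l * M $ j $ l" for M j l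
    by (simp add: r_upper_def w_def)
  have "hamiltonian_map A F $ k $ l =
      (\<Sum>j\<in>UNIV. A $ k $ j * (w j l * (\<Sum>i\<in>UNIV. F $ j $ i * A $ i $ l))) -
      (\<Sum>i\<in>UNIV. w k i * (\<Sum>j\<in>UNIV. A $ k $ j * F $ j $ i) * A $ i $ l)"
    by (simp add: hamiltonian_map_def matrix_matrix_mult_def r)
  also have "(\<Sum>j\<in>UNIV. A $ k $ j * (w j l * (\<Sum>i\<in>UNIV. F $ j $ i * A $ i $ l))) =
      (\<Sum>j\<in>UNIV. \<Sum>i\<in>UNIV. F $ j $ i * w j l * A $ i $ l * A $ k $ j)"
    by (simp add: sum_distrib_left sum_distrib_right mult_ac)
  also have "\<dots> = (\<Sum>i\<in>UNIV. \<Sum>j\<in>UNIV. F $ j $ i * w j l * A $ i $ l * A $ k $ j)"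
    by (rule sum.swap)
  also have "(\<Sum>i\<in>UNIV. w k i * (\<Sum>j\<in>UNIV. A $ k $ j * F $ j $ i) * A $ i $ l) =
      (\<Sum>i\<in>UNIV. \<Sum>j\<in>UNIV. F $ j $ i * w k i * A $ i $ l * A $ k $ j)"
    by (simp add: sum_distrib_left sum_distrib_right mult_ac)
  finally show ?thesis
    by (simp add: cb sum_subtractf[symmetric] algebra_simps)
qed

lemma hamiltonian_field_eq:
  "hamiltonian_field f A = hamiltonian_map A (\<chi> j i. partial_deriv i j f A)"
proof -
  have "partial_deriv i j f A * partial_deriv s t (\<lambda>X. X $ k $ l) A * coordinate_bracket i j s t A =
      (if k = s then if l = t then partial_deriv i j f A * coordinate_bracket i j k l A else 0 else 0)"
    for i j s t k l
    by (simp add: partial_deriv_coordinate)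
  then have "poisson_bracket f (\<lambda>X. X $ k $ l) A =
      (\<Sum>i\<in>UNIV. \<Sum>j\<in>UNIV. partial_deriv i j f A * coordinate_bracket i j k l A)" for k l
    unfolding poisson_bracket_def by (simp only: sum_if_outside) simp
  then show ?thesis
    by (simp add: vec_eq_iff hamiltonian_field_def hamiltonian_map_nth)
qed

lemma hamiltonian_distribution_eq: "hamiltonian_distribution A = range (hamiltonian_map A)"
proof -
  have "\<exists>f. holomorphic_on_GL f \<and> hamiltonian_field f A = hamiltonian_map A F" for F
  proof (intro exI conjI)
    let ?f = "\<lambda>X :: 'a cmat. \<Sum>i\<in>UNIV. \<Sum>j\<in>UNIV. F $ j $ i * X $ i $ j"
    have bl: "bounded_linear ?f"
      by (intro bounded_linear_sum bounded_linear_const_mult bounded_linear_entry)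
    have "?f (x + y) = ?f x + ?f y" "?f (cscale c x) = c * ?f x" for x y c
      by (simp_all add: algebra_simps sum.distrib sum_distrib_left)
    then have lin: "Vector_Spaces.linear cscale (*) ?f" by (simp only: linear_cscale_mult_iff) simp
    then show "holomorphic_on_GL ?f"
      unfolding holomorphic_on_GL_def using bounded_linear_imp_has_derivative[OF bl] by blast
    have "partial_deriv i j ?f A = F $ j $ i" for i j
    proof -
      define f where "f = ?f"
      have f: "f (A + cscale z (matrix_unit i j)) = f A + z * f (matrix_unit i j)" for z
        using lin unfolding f_def[symmetric] by (simp only: linear_cscale_mult_iff)
      have unit: "f (matrix_unit i j) = F $ j $ i"
      proof -
        have "F $ l $ k * matrix_unit i j $ k $ l = (if k = i then if l = j then F $ j $ i else 0 else 0)" for k l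
          by (simp add: matrix_unit_def)
        then show ?thesis by (simp add: f_def sum_if_outside)
      qed
      have "((\<lambda>z. f A + z * F $ j $ i) has_field_derivative F $ j $ i) (at 0)"
        by (auto intro!: derivative_eq_intros)
      then have "partial_deriv i j f A = F $ j $ i"
        unfolding partial_deriv_def f unit by (rule DERIV_imp_deriv)
      then show ?thesis by (simp add: f_def)
    qed
    then show "hamiltonian_field ?f A = hamiltonian_map A F"
      by (simp add: hamiltonian_field_eq)
  qed
  then have "{hamiltonian_field f A | f. holomorphic_on_GL f} = range (hamiltonian_map A)"
    by (auto simp: hamiltonian_field_eq image_def) (metis hamiltonian_field_eq)
  moreover have "cmat.subspace (range (hamiltonian_map A))"
    unfolding cmat.subspace_def
  proof (intro conjI ballI allI)
    have "hamiltonian_map A 0 = 0" using hamiltonian_map_add[of A 0 0] by simp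
    then show "0 \<in> range (hamiltonian_map A)" by (metis rangeI)
    fix x y c assume x: "x \<in> range (hamiltonian_map A)"
    then obtain F where F: "x = hamiltonian_map A F" by blast
    show "cscale c x \<in> range (hamiltonian_map A)"
      unfolding F hamiltonian_map_cscale[symmetric] by (rule rangeI)
    assume "y \<in> range (hamiltonian_map A)"
    then obtain G where G: "y = hamiltonian_map A G" by blast
    show "x + y \<in> range (hamiltonian_map A)"
      unfolding F G hamiltonian_map_add[symmetric] by (rule rangeI)
  qed
  ultimately show ?thesis
    unfolding hamiltonian_distribution_def by (metis cmat.span_eq_iff)
qed

text \<open>
  The distribution in terms of the dual group: a tangent vector at \<open>A\<close> belongs to it iff it is both
  an infinitesimal upper and an infinitesimal lower triangular two-sided displacement of \<open>A\<close> with
  opposite diagonals.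
\<close>

lemma hamiltonian_distribution_iff:
  assumes A: "invertible A"
  shows "\<xi> \<in> hamiltonian_distribution A \<longleftrightarrow>
    (\<exists>x x' z z'. upper x \<and> upper z \<and> lower x' \<and> lower z' \<and>
      (\<forall>i. x' $ i $ i = - x $ i $ i) \<and> (\<forall>i. z' $ i $ i = - z $ i $ i) \<and>
      \<xi> = A ** x - z ** A \<and> \<xi> = A ** x' - z' ** A)"
proof
  assume "\<xi> \<in> hamiltonian_distribution A"
  then obtain F where F: "\<xi> = hamiltonian_map A F" by (auto simp: hamiltonian_distribution_eq)
  show "\<exists>x x' z z'. upper x \<and> upper z \<and> lower x' \<and> lower z' \<and>
      (\<forall>i. x' $ i $ i = - x $ i $ i) \<and> (\<forall>i. z' $ i $ i = - z $ i $ i) \<and>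
      \<xi> = A ** x - z ** A \<and> \<xi> = A ** x' - z' ** A"
    by (rule exI[of _ "r_upper (F ** A)"], rule exI[of _ "r_lower (F ** A)"],
        rule exI[of _ "r_upper (A ** F)"], rule exI[of _ "r_lower (A ** F)"])
      (auto simp: F hamiltonian_map_def[symmetric] hamiltonian_map_lower[symmetric])
next
  assume "\<exists>x x' z z'. upper x \<and> upper z \<and> lower x' \<and> lower z' \<and>
      (\<forall>i. x' $ i $ i = - x $ i $ i) \<and> (\<forall>i. z' $ i $ i = - z $ i $ i) \<and>
      \<xi> = A ** x - z ** A \<and> \<xi> = A ** x' - z' ** A"
  then obtain x x' z z' where *: "upper x" "upper z" "lower x'" "lower z'"
    "\<And>i. x' $ i $ i = - x $ i $ i" "\<And>i. z' $ i $ i = - z $ i $ i"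
    "\<xi> = A ** x - z ** A" "\<xi> = A ** x' - z' ** A" by blast
  have r: "r_upper (cscale (1/2) (y - y')) = y"
    if "upper y" "lower y'" "\<And>i. y' $ i $ i = - y $ i $ i" for y y' :: "'a cmat"
  proof -
    have "r_upper (cscale (1/2) (y - y')) $ k $ l = y $ k $ l" for k l
      using upperD[OF that(1), of l k] lowerD[OF that(2), of k l] that(3)
      by (cases k l rule: linorder_cases) (auto simp: r_upper_def)
    then show ?thesis by (simp add: vec_eq_iff)
  qed
  define F where "F = cscale (1/2) (x - x') ** matrix_inv A"
  have FA: "F ** A = cscale (1/2) (x - x')"
    unfolding F_def using inverse_matrix(2)[OF A] by (metis matrix_mul_assoc matrix_mul_rid)
  have "A ** (x - x') = (z - z') ** A"
    using *(7,8) by (simp add: matrix_diff_ldistrib matrix_diff_rdistrib algebra_simps)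
  then have "A ** F = cscale (1/2) ((z - z') ** A ** matrix_inv A)"
    by (simp add: F_def cscale_mult matrix_mul_assoc)
  also have "\<dots> = cscale (1/2) (z - z')"
    using inverse_matrix(1)[OF A] by (metis matrix_mul_assoc matrix_mul_rid)
  finally have "\<xi> = hamiltonian_map A F"
    using r[of x x'] r[of z z'] * by (simp add: hamiltonian_map_def FA)
  then show "\<xi> \<in> hamiltonian_distribution A" by (simp add: hamiltonian_distribution_eq)
qed

section \<open>The Bruhat decomposition\<close>

text \<open>
  Elimination from the left to the right: the pivot of a column is its lowest entry that is not
  zero. It is used to clear the entries above it and those to its right.
\<close>

lemma bruhat_elimination_step:
  fixes M :: "('n::{finite,linorder}) cmat"
  assumes M: "invertible M"
    and col: "\<And>i j. j < b \<Longrightarrow> M $ i $ j = (if i = p j then 1 else 0)"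
    and row: "\<And>j k. j < b \<Longrightarrow> M $ p j $ k = (if k = j then 1 else 0)"
  obtains u v i0 where "u \<in> B_plus" "v \<in> B_plus" "i0 \<notin> p ` {..<b}"
    "\<And>i j. j \<le> b \<Longrightarrow> (u ** M ** v) $ i $ j = (if i = (p(b := i0)) j then 1 else 0)"
    "\<And>j k. j \<le> b \<Longrightarrow> (u ** M ** v) $ (p(b := i0)) j $ k = (if k = j then 1 else 0)"
proof -
  have "\<exists>i. M $ i $ b \<noteq> 0"
  proof (rule ccontr)
    assume "\<not> ?thesis"
    then have "(matrix_inv M ** M) $ b $ b = 0" by (simp add: matrix_matrix_mult_def)
    then show False by (simp add: inverse_matrix[OF M] mat_def)
  qed
  then have ne: "{i. M $ i $ b \<noteq> 0} \<noteq> {}" by blast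
  define i0 where "i0 = Max {i. M $ i $ b \<noteq> 0}"
  define c where "c = M $ i0 $ b"
  have c: "c \<noteq> 0" using Max_in[OF _ ne] by (simp add: c_def i0_def)
  have below: "M $ i $ b = 0" if "i > i0" for i
  proof (rule ccontr)
    assume "M $ i $ b \<noteq> 0"
    then have "i \<le> i0" unfolding i0_def by (intro Max_ge) auto
    then show False using that by simp
  qed
  have i0: "i0 \<noteq> p j" if "j < b" for j using row[OF that, of b] that c by (auto simp: c_def split: if_splits)
  define u where "u = (\<chi> i k. if k = i then (if i = i0 then 1 / c else 1)
    else if k = i0 then - M $ i $ b / c else 0)"
  define M1 where "M1 = (\<chi> i k. if i = i0 then M $ i0 $ k / c else M $ i $ k - M $ i $ b / c * M $ i0 $ k)"
  define v where "v = (\<chi> l k. if l = k then 1 else if l = b then - M1 $ i0 $ k else 0)"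
  define M2 where "M2 = (\<chi> i k. if k = b then M1 $ i $ k else M1 $ i $ k - M1 $ i $ b * M1 $ i0 $ k)"
  have uM: "u ** M = M1"
  proof -
    have "(u ** M) $ i $ k = M1 $ i $ k" for i k
    proof (cases "i = i0")
      case True
      then have "u $ i $ l * M $ l $ k = (if l = i0 then M $ i0 $ k / c else 0)" for l
        by (simp add: u_def)
      then show ?thesis using True by (simp add: matrix_matrix_mult_def M1_def)
    next
      case False
      then have "u $ i $ l * M $ l $ k = (if l = i then M $ i $ k else 0) +
          (if l = i0 then - M $ i $ b / c * M $ i0 $ k else 0)" for l
        by (simp add: u_def)
      then show ?thesis using False by (simp add: matrix_matrix_mult_def M1_def sum.distrib)
    qed
    then show ?thesis by (simp add: vec_eq_iff)
  qed
  have Mv: "M1 ** v = M2"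
  proof -
    have "(M1 ** v) $ i $ k = M2 $ i $ k" for i k
    proof (cases "k = b")
      case True
      then have "M1 $ i $ l * v $ l $ k = (if l = b then M1 $ i $ b else 0)" for l
        by (simp add: v_def)
      then show ?thesis using True by (simp add: matrix_matrix_mult_def M2_def)
    next
      case False
      then have "M1 $ i $ l * v $ l $ k = (if l = k then M1 $ i $ k else 0) +
          (if l = b then - M1 $ i $ b * M1 $ i0 $ k else 0)" for l
        by (simp add: v_def)
      then show ?thesis using False by (simp add: matrix_matrix_mult_def M2_def sum.distrib)
    qed
    then show ?thesis by (simp add: vec_eq_iff)
  qed
  have M1b: "M1 $ i $ b = (if i = i0 then 1 else 0)" for i using c by (simp add: M1_def c_def)
  have M1col: "M1 $ i $ j = (if i = p j then 1 else 0)" if "j < b" for i j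
    using col[OF that] i0[OF that] by (auto simp: M1_def)
  have M1row: "M1 $ p j $ k = (if k = j then 1 else 0)" if "j < b" for j k
    using row[OF that] i0[OF that] that by (auto simp: M1_def)
  have uv: "u ** M ** v = M2" by (simp add: uM Mv)
  show ?thesis
  proof (rule that[of u v i0])
    show "u \<in> B_plus" using below c by (auto simp: B_plus_iff tri_def u_def not_less[symmetric])
    show "v \<in> B_plus"
      using M1col[of _ i0] i0 by (auto simp: B_plus_iff tri_def v_def not_less[symmetric])
    show "i0 \<notin> p ` {..<b}" using i0 by auto
    show "(u ** M ** v) $ i $ j = (if i = (p(b := i0)) j then 1 else 0)" if "j \<le> b" for i j
    proof (cases "j = b")
      case False
      then have "j < b" using that by simp
      then show ?thesis using M1col[of j] i0[of j] False unfolding uv by (auto simp: M2_def M1b)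
    qed (unfold uv, simp add: M2_def M1b)
    show "(u ** M ** v) $ (p(b := i0)) j $ k = (if k = j then 1 else 0)" if "j \<le> b" for j k
    proof (cases "j = b")
      case False
      then have j: "j < b" using that by simp
      have "p j \<noteq> i0" using i0[OF j] by simp
      then show ?thesis using M1row[OF j] j False unfolding uv by (auto simp: M2_def M1b)
    qed (unfold uv, simp add: M2_def M1b)
  qed
qed

lemma B_plus_mult: "A \<in> B_plus \<Longrightarrow> B \<in> B_plus \<Longrightarrow> A ** B \<in> B_plus"
  using tri_mult[OF partial_order_rel_le(1), of A B] by (simp add: B_plus_iff)

lemma B_minus_mult: "A \<in> B_minus \<Longrightarrow> B \<in> B_minus \<Longrightarrow> A ** B \<in> B_minus"
  using tri_mult[OF partial_order_rel_le(2), of A B] by (simp add: B_minus_iff)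

lemma B_plus_inverse: "A \<in> B_plus \<Longrightarrow> matrix_inv A \<in> B_plus"
  using tri_inverse[OF partial_order_rel_le(1), of A] by (simp add: B_plus_iff)

lemma B_minus_inverse: "A \<in> B_minus \<Longrightarrow> matrix_inv A \<in> B_minus"
  using tri_inverse[OF partial_order_rel_le(2), of A] by (simp add: B_minus_iff)

lemma B_invertible: "A \<in> B_plus \<Longrightarrow> invertible A" "A \<in> B_minus \<Longrightarrow> invertible A"
  by (auto simp: B_plus_def B_minus_def GL_def)

lemma mat_1_B [simp]: "mat 1 \<in> B_plus" "mat 1 \<in> B_minus"
  by (auto simp: B_plus_iff B_minus_iff mat_def tri_def)

lemma bruhat_elimination:
  fixes A :: "('n::{finite,linorder}) cmat"
  assumes A: "invertible A" and "finite J"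
  shows "(\<forall>a\<in>J. \<forall>x<a. x \<in> J) \<longrightarrow> (\<exists>u v p. u \<in> B_plus \<and> v \<in> B_plus \<and> inj_on p J \<and>
    (\<forall>j\<in>J. \<forall>i. (u ** A ** v) $ i $ j = (if i = p j then 1 else 0)) \<and>
    (\<forall>j\<in>J. \<forall>k. (u ** A ** v) $ p j $ k = (if k = j then 1 else 0)))"
  using assms(2)
proof (induction J rule: finite_linorder_max_induct)
  case empty
  show ?case by (auto intro!: exI[of _ "mat 1 :: 'n cmat"])
next
  case (insert b J)
  show ?case
  proof
    assume down: "\<forall>a\<in>insert b J. \<forall>x<a. x \<in> insert b J"
    then have J: "J = {..<b}" using insert.hyps by fastforce
    obtain u v p where uv: "u \<in> B_plus" "v \<in> B_plus" "inj_on p J"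
      "\<And>i j. j < b \<Longrightarrow> (u ** A ** v) $ i $ j = (if i = p j then 1 else 0)"
      "\<And>j k. j < b \<Longrightarrow> (u ** A ** v) $ p j $ k = (if k = j then 1 else 0)"
      using insert.IH unfolding J by fastforce
    have "invertible (u ** A ** v)" using uv A B_invertible by (intro invertible_mult) auto
    from bruhat_elimination_step[OF this uv(4,5)]
    obtain u' v' i0 where *: "u' \<in> B_plus" "v' \<in> B_plus" "i0 \<notin> p ` {..<b}"
      "\<And>i j. j \<le> b \<Longrightarrow> (u' ** (u ** A ** v) ** v') $ i $ j = (if i = (p(b := i0)) j then 1 else 0)"
      "\<And>j k. j \<le> b \<Longrightarrow> (u' ** (u ** A ** v) ** v') $ (p(b := i0)) j $ k = (if k = j then 1 else 0)"
      by blast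
    have eq: "u' ** (u ** A ** v) ** v' = (u' ** u) ** A ** (v ** v')"
      by (simp add: matrix_mul_assoc)
    show "\<exists>u v p. u \<in> B_plus \<and> v \<in> B_plus \<and> inj_on p (insert b J) \<and>
        (\<forall>j\<in>insert b J. \<forall>i. (u ** A ** v) $ i $ j = (if i = p j then 1 else 0)) \<and>
        (\<forall>j\<in>insert b J. \<forall>k. (u ** A ** v) $ p j $ k = (if k = j then 1 else 0))"
    proof (intro exI conjI)
      show "u' ** u \<in> B_plus" "v ** v' \<in> B_plus" using uv * by (auto intro: B_plus_mult)
      show "inj_on (p(b := i0)) (insert b J)"
        using uv(3) *(3) by (auto simp: J inj_on_def)
      show "\<forall>j\<in>insert b J. \<forall>i. (u' ** u ** A ** (v ** v')) $ i $ j = (if i = (p(b := i0)) j then 1 else 0)"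
        by (intro ballI allI *(4)[unfolded eq]) (auto simp: J)
      show "\<forall>j\<in>insert b J. \<forall>k. (u' ** u ** A ** (v ** v')) $ (p(b := i0)) j $ k = (if k = j then 1 else 0)"
        by (intro ballI allI *(5)[unfolded eq]) (auto simp: J)
    qed
  qed
qed

lemma bruhat_plus:
  fixes A :: "('n::{finite,linorder}) cmat"
  assumes A: "invertible A"
  shows "\<exists>p. p permutes UNIV \<and> A \<in> double_coset B_plus (permutation_matrix p)"
proof -
  obtain u v p where *: "u \<in> B_plus" "v \<in> B_plus" "inj p"
    "\<And>i j. (u ** A ** v) $ i $ j = (if i = p j then 1 else 0)"
    using bruhat_elimination[OF A, of UNIV] by auto
  have p: "p permutes UNIV" using *(3) by (intro bij_imp_permutes) (auto simp: bij_def finite_UNIV_inj_surj)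
  have "u ** A ** v = permutation_matrix p"
    by (simp add: vec_eq_iff permutation_matrix_def *(4))
  then have "A = matrix_inv u ** permutation_matrix p ** matrix_inv v"
    using B_invertible(1)[OF *(1)] B_invertible(1)[OF *(2)]
    by (metis inverse_matrix matrix_mul_assoc matrix_mul_lid matrix_mul_rid)
  then show ?thesis using p *(1,2) B_plus_inverse unfolding double_coset_def by blast
qed

lemma bruhat_minus:
  fixes A :: "('n::{finite,linorder}) cmat"
  assumes A: "invertible A"
  shows "\<exists>p. p permutes UNIV \<and> A \<in> double_coset B_minus (permutation_matrix p)"
proof -
  have tr: "transpose X \<in> B_minus" if "X \<in> B_plus" for X :: "'n cmat"
    using that by (auto simp: B_plus_iff B_minus_iff tri_def transpose_def)
  obtain p b b' where *: "p permutes UNIV" "b \<in> B_plus" "b' \<in> B_plus"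
    "transpose A = b ** permutation_matrix p ** b'"
    using bruhat_plus[of "transpose A"] A
    unfolding double_coset_def invertible_det_nz det_transpose by blast
  have "transpose (permutation_matrix p) = permutation_matrix (inv p)"
    using *(1) by (auto simp: vec_eq_iff transpose_def permutation_matrix_def permutes_inverses)
  then have "A = transpose b' ** permutation_matrix (inv p) ** transpose b"
    using *(4) by (metis matrix_mul_assoc matrix_transpose_mul transpose_transpose)
  then show ?thesis
    using tr *(2,3) permutes_inv[OF *(1)] unfolding double_coset_def by blast
qed


section \<open>Coordinates on the intersection of two double cosets\<close>

text \<open>
  The pairs \<open>(u, l)\<close> with inverse diagonals form the dual Poisson group, which acts from both sides on
  pairs of matrices; two matrices are related if their diagonal pairs lie in the same orbit.
\<close>
definition dressed :: "('n::{finite,linorder}) cmat \<Rightarrow> 'n cmat \<Rightarrow> bool" where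
  "dressed A q \<longleftrightarrow> (\<exists>u\<in>B_plus. \<exists>u'\<in>B_plus. \<exists>l\<in>B_minus. \<exists>l'\<in>B_minus.
    (\<forall>i. u $ i $ i * l $ i $ i = 1) \<and> (\<forall>i. u' $ i $ i * l' $ i $ i = 1) \<and>
    A = u ** q ** u' \<and> A = l ** q ** l')"

lemma B_plus_inverse_diag: "A \<in> B_plus \<Longrightarrow> matrix_inv A $ i $ i = 1 / A $ i $ i"
  using tri_inverse(2)[OF partial_order_rel_le(1), of A] by (simp add: B_plus_iff)

lemma B_minus_inverse_diag: "A \<in> B_minus \<Longrightarrow> matrix_inv A $ i $ i = 1 / A $ i $ i"
  using tri_inverse(2)[OF partial_order_rel_le(2), of A] by (simp add: B_minus_iff)

lemma dressed_sym: "dressed A q \<Longrightarrow> dressed q A"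
proof -
  assume "dressed A q"
  then obtain u u' l l' where *: "u \<in> B_plus" "u' \<in> B_plus" "l \<in> B_minus" "l' \<in> B_minus"
    "\<forall>i. u $ i $ i * l $ i $ i = 1" "\<forall>i. u' $ i $ i * l' $ i $ i = 1"
    "A = u ** q ** u'" "A = l ** q ** l'"
    unfolding dressed_def by blast
  have "matrix_inv u \<in> B_plus" "matrix_inv u' \<in> B_plus" "matrix_inv l \<in> B_minus"
    "matrix_inv l' \<in> B_minus"
    using * B_plus_inverse B_minus_inverse by auto
  moreover have "q = matrix_inv u ** A ** matrix_inv u'" "q = matrix_inv l ** A ** matrix_inv l'"
    using mult_inverse_both[OF B_invertible(1)[OF *(1)] B_invertible(1)[OF *(2)] *(7)]
      mult_inverse_both[OF B_invertible(2)[OF *(3)] B_invertible(2)[OF *(4)] *(8)] by auto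
  moreover have "\<forall>i. matrix_inv u $ i $ i * matrix_inv l $ i $ i = 1"
    "\<forall>i. matrix_inv u' $ i $ i * matrix_inv l' $ i $ i = 1"
    using * by (auto simp: B_plus_inverse_diag B_minus_inverse_diag)
  ultimately show "dressed q A" unfolding dressed_def by blast
qed

lemma double_coset_mult:
  assumes "\<And>x y. x \<in> B \<Longrightarrow> y \<in> B \<Longrightarrow> x ** y \<in> B" "b \<in> B" "b' \<in> B" "A \<in> double_coset B \<omega>"
  shows "b ** A ** b' \<in> double_coset B \<omega>"
proof -
  obtain x y where "A = x ** \<omega> ** y" "x \<in> B" "y \<in> B" using assms(4) by (auto simp: double_coset_def)
  then have "b ** A ** b' = (b ** x) ** \<omega> ** (y ** b')" "b ** x \<in> B" "y ** b' \<in> B"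
    using assms by (simp_all add: matrix_mul_assoc)
  then show ?thesis unfolding double_coset_def by blast
qed

lemma diagm_B: "(\<And>i. d i \<noteq> 0) \<Longrightarrow> diagm d \<in> B_plus" "(\<And>i. d i \<noteq> 0) \<Longrightarrow> diagm d \<in> B_minus"
  by (auto simp: B_plus_iff B_minus_iff)

text \<open>
  The exponent \<open>N\<close> replaces products along an orbit of \<open>p \<circ> inv r\<close> by products over \<open>k < N\<close>, in which
  the orbit is traversed several times. So powers of the products along orbits are formed, and their
  level sets are finite disjoint unions of those of the products, with the same connected components.
\<close>

locale cell_pair =
  fixes p r :: "'n::{finite,linorder} \<Rightarrow> 'n" and N :: nat
  assumes p: "p permutes UNIV" and r: "r permutes UNIV"
    and N: "N > 0" "(p \<circ> inv r) ^^ N = id"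
begin

abbreviation "P \<equiv> permutation_matrix p"
abbreviation "R \<equiv> permutation_matrix r"

definition "cell = double_coset B_plus P \<inter> double_coset B_minus R"

text \<open>
  On this open set \<open>A\<close> has the factorizations \<open>nu A ** A = P ** beta A\<close> and \<open>A ** mu A = gam A ** R\<close>,
  where \<open>beta A\<close> is upper and \<open>mu A\<close> lower triangular, whereas \<open>nu A\<close> and \<open>gam A\<close> are triangular for
  the orders that are permuted by \<open>p\<close> and \<open>r\<close>.
\<close>
definition "dom_coords = {A. invertible A \<and> matrix_inv A ** P \<in> big_cell \<and>
  permutation_matrix (inv r) ** A \<in> big_cell}"

definition "nu A = pconj (inv p) (matrix_inv (ul_lower (matrix_inv A ** P)))"
definition "beta A = matrix_inv (ul_upper (matrix_inv A ** P))"
definition "gam A = pconj (inv r) (ul_upper (permutation_matrix (inv r) ** A))"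
definition "mu A = ul_lower (permutation_matrix (inv r) ** A)"

lemma inv_p [simp]: "inv p (p i) = i" "p (inv p i) = i"
  using permutes_inverses[OF p] by auto

lemma inv_r [simp]: "inv r (r i) = i" "r (inv r i) = i"
  using permutes_inverses[OF r] by auto

lemma partial_order_rel_perm:
  "partial_order_rel (\<lambda>i j. p i \<le> p j)" "partial_order_rel (\<lambda>i j. r j \<le> r i)"
  "partial_order_rel (\<lambda>i j. inv p j \<le> inv p i)" "partial_order_rel (\<lambda>i j. inv r i \<le> inv r j)"
  using partial_order_rel_inj[OF permutes_inj[OF p] partial_order_rel_le(1)]
    partial_order_rel_inj[OF permutes_inj[OF r] partial_order_rel_le(2)]
    partial_order_rel_inj[OF permutes_inj[OF permutes_inv[OF p]] partial_order_rel_le(2)]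
    partial_order_rel_inj[OF permutes_inj[OF permutes_inv[OF r]] partial_order_rel_le(1)]
  by auto

lemma dom_coords_plus:
  assumes A: "A \<in> dom_coords"
  shows "nu A ** A = P ** beta A" "beta A \<in> B_plus" "nu A $ i $ i = 1"
    "tri (\<lambda>i j. inv p j \<le> inv p i) (nu A)" "invertible (nu A)"
proof -
  define g where "g = matrix_inv A ** P"
  have g: "g \<in> big_cell" and iA: "invertible A" using A by (auto simp: dom_coords_def g_def)
  note ul = ul_lower[OF g]
  define m where "m = ul_lower g"
  define b where "b = ul_upper g"
  have m: "invertible m" "lower m" "m $ i $ i = 1" "m \<in> B_minus" and b: "b \<in> B_plus" "invertible b" for i
    using ul by (auto simp: m_def b_def intro: B_invertible)
  have nu: "nu A = pconj (inv p) (matrix_inv m)" and beta: "beta A = matrix_inv b"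
    by (simp_all add: nu_def beta_def g_def m_def b_def)
  have "b = matrix_inv A ** P ** m" by (simp add: b_def ul_upper_def m_def g_def)
  then have Ab: "A ** b = P ** m"
    using inverse_matrix(1)[OF iA] by (simp add: matrix_mul_assoc)
  then have "A = P ** m ** matrix_inv b"
    by (rule matrix_solve(2)[OF b(2)])
  then have "nu A ** A = nu A ** P ** m ** matrix_inv b" by (simp add: matrix_mul_assoc)
  also have "nu A ** P = P ** matrix_inv m" by (simp add: nu perm_pconj(2)[OF p])
  also have "P ** matrix_inv m ** m ** matrix_inv b = P ** beta A"
    by (simp only: matrix_cancel[OF m(1)] beta)
  finally show "nu A ** A = P ** beta A" .
  show "beta A \<in> B_plus" unfolding beta using b B_plus_inverse by blast
  have mi: "lower (matrix_inv m)" "matrix_inv m $ i $ i = 1" for i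
    using tri_inverse[OF partial_order_rel_le(2) m(2)] m(3) by auto
  show nu1: "nu A $ i $ i = 1" for i by (simp add: nu mi)
  show tri: "tri (\<lambda>i j. inv p j \<le> inv p i) (nu A)"
    unfolding nu by (rule tri_pconj[OF mi(1)])
  show "invertible (nu A)"
    by (rule tri_invertible[OF partial_order_rel_perm(3) tri]) (simp add: nu1)
qed

lemma dom_coords_minus:
  assumes A: "A \<in> dom_coords"
  shows "A ** mu A = gam A ** R" "lower (mu A)" "mu A $ i $ i = 1" "mu A \<in> B_minus"
    "tri (\<lambda>i j. inv r i \<le> inv r j) (gam A)" "gam A $ i $ i \<noteq> 0" "invertible (gam A)"
proof -
  define h where "h = permutation_matrix (inv r) ** A"
  have h: "h \<in> big_cell" using A by (simp add: dom_coords_def h_def)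
  note ul = ul_lower[OF h]
  have gam: "gam A = pconj (inv r) (ul_upper h)" and mu: "mu A = ul_lower h"
    by (simp_all add: gam_def mu_def h_def)
  have "gam A ** R = R ** ul_upper h" unfolding gam by (simp add: perm_pconj(2)[OF r])
  also have "\<dots> = A ** mu A"
    unfolding ul_upper_def mu[symmetric] h_def using perm_inverse(1)[OF r]
    by (simp add: matrix_mul_assoc mu_def)
  finally show "A ** mu A = gam A ** R" by simp
  show "lower (mu A)" "mu A $ i $ i = 1" "mu A \<in> B_minus" using ul by (auto simp: mu)
  show tri: "tri (\<lambda>i j. inv r i \<le> inv r j) (gam A)" unfolding gam by (rule tri_pconj[OF ul(5)])
  show nz: "gam A $ i $ i \<noteq> 0" for i using ul(8) by (simp add: gam)
  show "invertible (gam A)" by (rule tri_invertible[OF partial_order_rel_perm(4) tri nz])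
qed

text \<open>
  Moving \<open>P\<close> to the right turns the left factor of \<open>A\<close> into a matrix that is triangular for a permuted
  order, and the triangular factorization of such a matrix preserves this shape.
\<close>

lemma plus_coset_coords:
  assumes "A \<in> double_coset B_plus P"
  shows "invertible A" "matrix_inv A ** P \<in> big_cell" "upper (nu A)"
proof -
  obtain x y where A: "A = x ** P ** y" and x: "x \<in> B_plus" and y: "y \<in> B_plus"
    using assms by (auto simp: double_coset_def)
  have ix: "invertible x" "invertible y" "invertible (x ** P)" "invertible P"
    using x y invertible_perm[OF p] by (auto intro: invertible_mult B_invertible)
  then show "invertible A" unfolding A by (intro invertible_mult)
  define w where "w = pconj p (matrix_inv x)"
  have xi: "matrix_inv x \<in> B_plus" using x B_plus_inverse by blast
  have "matrix_inv A = matrix_inv y ** (matrix_inv P ** matrix_inv x)"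
    unfolding A by (simp add: matrix_inv_mult ix)
  then have g: "matrix_inv A ** P = matrix_inv y ** w"
    by (simp add: w_def pconj_eq[OF p] matrix_inv_perm[OF p] matrix_mul_assoc)
  have w: "tri (\<lambda>i j. p i \<le> p j) w" "w $ i $ i \<noteq> 0" for i
    using tri_pconj[of "(\<le>)" "matrix_inv x" p] xi by (auto simp: w_def B_plus_iff)
  have big: "w \<in> big_cell" by (rule tri_in_big_cell[OF partial_order_rel_perm(1) w])
  show "matrix_inv A ** P \<in> big_cell" unfolding g
    by (rule big_cell_mult(1)[OF big B_plus_inverse[OF y]])
  have ul: "ul_lower (matrix_inv A ** P) = ul_lower w"
    unfolding g by (rule ul_lower_mult(1)[OF big B_plus_inverse[OF y]])
  have "tri (\<lambda>i j. p i \<le> p j) (matrix_inv (ul_lower w))"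
    by (rule tri_inverse(1)[OF partial_order_rel_perm(1) tri_ul_lower[OF partial_order_rel_perm(1) w]])
      (simp add: ul_lower(2)[OF big])
  from tri_pconj[OF this, of "inv p"] show "upper (nu A)" by (simp add: nu_def ul)
qed

lemma minus_coset_coords:
  assumes "A \<in> double_coset B_minus R"
  shows "permutation_matrix (inv r) ** A \<in> big_cell" "lower (gam A)"
proof -
  obtain x y where A: "A = x ** R ** y" and x: "x \<in> B_minus" and y: "y \<in> B_minus"
    using assms by (auto simp: double_coset_def)
  define d where "d i = y $ i $ i" for i
  define m where "m = diagm (\<lambda>i. 1 / d i) ** y"
  define w where "w = pconj r x ** diagm d"
  have d: "d i \<noteq> 0" for i using y by (simp add: d_def B_minus_iff)
  have ym: "y = diagm d ** m" by (simp add: m_def matrix_mul_assoc diagm_inverse d)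
  have m: "lower m" "m $ i $ i = 1" for i
    using tri_mult[OF partial_order_rel_le(2) tri_diagm[OF partial_order_rel_le(2)], of y] y d
    by (auto simp: m_def B_minus_iff d_def)
  have mB: "m \<in> B_minus" "invertible m" using m by (auto simp: B_minus_iff intro!: B_invertible)
  have h: "permutation_matrix (inv r) ** A = w ** m"
    unfolding A w_def by (subst ym) (simp add: pconj_eq[OF r] matrix_mul_assoc)
  have w: "tri (\<lambda>i j. r j \<le> r i) w" "w $ i $ i \<noteq> 0" for i
    using tri_mult(1)[OF partial_order_rel_perm(2) tri_pconj[of "(\<ge>)" x r]
        tri_diagm[OF partial_order_rel_perm(2)]] x d
    by (auto simp: w_def B_minus_iff)
  have big: "w \<in> big_cell" by (rule tri_in_big_cell[OF partial_order_rel_perm(2) w])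
  show "permutation_matrix (inv r) ** A \<in> big_cell" unfolding h by (rule big_cell_mult(2)[OF big mB(1)])
  have "ul_upper (w ** m) = w ** m ** (matrix_inv m ** ul_lower w)"
    unfolding ul_upper_def by (simp add: ul_lower_mult(2)[OF big m])
  also have "\<dots> = w ** ul_lower w"
    by (simp only: matrix_mul_assoc matrix_cancel(3)[OF mB(2)])
  finally have "tri (\<lambda>i j. r j \<le> r i) (ul_upper (w ** m))"
    using tri_mult(1)[OF partial_order_rel_perm(2) w(1) tri_ul_lower[OF partial_order_rel_perm(2) w]]
    by simp
  from tri_pconj[OF this, of "inv r"] show "lower (gam A)" by (simp add: gam_def h)
qed

lemma upper_nu_B_plus: "A \<in> dom_coords \<Longrightarrow> upper (nu A) \<Longrightarrow> nu A \<in> B_plus"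
  by (simp add: B_plus_iff dom_coords_plus)

lemma lower_gam_B_minus: "A \<in> dom_coords \<Longrightarrow> lower (gam A) \<Longrightarrow> gam A \<in> B_minus"
  by (simp add: B_minus_iff dom_coords_minus)

text \<open>
  In terms of \<open>nu\<close> and \<open>gam\<close> the cell is described by the vanishing of entries.
\<close>

lemma cell_iff: "A \<in> cell \<longleftrightarrow> A \<in> dom_coords \<and> upper (nu A) \<and> lower (gam A)"
proof
  assume "A \<in> cell"
  then show "A \<in> dom_coords \<and> upper (nu A) \<and> lower (gam A)"
    using plus_coset_coords minus_coset_coords by (auto simp: cell_def dom_coords_def)
next
  assume *: "A \<in> dom_coords \<and> upper (nu A) \<and> lower (gam A)"
  then have dom: "A \<in> dom_coords" by blast
  note pl = dom_coords_plus[OF dom] and mi = dom_coords_minus[OF dom]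
  have "A = matrix_inv (nu A) ** P ** beta A"
    using matrix_solve(1)[OF pl(5) pl(1)] by (simp add: matrix_mul_assoc)
  moreover have "matrix_inv (nu A) \<in> B_plus"
    using upper_nu_B_plus B_plus_inverse * by blast
  moreover have "A = gam A ** R ** matrix_inv (mu A)"
    by (rule matrix_solve(2)[OF B_invertible(2)[OF mi(4)] mi(1)])
  moreover have "matrix_inv (mu A) \<in> B_minus" "gam A \<in> B_minus"
    using mi(4) B_minus_inverse lower_gam_B_minus * by auto
  ultimately show "A \<in> cell"
    unfolding cell_def double_coset_def using pl(2) by blast
qed

lemma cell_invertible: "A \<in> cell \<Longrightarrow> invertible A"
  by (simp add: cell_iff dom_coords_def)

lemma cell_factors:
  assumes "A \<in> cell"
  shows "A \<in> dom_coords" "nu A \<in> B_plus" "beta A \<in> B_plus" "gam A \<in> B_minus" "mu A \<in> B_minus"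
    "A = matrix_inv (nu A) ** P ** beta A" "A = gam A ** R ** matrix_inv (mu A)"
proof -
  show dom: "A \<in> dom_coords" using assms by (simp add: cell_iff)
  note pl = dom_coords_plus[OF dom] and mi = dom_coords_minus[OF dom]
  show "A = matrix_inv (nu A) ** P ** beta A"
    using matrix_solve(1)[OF pl(5) pl(1)] by (simp add: matrix_mul_assoc)
  show "A = gam A ** R ** matrix_inv (mu A)"
    by (rule matrix_solve(2)[OF B_invertible(2)[OF mi(4)] mi(1)])
  show "nu A \<in> B_plus" "beta A \<in> B_plus" "gam A \<in> B_minus" "mu A \<in> B_minus"
    using assms pl mi upper_nu_B_plus lower_gam_B_minus by (auto simp: cell_iff)
qed

lemma cell_coords_unique:
  assumes n: "upper n" "tri (\<lambda>i j. inv p j \<le> inv p i) n" "\<And>i. n $ i $ i = 1"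
    and b: "b \<in> B_plus" and nA: "n ** A = P ** b"
    and c: "lower c" "tri (\<lambda>i j. inv r i \<le> inv r j) c" "\<And>i. c $ i $ i \<noteq> 0"
    and m: "lower m" "\<And>i. m $ i $ i = 1" and Am: "A ** m = c ** R"
  shows "A \<in> cell" "nu A = n" "beta A = b" "gam A = c" "mu A = m"
proof -
  have nB: "n \<in> B_plus" using n by (simp add: B_plus_iff)
  have mB: "m \<in> B_minus" and cB: "c \<in> B_minus" using m c by (simp_all add: B_minus_iff)
  note inv = B_invertible(1)[OF nB] B_invertible(1)[OF b] B_invertible(2)[OF mB]
  have A1: "A = matrix_inv n ** P ** b"
    using matrix_solve(1)[OF inv(1) nA] by (simp add: matrix_mul_assoc)
  have A2: "A = c ** R ** matrix_inv m"
    by (rule matrix_solve(2)[OF inv(3) Am])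
  show cell: "A \<in> cell"
    unfolding cell_def double_coset_def using A1 A2 B_plus_inverse[OF nB] b cB B_minus_inverse[OF mB] by blast
  define k where "k = pconj p n"
  have k: "lower k" "k $ i $ i = 1" for i using tri_pconj[OF n(2), of p] n(3) by (simp_all add: k_def)
  have kB: "k \<in> B_minus" "invertible k" using k by (auto simp: B_minus_iff intro!: B_invertible)
  have "matrix_inv A = matrix_inv b ** (matrix_inv P ** n)"
    unfolding A1 using inv invertible_perm[OF p]
    by (simp add: matrix_inv_mult invertible_mult invertible_matrix_inv matrix_inv_inv)
  then have g: "matrix_inv A ** P = matrix_inv b ** k"
    by (simp add: k_def pconj_eq[OF p] matrix_inv_perm[OF p] matrix_mul_assoc)
  have bi: "matrix_inv b \<in> B_plus" using b B_plus_inverse by blast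
  have big: "matrix_inv A ** P \<in> big_cell" using cell by (simp add: cell_iff dom_coords_def)
  have gk: "matrix_inv A ** P ** matrix_inv k = matrix_inv b"
    unfolding g by (rule matrix_cancel(3)[OF kB(2)])
  have low: "ul_lower (matrix_inv A ** P) = matrix_inv k"
  proof (rule ul_lower_eqI[OF big])
    show "lower (matrix_inv k)" "matrix_inv k $ i $ i = 1" for i
      using tri_inverse[OF partial_order_rel_le(2) k(1)] k(2) by auto
    show "upper (matrix_inv A ** P ** matrix_inv k)" unfolding gk using bi by (simp add: B_plus_iff)
  qed
  show "nu A = n" unfolding nu_def low matrix_inv_inv[OF kB(2)] by (simp add: k_def p)
  show "beta A = b" unfolding beta_def ul_upper_def low gk by (rule matrix_inv_inv[OF inv(2)])
  have bigh: "permutation_matrix (inv r) ** A \<in> big_cell" using cell by (simp add: cell_iff dom_coords_def)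
  have hm: "permutation_matrix (inv r) ** A ** m = pconj r c"
    by (simp add: pconj_eq[OF r] Am flip: matrix_mul_assoc)
  have lowh: "ul_lower (permutation_matrix (inv r) ** A) = m"
    using tri_pconj[OF c(2), of r] by (intro ul_lower_eqI[OF bigh] m) (simp add: hm)
  show "mu A = m" by (simp add: mu_def lowh)
  show "gam A = c" unfolding gam_def ul_upper_def lowh hm by (simp add: r)
qed

text \<open>
  A triangular matrix that is moved across \<open>P\<close> has its diagonal permuted. Hence the diagonals of any
  factorization, not only of the normalized one, determine the diagonal of \<open>beta A\<close>.
\<close>

lemma beta_diag:
  assumes A: "A \<in> cell" "A = x ** P ** y" and x: "x \<in> B_plus" and y: "y \<in> B_plus"
  shows "beta A $ j $ j = x $ p j $ p j * y $ j $ j"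
proof -
  note f = cell_factors[OF A(1)]
  have "nu A ** x ** P = P ** (beta A ** matrix_inv y)"
    using dom_coords_plus(1)[OF f(1)] inverse_matrix(1)[OF B_invertible(1)[OF y]] A(2)
    by (metis matrix_mul_assoc matrix_mul_rid)
  then have "(nu A ** x ** P) $ p j $ j = (P ** (beta A ** matrix_inv y)) $ p j $ j" by simp
  then have "(nu A ** x) $ p j $ p j = (beta A ** matrix_inv y) $ j $ j"
    by (simp add: perm_mult_left[OF p] perm_mult_right)
  moreover have "(nu A ** x) $ p j $ p j = x $ p j $ p j"
    using tri_mult(2)[OF partial_order_rel_le(1), of "nu A" x] f(2) x dom_coords_plus(3)[OF f(1)]
    by (simp add: B_plus_iff)
  moreover have "(beta A ** matrix_inv y) $ j $ j = beta A $ j $ j / y $ j $ j"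
    using tri_mult(2)[OF partial_order_rel_le(1), of "beta A" "matrix_inv y"] f(3) B_plus_inverse[OF y]
    by (simp add: B_plus_iff B_plus_inverse_diag[OF y])
  ultimately show ?thesis using y by (simp add: B_plus_iff field_simps)
qed

lemma gam_diag:
  assumes A: "A \<in> cell" "A = x ** R ** y" and x: "x \<in> B_minus" and y: "y \<in> B_minus"
  shows "gam A $ i $ i = x $ i $ i * y $ inv r i $ inv r i"
proof -
  note f = cell_factors[OF A(1)]
  note ix = inverse_matrix[OF B_invertible(2)[OF x]]
  have "matrix_inv x ** gam A ** R = R ** (y ** mu A)"
    using dom_coords_minus(1)[OF f(1)] ix A(2)
    by (metis matrix_mul_assoc matrix_mul_lid)
  then have "(matrix_inv x ** gam A ** R) $ i $ inv r i = (R ** (y ** mu A)) $ i $ inv r i" by simp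
  then have "(matrix_inv x ** gam A) $ i $ i = (y ** mu A) $ inv r i $ inv r i"
    by (simp add: perm_mult_left[OF r] perm_mult_right)
  moreover have "(y ** mu A) $ inv r i $ inv r i = y $ inv r i $ inv r i"
    using tri_mult(2)[OF partial_order_rel_le(2), of y "mu A"] f(5) y dom_coords_minus(3)[OF f(1)]
    by (simp add: B_minus_iff)
  moreover have "(matrix_inv x ** gam A) $ i $ i = gam A $ i $ i / x $ i $ i"
    using tri_mult(2)[OF partial_order_rel_le(2), of "matrix_inv x" "gam A"] f(4) B_minus_inverse[OF x]
    by (simp add: B_minus_iff B_minus_inverse_diag[OF x])
  ultimately show ?thesis using x by (simp add: B_minus_iff field_simps)
qed

definition "tau = p \<circ> inv r"
text \<open>
  The functions \<open>\<lambda>A. KK A i\<close> are Casimir functions of the cell: they are constant along the leaves.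
\<close>
definition "kappa A i = beta A $ inv r i $ inv r i * gam A $ i $ i"
definition "KK A i = (\<Prod>k<N. kappa A ((tau ^^ k) i))"

lemma tauN: "tau ^^ N = id" using N by (simp add: tau_def)

lemma kappa_nonzero: "A \<in> dom_coords \<Longrightarrow> kappa A i \<noteq> 0"
  using dom_coords_plus(2)[of A] dom_coords_minus(6)[of A] by (simp add: kappa_def B_plus_iff)

lemma KK_nonzero: "A \<in> dom_coords \<Longrightarrow> KK A i \<noteq> 0"
  by (simp add: KK_def kappa_nonzero)

lemma KK_tau: "KK A (tau i) = KK A i"
  unfolding KK_def by (rule cyclic_prod_shift[OF tauN N(1)])

text \<open>
  The factor \<open>u $ tau i $ tau i / u $ i $ i\<close> by which \<open>kappa A i\<close> changes cancels in the product along
  an orbit of \<open>tau\<close>.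
\<close>

lemma dressed_cell:
  assumes "dressed A q" "q \<in> cell"
  shows "A \<in> cell" "KK A = KK q"
proof -
  obtain u u' l l' where *: "u \<in> B_plus" "u' \<in> B_plus" "l \<in> B_minus" "l' \<in> B_minus"
    "\<And>i. u $ i $ i * l $ i $ i = 1" "\<And>i. u' $ i $ i * l' $ i $ i = 1"
    "A = u ** q ** u'" "A = l ** q ** l'"
    using assms(1) unfolding dressed_def by blast
  show A: "A \<in> cell"
    unfolding cell_def
  proof
    show "A \<in> double_coset B_plus P"
      unfolding *(7) using assms(2) * by (intro double_coset_mult B_plus_mult) (auto simp: cell_def)
    show "A \<in> double_coset B_minus R"
      unfolding *(8) using assms(2) * by (intro double_coset_mult B_minus_mult) (auto simp: cell_def)
  qed
  note f = cell_factors[OF assms(2)]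
  have "A = (u ** matrix_inv (nu q)) ** P ** (beta q ** u')"
    using *(7) f(6) by (metis matrix_mul_assoc)
  then have "beta A $ j $ j = (u ** matrix_inv (nu q)) $ p j $ p j * (beta q ** u') $ j $ j" for j
    using * f by (intro beta_diag[OF A]) (auto intro: B_plus_mult B_plus_inverse)
  moreover have "(u ** matrix_inv (nu q)) $ i $ i = u $ i $ i" for i
    using tri_mult(2)[OF partial_order_rel_le(1), of u "matrix_inv (nu q)"] *(1) B_plus_inverse[OF f(2)]
      dom_coords_plus(3)[OF f(1)]
    by (simp add: B_plus_iff B_plus_inverse_diag[OF f(2)])
  moreover have "(beta q ** u') $ i $ i = beta q $ i $ i * u' $ i $ i" for i
    using tri_mult(2)[OF partial_order_rel_le(1), of "beta q" u'] f(3) *(2) by (simp add: B_plus_iff)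
  ultimately have beta: "beta A $ j $ j = u $ p j $ p j * beta q $ j $ j * u' $ j $ j" for j by simp
  have "A = (l ** gam q) ** R ** (matrix_inv (mu q) ** l')"
    using *(8) f(7) by (metis matrix_mul_assoc)
  then have "gam A $ i $ i = (l ** gam q) $ i $ i * (matrix_inv (mu q) ** l') $ inv r i $ inv r i" for i
    using * f by (intro gam_diag[OF A]) (auto intro: B_minus_mult B_minus_inverse)
  moreover have "(matrix_inv (mu q) ** l') $ i $ i = l' $ i $ i" for i
    using tri_mult(2)[OF partial_order_rel_le(2), of "matrix_inv (mu q)" l'] *(4) B_minus_inverse[OF f(5)]
      dom_coords_minus(3)[OF f(1)]
    by (simp add: B_minus_iff B_minus_inverse_diag[OF f(5)])
  moreover have "(l ** gam q) $ i $ i = l $ i $ i * gam q $ i $ i" for i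
    using tri_mult(2)[OF partial_order_rel_le(2), of l "gam q"] f(4) *(3) by (simp add: B_minus_iff)
  ultimately have gam: "gam A $ i $ i = l $ i $ i * gam q $ i $ i * l' $ inv r i $ inv r i" for i by simp
  have "kappa A i = (u $ tau i $ tau i * l $ i $ i) * (u' $ inv r i $ inv r i * l' $ inv r i $ inv r i) * kappa q i" for i
    by (simp add: kappa_def beta gam tau_def mult_ac)
  then have kap: "kappa A i = u $ tau i $ tau i * l $ i $ i * kappa q i" for i
    using *(6) by simp
  show "KK A = KK q"
  proof
    fix i
    have "(\<Prod>k<N. u $ tau ((tau ^^ k) i) $ tau ((tau ^^ k) i)) = (\<Prod>k<N. u $ (tau ^^ k) i $ (tau ^^ k) i)"
      using cyclic_prod_shift[OF tauN N(1), of "\<lambda>i. u $ i $ i" i] by (simp add: funpow_swap1)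
    then have "KK A i = (\<Prod>k<N. u $ (tau ^^ k) i $ (tau ^^ k) i * l $ (tau ^^ k) i $ (tau ^^ k) i) * KK q i"
      by (simp add: KK_def kap prod.distrib)
    then show "KK A i = KK q i" using *(5) by simp
  qed
qed

lemma torus_cell:
  assumes A: "A \<in> cell" and a: "\<And>i. a i \<noteq> 0"
  shows "diagm a ** A \<in> cell" "gam (diagm a ** A) $ i $ i = a i * gam A $ i $ i"
    "KK (diagm a ** A) i = (\<Prod>k<N. a ((tau ^^ k) i)) ^ 2 * KK A i"
proof -
  note f = cell_factors[OF A]
  have d: "diagm a \<in> B_plus" "diagm a \<in> B_minus" using diagm_B a by auto
  show aA: "diagm a ** A \<in> cell"
    using A double_coset_mult[OF B_plus_mult d(1) mat_1_B(1), of A P]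
      double_coset_mult[OF B_minus_mult d(2) mat_1_B(2), of A R] by (simp add: cell_def)
  have "diagm a ** A = (diagm a ** matrix_inv (nu A)) ** P ** beta A"
    using f(6) by (metis matrix_mul_assoc)
  then have "beta (diagm a ** A) $ j $ j = (diagm a ** matrix_inv (nu A)) $ p j $ p j * beta A $ j $ j" for j
    using f d by (intro beta_diag[OF aA]) (auto intro: B_plus_mult B_plus_inverse)
  then have beta: "beta (diagm a ** A) $ j $ j = a (p j) * beta A $ j $ j" for j
    using dom_coords_plus(3)[OF f(1)] by (simp add: B_plus_inverse_diag[OF f(2)])
  have "diagm a ** A = (diagm a ** gam A) ** R ** matrix_inv (mu A)"
    using f(7) by (metis matrix_mul_assoc)
  then have "gam (diagm a ** A) $ i $ i = (diagm a ** gam A) $ i $ i * matrix_inv (mu A) $ inv r i $ inv r i" for i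
    using f d by (intro gam_diag[OF aA]) (auto intro: B_minus_mult B_minus_inverse)
  then show gam: "gam (diagm a ** A) $ i $ i = a i * gam A $ i $ i" for i
    using dom_coords_minus(3)[OF f(1)] by (simp add: B_minus_inverse_diag[OF f(5)])
  have kap: "kappa (diagm a ** A) i = a (tau i) * a i * kappa A i" for i
    by (simp add: kappa_def beta gam tau_def mult_ac)
  have "(\<Prod>k<N. a (tau ((tau ^^ k) i))) = (\<Prod>k<N. a ((tau ^^ k) i))"
    using cyclic_prod_shift[OF tauN N(1), of a i] by (simp add: funpow_swap1)
  then show "KK (diagm a ** A) i = (\<Prod>k<N. a ((tau ^^ k) i)) ^ 2 * KK A i"
    by (simp add: KK_def kap prod.distrib power2_eq_square)
qed

lemma KK_torus_invariant:
  assumes "A \<in> cell" "\<And>i. a i \<noteq> 0" "\<And>i. a (tau i) = a i"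
  shows "KK (diagm a ** A) i = a i ^ (2 * N) * KK A i"
  using torus_cell(3)[where a = a and i = i, OF assms(1,2)] invariant_funpow[where h = a and \<tau> = tau, OF assms(3)]
  by (simp add: power_mult[symmetric] mult.commute)

subsection \<open>The cell is connected and not empty\<close>

definition "big_poly G = det G * (\<Prod>j\<in>UNIV. det (pad {j<..} G))" for G :: "'n cmat"

lemma big_poly: "big_poly G \<noteq> 0 \<longleftrightarrow> G \<in> big_cell"
  by (auto simp: big_poly_def big_cell_def)

lemma line_poly_big_poly:
  assumes "\<And>i j. line_poly (\<lambda>G. F G $ i $ j)"
  shows "line_poly (\<lambda>G. big_poly (F G))"
proof -
  have "line_poly (\<lambda>G. pad S (F G) $ i $ j)" for S i j
    using assms[of i j] by (cases "i \<in> S \<and> j \<in> S"; cases "i = j") (auto simp: pad_def)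
  then show ?thesis
    unfolding big_poly_def using assms by (intro line_poly_mult line_poly_prod line_poly_det)
qed

text \<open>
  Suppose that \<open>G = n c\<close> and \<open>P\<^sup>-\<^sup>1 G R = b m\<^sup>-\<^sup>1\<close> with upper triangular \<open>n\<close>, \<open>b\<close> and lower triangular
  \<open>c\<close>, \<open>m\<close>. Then \<open>c R m = n\<^sup>-\<^sup>1 P b\<close> belongs to the cell. This element is \<open>cell_param G\<close>, with \<open>n\<close> and \<open>m\<close>
  chosen unipotent.
\<close>
definition "PGR G = permutation_matrix (inv p) ** G ** R"
definition "cell_param G = diagm (\<lambda>i. ul_upper G $ i $ i) ** matrix_inv (ul_lower G) ** R ** ul_lower (PGR G)"

lemma PGR_nth: "PGR G $ i $ j = G $ p i $ r j"
  by (simp add: PGR_def perm_mult_left[OF permutes_inv[OF p]] perm_mult_right permutes_inv_inv[OF p])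

lemma PGR_cell:
  assumes A: "A \<in> cell"
  shows "PGR (nu A ** gam A) \<in> big_cell" "ul_lower (PGR (nu A ** gam A)) = matrix_inv (mu A)"
proof -
  note f = cell_factors[OF A]
  have "PGR (nu A ** gam A) = permutation_matrix (inv p) ** nu A ** (gam A ** R)"
    by (simp add: PGR_def matrix_mul_assoc)
  also have "\<dots> = permutation_matrix (inv p) ** (nu A ** A) ** mu A"
    unfolding dom_coords_minus(1)[OF f(1), symmetric] by (simp only: matrix_mul_assoc)
  also have "\<dots> = beta A ** mu A"
    using perm_inverse(2)[OF p] by (simp add: dom_coords_plus(1)[OF f(1)] matrix_mul_assoc)
  finally have PGR: "PGR (nu A ** gam A) = beta A ** mu A" .
  have bbig: "beta A \<in> big_cell"
    using f(3) by (intro tri_in_big_cell[OF partial_order_rel_le(1)]) (auto simp: B_plus_iff)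
  show "PGR (nu A ** gam A) \<in> big_cell" unfolding PGR by (rule big_cell_mult(2)[OF bbig f(5)])
  have "(mat 1 :: 'n cmat) $ i $ i = 1" for i by (simp add: mat_def)
  then have "ul_lower (beta A) = mat 1"
    using f(3) by (intro ul_lower_eqI[OF bbig]) (simp_all add: B_plus_iff)
  then show "ul_lower (PGR (nu A ** gam A)) = matrix_inv (mu A)"
    unfolding PGR using ul_lower_mult(2)[OF bbig dom_coords_minus(2,3)[OF f(1)]] by simp
qed

lemma cell_param_image: "cell_param ` {G. G \<in> big_cell \<and> PGR G \<in> big_cell} = cell"
proof
  show "cell_param ` {G. G \<in> big_cell \<and> PGR G \<in> big_cell} \<subseteq> cell"
  proof safe
    fix G assume G: "G \<in> big_cell" "PGR G \<in> big_cell"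
    note u = ul_lower[OF G(1)] and u' = ul_lower[OF G(2)]
    define h where "h = diagm (\<lambda>i. ul_upper G $ i $ i)"
    define c where "c = h ** matrix_inv (ul_lower G)"
    define n where "n = ul_upper G ** matrix_inv h"
    define A where "A = c ** R ** ul_lower (PGR G)"
    have h: "h \<in> B_plus" "h \<in> B_minus" "invertible h"
      using u(8) diagm_B[of "\<lambda>i. ul_upper G $ i $ i"] B_invertible by (auto simp: h_def)
    have c: "c \<in> B_minus" and n: "n \<in> B_plus" "invertible n"
      using h u by (auto simp: c_def n_def intro!: B_minus_mult B_plus_mult B_minus_inverse B_plus_inverse
          invertible_mult B_invertible(1) invertible_matrix_inv)
    have "n ** c = ul_upper G ** matrix_inv (ul_lower G)"
      unfolding n_def c_def by (simp only: matrix_mul_assoc matrix_cancel(4)[OF h(3)])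
    also have "\<dots> = G"
      unfolding ul_upper_def by (rule matrix_cancel(3)[OF u(4)])
    finally have nc: "n ** c = G" .
    have "n ** A = P ** ul_upper (PGR G)"
      unfolding A_def ul_upper_def using nc perm_inverse(1)[OF p]
      by (simp add: PGR_def matrix_mul_assoc)
    from matrix_solve(1)[OF n(2) this] have "A = matrix_inv n ** P ** ul_upper (PGR G)"
      by (simp add: matrix_mul_assoc)
    then have "A \<in> cell"
      unfolding cell_def double_coset_def using B_plus_inverse[OF n(1)] u'(3,6) c A_def by blast
    then show "cell_param G \<in> cell" by (simp add: cell_param_def A_def c_def h_def)
  qed
next
  show "cell \<subseteq> cell_param ` {G. G \<in> big_cell \<and> PGR G \<in> big_cell}"
  proof
    fix A assume A: "A \<in> cell"
    note f = cell_factors[OF A]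
    define G where "G = nu A ** gam A"
    define h where "h = diagm (\<lambda>i. gam A $ i $ i)"
    have gam: "lower (gam A)" "\<And>i. gam A $ i $ i \<noteq> 0" "invertible (gam A)"
      using f(4) B_invertible by (auto simp: B_minus_iff)
    have hB: "h \<in> B_minus" "invertible h"
      using diagm_B(2)[of "\<lambda>i. gam A $ i $ i"] gam(2) B_invertible by (auto simp: h_def)
    have gbig: "gam A \<in> big_cell" by (rule tri_in_big_cell[OF partial_order_rel_le(2) gam(1,2)])
    have Gbig: "G \<in> big_cell" unfolding G_def by (rule big_cell_mult(1)[OF gbig f(2)])
    have gi: "gam A ** (matrix_inv (gam A) ** h) = h"
      by (rule matrix_cancel(1)[OF gam(3)])
    have "ul_lower (gam A) = matrix_inv (gam A) ** h"
    proof (rule ul_lower_eqI[OF gbig])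
      show "lower (matrix_inv (gam A) ** h)" "(matrix_inv (gam A) ** h) $ i $ i = 1" for i
        using tri_mult(1)[OF partial_order_rel_le(2), of "matrix_inv (gam A)" h] B_minus_inverse[OF f(4)] hB gam(2)
        by (simp_all add: B_minus_iff h_def B_minus_inverse_diag[OF f(4)])
      show "upper (gam A ** (matrix_inv (gam A) ** h))" unfolding gi by (simp add: h_def)
    qed
    then have low: "ul_lower G = matrix_inv (gam A) ** h"
      unfolding G_def using ul_lower_mult(1)[OF gbig f(2)] by simp
    have "ul_upper G = G ** (matrix_inv (gam A) ** h)" by (simp only: ul_upper_def low)
    also have "\<dots> = nu A ** h" unfolding G_def by (simp only: gi flip: matrix_mul_assoc)
    finally have up: "ul_upper G $ i $ i = gam A $ i $ i" for i
      using dom_coords_plus(3)[OF f(1)] by (simp add: h_def)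
    have PGRbig: "PGR G \<in> big_cell" and low': "ul_lower (PGR G) = matrix_inv (mu A)"
      using PGR_cell[OF A] by (simp_all add: G_def)
    have "matrix_inv (ul_lower G) = matrix_inv h ** gam A"
      unfolding low using gam(3) hB(2) by (simp add: matrix_inv_mult matrix_inv_inv invertible_matrix_inv)
    then have "cell_param G = h ** (matrix_inv h ** gam A) ** R ** matrix_inv (mu A)"
      unfolding cell_param_def up low' h_def by simp
    also have "\<dots> = A"
      using f(7) inverse_matrix(1)[OF hB(2)] by (simp add: matrix_mul_assoc)
    finally show "A \<in> cell_param ` {G. G \<in> big_cell \<and> PGR G \<in> big_cell}"
      using Gbig PGRbig by blast
  qed
qed

text \<open>
  The parameters \<open>G\<close> form the complement of the zero set of one polynomial. It is not zero because
  each of its two factors has a point at which it does not vanish.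
\<close>

lemma cell_connected_nonempty: "connected cell" "cell \<noteq> {}"
proof -
  let ?Q = "{G. G \<in> big_cell \<and> PGR G \<in> big_cell}"
  have lp: "line_poly big_poly" "line_poly (\<lambda>G. big_poly (PGR G))"
    by (auto intro!: line_poly_big_poly simp: PGR_nth)
  have Q: "?Q = {G. big_poly G * big_poly (PGR G) \<noteq> 0}" using big_poly by auto
  have one: "(mat 1 :: 'n cmat) \<in> big_cell"
    by (rule tri_in_big_cell[OF partial_order_rel_le(1)]) (auto simp: mat_def tri_def)
  have "PGR (P ** permutation_matrix (inv r)) = mat 1"
    by (simp only: PGR_def matrix_mul_assoc perm_inverse(2)[OF p] matrix_mul_lid perm_inverse(2)[OF r])
  then have "?Q \<noteq> {}"
    using line_poly_common_nonzero[OF lp, of "mat 1" "P ** permutation_matrix (inv r)"] one big_poly by auto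
  then show "cell \<noteq> {}" using cell_param_image by blast
  have "connected ?Q" unfolding Q by (intro connected_line_poly_nonzero line_poly_mult lp)
  moreover have "isCont cell_param G" if "G \<in> ?Q" for G
  proof (rule mdiff_isCont)
    have G: "G \<in> big_cell" "PGR G \<in> big_cell" using that by auto
    have "mdiff PGR G" unfolding PGR_def[abs_def] by (intro mdiff_mult mdiff_const mdiff_ident)
    then show "mdiff cell_param G"
      unfolding cell_param_def[abs_def] using G ul_lower(4)[OF G(1)]
      by (intro mdiff_mult mdiff_diagm mdiff_entry mdiff_matrix_inv mdiff_ul_lower mdiff_ul_upper
          mdiff_const mdiff_ident)
  qed
  then have "continuous_on ?Q cell_param" using continuous_at_imp_continuous_on by blast
  ultimately have "connected (cell_param ` ?Q)" by (intro connected_continuous_image)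
  then show "connected cell" by (simp only: cell_param_image)
qed

end


section \<open>Curves in the level sets\<close>

lemma bounded_bilinear_matrix_mult:
  "bounded_bilinear ((**) :: ('n::finite) cmat \<Rightarrow> 'n cmat \<Rightarrow> 'n cmat)"
proof -
  have "bilinear ((**) :: 'n cmat \<Rightarrow> 'n cmat \<Rightarrow> 'n cmat)"
    unfolding bilinear_def
    by (auto intro!: linearI simp: vec_eq_iff matrix_matrix_mult_def scaleR_sum_right
        sum.distrib distrib_left distrib_right)
  then show ?thesis by (simp add: bilinear_conv_bounded_bilinear)
qed

lemmas has_vector_derivative_matrix_mult =
  bounded_bilinear.has_vector_derivative[OF bounded_bilinear_matrix_mult]

lemmas has_vector_derivative_entry =
  bounded_linear.has_vector_derivative[OF bounded_linear_entry]

lemma has_vector_derivative_chain: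
  assumes "(\<gamma> has_vector_derivative \<xi>) (at t)" "(F has_derivative D) (at (\<gamma> t))"
  shows "((\<lambda>s. F (\<gamma> s)) has_vector_derivative D \<xi>) (at t)"
  using vector_derivative_diff_chain_within[of \<gamma> \<xi> t UNIV F D] assms
    has_derivative_at_withinI[OF assms(2), of "range \<gamma>"]
  by (simp add: o_def)

lemma mdiff_curve:
  assumes "(\<gamma> has_vector_derivative \<xi>) (at t)" "mdiff F (\<gamma> t)"
  obtains F' where "((\<lambda>s. F (\<gamma> s)) has_vector_derivative F') (at t)"
  using has_vector_derivative_chain[OF assms(1)] assms(2) unfolding mdiff_def by blast

lemma has_vector_derivative_unique_near:
  assumes "(f has_vector_derivative f') (at t)" "(g has_vector_derivative g') (at t)"
    and "e > 0" "\<And>s. \<bar>s - t\<bar> < e \<Longrightarrow> f s = g s"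
  shows "f' = g'"
proof -
  have "(g has_vector_derivative f') (at t)"
    using assms(3,4)
    by (intro has_vector_derivative_transform_within_open[OF assms(1), of "ball t e"])
      (auto simp: dist_real_def abs_minus_commute)
  then show ?thesis using assms(2) vector_derivative_unique_at by blast
qed

lemma tri_scaleR: "tri Q A \<Longrightarrow> tri Q (s *\<^sub>R A)"
  by (auto simp: tri_def)

lemma tri_derivative:
  fixes F :: "real \<Rightarrow> ('n::finite) cmat"
  assumes "(F has_vector_derivative F') (at t)" "e > 0" "\<And>s. \<bar>s - t\<bar> < e \<Longrightarrow> tri Q (F s)"
  shows "tri Q F'"
  unfolding tri_def
proof (intro allI impI, rule ccontr)
  fix i j assume *: "F' $ i $ j \<noteq> 0" "\<not> Q i j"
  have "F' $ i $ j = 0"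
    using has_vector_derivative_unique_near[OF has_vector_derivative_entry[OF assms(1)]
        has_vector_derivative_const[of 0] assms(2), of i j] assms(3) *(2)
    by (meson triD)
  then show False using * by simp
qed

lemma diag_derivative:
  fixes F :: "real \<Rightarrow> ('n::finite) cmat"
  assumes "(F has_vector_derivative F') (at t)" "e > 0" "\<And>s. \<bar>s - t\<bar> < e \<Longrightarrow> F s $ i $ i = c"
  shows "F' $ i $ i = 0"
  using has_vector_derivative_unique_near[OF has_vector_derivative_entry[OF assms(1)]
      has_vector_derivative_const[of c] assms(2), of i i] assms(3) by blast

lemma has_vector_derivative_log_prod:
  fixes f :: "nat \<Rightarrow> real \<Rightarrow> complex"
  assumes "\<And>k. k < M \<Longrightarrow> (f k has_vector_derivative f' k) (at t)" "\<And>k. k < M \<Longrightarrow> f k t \<noteq> 0"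
  shows "((\<lambda>s. \<Prod>k<M. f k s) has_vector_derivative (\<Prod>k<M. f k t) * (\<Sum>k<M. f' k / f k t)) (at t)"
  using assms
proof (induction M)
  case (Suc M)
  have "((\<lambda>s. (\<Prod>k<M. f k s) * f M s) has_vector_derivative
      (\<Prod>k<M. f k t) * f' M + (\<Prod>k<M. f k t) * (\<Sum>k<M. f' k / f k t) * f M t) (at t)"
    using Suc by (intro has_vector_derivative_mult) auto
  moreover have "(\<Prod>k<M. f k t) * f' M + (\<Prod>k<M. f k t) * (\<Sum>k<M. f' k / f k t) * f M t =
      (\<Prod>k<Suc M. f k t) * (\<Sum>k<Suc M. f' k / f k t)"
    using Suc.prems(2)[of M] by (simp add: field_simps)
  ultimately show ?case by simp
qed simp

context cell_pair
begin

lemma dom_coords_diff: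
  assumes "A \<in> dom_coords"
  shows "mdiff nu A" "mdiff beta A" "mdiff gam A" "mdiff mu A"
proof -
  have A: "invertible A" "matrix_inv A ** P \<in> big_cell" "permutation_matrix (inv r) ** A \<in> big_cell"
    using assms by (auto simp: dom_coords_def)
  have i: "mdiff (\<lambda>A. matrix_inv A ** P) A" using A by (intro mdiff_mult mdiff_matrix_inv) auto
  have j: "mdiff (\<lambda>A. permutation_matrix (inv r) ** A) A" by (intro mdiff_mult) auto
  show "mdiff nu A"
    unfolding nu_def[abs_def] using A i ul_lower(4)[OF A(2)]
    by (intro mdiff_pconj mdiff_matrix_inv mdiff_ul_lower)
  show "mdiff beta A"
    unfolding beta_def[abs_def] using A i B_invertible(1)[OF ul_lower(6)[OF A(2)]]
    by (intro mdiff_matrix_inv mdiff_ul_upper)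
  show "mdiff gam A" unfolding gam_def[abs_def] using A j by (intro mdiff_pconj mdiff_ul_upper)
  show "mdiff mu A" unfolding mu_def[abs_def] using A j by (intro mdiff_ul_lower)
qed

lemma open_dom_coords: "open dom_coords"
proof -
  have "open {A \<in> GL. matrix_inv A ** P \<in> big_cell}"
    by (rule open_continuous_preimage[OF open_GL _ open_big_cell])
      (auto simp: GL_def intro!: mdiff_isCont mdiff_mult mdiff_matrix_inv)
  moreover have "open {A \<in> UNIV. permutation_matrix (inv r) ** A \<in> big_cell}"
    by (rule open_continuous_preimage[OF open_UNIV _ open_big_cell])
      (auto intro!: mdiff_isCont mdiff_mult)
  moreover have "dom_coords = {A \<in> GL. matrix_inv A ** P \<in> big_cell} \<inter>
      {A \<in> UNIV. permutation_matrix (inv r) ** A \<in> big_cell}"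
    by (auto simp: dom_coords_def GL_def)
  ultimately show ?thesis by (simp only:) (rule open_Int)
qed

definition "level q = {A \<in> cell. KK A = KK q}"

text \<open>
  The logarithmic derivative of \<open>KK\<close> vanishes along the curve, so that the difference equation for
  a diagonal matrix \<open>d\<close> has a solution, by which the two triangular displacements can be corrected
  until their diagonals are opposite to each other.
\<close>

lemma tangent_in_distribution:
  assumes \<gamma>: "(\<gamma> has_vector_derivative \<xi>) (at t)" and e: "e > 0"
    and lev: "\<And>s. \<bar>s - t\<bar> < e \<Longrightarrow> \<gamma> s \<in> level q"
  shows "\<xi> \<in> hamiltonian_distribution (\<gamma> t)"
proof -
  define A where "A = \<gamma> t"
  have cell: "\<gamma> s \<in> cell" if "\<bar>s - t\<bar> < e" for s using lev[OF that] by (simp add: level_def)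
  have A: "A \<in> cell" using cell[of t] e by (simp add: A_def)
  note f = cell_factors[OF A] and dom = cell_factors(1)[OF A]
  note dp = dom_coords_plus[OF dom] and dm = dom_coords_minus[OF dom]
  note diff = dom_coords_diff[OF dom, unfolded A_def]
  obtain nu' where nu': "((\<lambda>s. nu (\<gamma> s)) has_vector_derivative nu') (at t)"
    by (rule mdiff_curve[OF \<gamma> diff(1)])
  obtain beta' where beta': "((\<lambda>s. beta (\<gamma> s)) has_vector_derivative beta') (at t)"
    by (rule mdiff_curve[OF \<gamma> diff(2)])
  obtain gam' where gam': "((\<lambda>s. gam (\<gamma> s)) has_vector_derivative gam') (at t)"
    by (rule mdiff_curve[OF \<gamma> diff(3)])
  obtain mu' where mu': "((\<lambda>s. mu (\<gamma> s)) has_vector_derivative mu') (at t)"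
    by (rule mdiff_curve[OF \<gamma> diff(4)])
  have domg: "\<gamma> s \<in> dom_coords" if "\<bar>s - t\<bar> < e" for s using cell_factors(1)[OF cell[OF that]] .
  have tri': "upper nu'" "upper beta'" "lower gam'" "lower mu'"
    using tri_derivative[OF nu' e] tri_derivative[OF beta' e] tri_derivative[OF gam' e]
      tri_derivative[OF mu' e] cell_factors[OF cell]
    by (auto simp: B_plus_iff B_minus_iff)
  have diag': "nu' $ i $ i = 0" "mu' $ i $ i = 0" for i
    using diag_derivative[OF nu' e, of i 1] diag_derivative[OF mu' e, of i 1]
      dom_coords_plus(3)[OF domg] dom_coords_minus(3)[OF domg] by auto
  have eq1: "nu A ** \<xi> + nu' ** A = P ** beta'"
    unfolding A_def
  proof (rule has_vector_derivative_unique_near[OF has_vector_derivative_matrix_mult[OF nu' \<gamma>] _ e])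
    show "((\<lambda>s. P ** beta (\<gamma> s)) has_vector_derivative P ** beta') (at t)"
      using has_vector_derivative_matrix_mult[OF has_vector_derivative_const beta', of P] by simp
    show "nu (\<gamma> s) ** \<gamma> s = P ** beta (\<gamma> s)" if "\<bar>s - t\<bar> < e" for s
      by (rule dom_coords_plus(1)[OF domg[OF that]])
  qed
  have eq2: "A ** mu' + \<xi> ** mu A = gam' ** R"
    unfolding A_def
  proof (rule has_vector_derivative_unique_near[OF has_vector_derivative_matrix_mult[OF \<gamma> mu'] _ e])
    show "((\<lambda>s. gam (\<gamma> s) ** R) has_vector_derivative gam' ** R) (at t)"
      using has_vector_derivative_matrix_mult[OF gam' has_vector_derivative_const, of R] by simp
    show "\<gamma> s ** mu (\<gamma> s) = gam (\<gamma> s) ** R" if "\<bar>s - t\<bar> < e" for s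
      by (rule dom_coords_minus(1)[OF domg[OF that]])
  qed
  define g where "g i = - (beta' $ inv r i $ inv r i / beta A $ inv r i $ inv r i +
    gam' $ i $ i / gam A $ i $ i)" for i
  have nz: "beta A $ i $ i \<noteq> 0" "gam A $ i $ i \<noteq> 0" for i
    using f(3) dm(6) by (auto simp: B_plus_iff)
  have sum0: "(\<Sum>k<N. g ((tau ^^ k) i)) = 0" for i
  proof -
    define kap' where "kap' i = beta A $ inv r i $ inv r i * gam' $ i $ i +
      beta' $ inv r i $ inv r i * gam A $ i $ i" for i
    have kap: "((\<lambda>s. kappa (\<gamma> s) i) has_vector_derivative kap' i) (at t)" for i
      unfolding kappa_def kap'_def A_def
      by (intro has_vector_derivative_mult has_vector_derivative_entry beta' gam')
    have "((\<lambda>s. \<Prod>k<N. kappa (\<gamma> s) ((tau ^^ k) i)) has_vector_derivative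
        (\<Prod>k<N. kappa (\<gamma> t) ((tau ^^ k) i)) *
        (\<Sum>k<N. kap' ((tau ^^ k) i) / kappa (\<gamma> t) ((tau ^^ k) i))) (at t)"
      using kappa_nonzero[OF dom] by (intro has_vector_derivative_log_prod kap) (auto simp: A_def)
    then have "((\<lambda>s. KK (\<gamma> s) i) has_vector_derivative
        KK A i * (\<Sum>k<N. kap' ((tau ^^ k) i) / kappa A ((tau ^^ k) i))) (at t)"
      by (simp add: KK_def A_def)
    then have "KK A i * (\<Sum>k<N. kap' ((tau ^^ k) i) / kappa A ((tau ^^ k) i)) = 0"
      by (rule has_vector_derivative_unique_near[OF _ has_vector_derivative_const[of "KK q i"] e])
        (use lev in \<open>auto simp: level_def\<close>)
    then have "(\<Sum>k<N. kap' ((tau ^^ k) i) / kappa A ((tau ^^ k) i)) = 0"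
      using KK_nonzero[OF dom] by simp
    moreover have "kap' i / kappa A i = - g i" for i
      using nz by (simp add: kap'_def kappa_def g_def field_simps)
    ultimately show ?thesis by (simp add: sum_negf)
  qed
  define d where "d i = (\<Sum>k<N. of_nat k * g ((tau ^^ k) i)) / of_nat N" for i
  have d: "d (tau i) - d i = g i" for i
    unfolding d_def by (rule cyclic_difference_equation[OF N(1) tauN sum0])
  define d' where "d' i = gam' $ i $ i / gam A $ i $ i - d i" for i
  have pd: "pconj p (diagm d) = diagm (\<lambda>j. d (p j))" "pconj r (diagm d') = diagm (\<lambda>j. d' (r j))"
    using permutes_inj[OF p] permutes_inj[OF r] by (auto simp: vec_eq_iff inj_eq)
  define \<beta>i where "\<beta>i = matrix_inv (beta A)"
  define \<nu>i where "\<nu>i = matrix_inv (nu A)"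
  define \<gamma>i where "\<gamma>i = matrix_inv (gam A)"
  define \<mu>i where "\<mu>i = matrix_inv (mu A)"
  have inv: "invertible (beta A)" "invertible (nu A)" "invertible (gam A)" "invertible (mu A)"
    using f B_invertible by auto
  have triA: "upper (beta A)" "upper \<beta>i" "upper (nu A)" "upper \<nu>i" "lower (gam A)" "lower \<gamma>i"
    "lower (mu A)" "lower \<mu>i"
    using f B_plus_inverse B_minus_inverse
    by (auto simp: B_plus_iff B_minus_iff \<beta>i_def \<nu>i_def \<gamma>i_def \<mu>i_def)
  have diA: "\<beta>i $ i $ i = 1 / beta A $ i $ i" "\<nu>i $ i $ i = 1" "\<gamma>i $ i $ i = 1 / gam A $ i $ i"
    "\<mu>i $ i $ i = 1" for i
    using f dp(3) dm(3)
    by (simp_all add: \<beta>i_def \<nu>i_def \<gamma>i_def \<mu>i_def B_plus_inverse_diag B_minus_inverse_diag)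
  note U = tri_mult[OF partial_order_rel_le(1)] and L = tri_mult[OF partial_order_rel_le(2)]
  \<comment> \<open>The first terms come from the differentiation of \<open>nu A ** A = P ** beta A\<close> and
    \<open>A ** mu A = gam A ** R\<close>; the terms with \<open>d\<close> and \<open>d'\<close> cancel in \<open>A ** x - z ** A\<close> and
    \<open>A ** x' - z' ** A\<close> and adjust the diagonals.\<close>
  define x where "x = \<beta>i ** beta' + \<beta>i ** (diagm (\<lambda>j. d (p j)) ** beta A)"
  define z where "z = \<nu>i ** nu' + \<nu>i ** (diagm d ** nu A)"
  define x' where "x' = mu A ** (diagm (\<lambda>j. d' (r j)) ** \<mu>i) - mu' ** \<mu>i"
  define z' where "z' = gam A ** (diagm d' ** \<gamma>i) - gam' ** \<gamma>i"
  have "upper x" "upper z" "lower x'" "lower z'"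
    unfolding x_def z_def x'_def z'_def
    by (intro tri_add tri_diff U(1) L(1) triA tri' tri_diagm partial_order_rel_le)+
  moreover have "x' $ i $ i = - x $ i $ i" for i
  proof -
    have "x $ i $ i = beta' $ i $ i / beta A $ i $ i + d (p i)"
      using U(2)[OF triA(2) tri'(2), of i] nz
        U(2)[OF triA(2) U(1)[OF tri_diagm triA(1)], of "\<lambda>j. d (p j)" i]
      by (simp add: x_def diA)
    moreover have "x' $ i $ i = d' (r i)"
      using L(2)[OF triA(7) L(1)[OF tri_diagm triA(8)], of "\<lambda>j. d' (r j)" i]
        L(2)[OF tri'(4) triA(8), of i] dm(3)
      by (simp add: x'_def diA diag')
    moreover have "d (r i) = d (p i) + (beta' $ i $ i / beta A $ i $ i + gam' $ r i $ r i / gam A $ r i $ r i)"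
      using d[of "r i"] by (simp add: tau_def g_def algebra_simps)
    ultimately show ?thesis by (simp add: d'_def)
  qed
  moreover have "z' $ i $ i = - z $ i $ i" for i
  proof -
    have "z $ i $ i = d i"
      using U(2)[OF triA(4) tri'(1), of i] dp(3)
        U(2)[OF triA(4) U(1)[OF tri_diagm triA(3)], of d i]
      by (simp add: z_def diA diag')
    moreover have "z' $ i $ i = d' i - gam' $ i $ i / gam A $ i $ i"
      using L(2)[OF triA(5) L(1)[OF tri_diagm triA(6)], of d' i]
        L(2)[OF tri'(3) triA(6), of i] nz
      by (simp add: z'_def diA)
    ultimately show ?thesis by (simp add: d'_def)
  qed
  moreover have "\<xi> = A ** x - z ** A"
  proof -
    have A\<beta>: "A ** \<beta>i = \<nu>i ** P"
      unfolding \<beta>i_def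
      by (rule matrix_solve(2)[OF inv(1), symmetric])
        (use f(6) in \<open>simp add: \<nu>i_def\<close>)
    have "A ** x = \<nu>i ** P ** beta' + \<nu>i ** (P ** pconj p (diagm d)) ** beta A"
      unfolding x_def pd[symmetric] matrix_add_ldistrib matrix_mul_assoc A\<beta> by (rule refl)
    also have "\<nu>i ** (P ** pconj p (diagm d)) ** beta A = \<nu>i ** diagm d ** (nu A ** A)"
      unfolding perm_pconj(1)[OF p] dp(1) by (simp only: matrix_mul_assoc)
    finally have "A ** x - z ** A = \<nu>i ** (P ** beta' - nu' ** A)"
      unfolding z_def matrix_add_rdistrib matrix_diff_ldistrib
      by (simp add: matrix_mul_assoc)
    also have "\<dots> = \<xi>"
      unfolding eq1[symmetric] by (simp add: \<nu>i_def matrix_cancel[OF inv(2)])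
    finally show ?thesis by simp
  qed
  moreover have "\<xi> = A ** x' - z' ** A"
  proof -
    have \<gamma>A: "\<gamma>i ** A = R ** \<mu>i"
      unfolding \<gamma>i_def
      by (rule matrix_solve(1)[OF inv(3), symmetric])
        (use f(7) in \<open>simp add: \<mu>i_def matrix_mul_assoc\<close>)
    have "z' ** A = gam A ** diagm d' ** (\<gamma>i ** A) - gam' ** (\<gamma>i ** A)"
      unfolding z'_def matrix_diff_rdistrib by (simp only: matrix_mul_assoc)
    also have "\<dots> = gam A ** (diagm d' ** R) ** \<mu>i - gam' ** R ** \<mu>i"
      unfolding \<gamma>A by (simp only: matrix_mul_assoc)
    also have "gam A ** (diagm d' ** R) ** \<mu>i = (A ** mu A) ** pconj r (diagm d') ** \<mu>i"
      unfolding perm_pconj(1)[OF r, of "diagm d'", symmetric] dm(1) by (simp only: matrix_mul_assoc)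
    finally have "A ** x' - z' ** A = (gam' ** R - A ** mu') ** \<mu>i"
      unfolding x'_def matrix_diff_rdistrib matrix_diff_ldistrib pd
      by (simp add: matrix_mul_assoc)
    also have "\<dots> = \<xi>"
      unfolding eq2[symmetric] by (simp add: \<mu>i_def matrix_cancel[OF inv(4)])
    finally show ?thesis by simp
  qed
  ultimately show ?thesis
    unfolding A_def[symmetric] hamiltonian_distribution_iff[OF cell_invertible[OF A]] by blast
qed

end

text \<open>
  A vector of the distribution is the velocity of a curve of dressing transformations: the left
  factors are prescribed as the inverse of \<open>1 + s z\<close> and \<open>1 - s z'\<close>, and the right factors are found by
  factorizing \<open>G s = A\<^sup>-\<^sup>1 (1 + s z) (1 - s z') A\<close>. The diagonal of \<open>G s\<close> is shared equally between
  the two right factors by means of a square root.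
\<close>

lemma distribution_dressing_curve:
  assumes A: "invertible A" and \<xi>: "\<xi> \<in> hamiltonian_distribution A"
  obtains \<gamma> e where "e > 0" "\<gamma> 0 = A" "(\<gamma> has_vector_derivative \<xi>) (at 0)"
    "\<And>s. \<bar>s\<bar> < e \<Longrightarrow> dressed (\<gamma> s) A"
proof -
  obtain x x' z z' where *: "upper x" "upper z" "lower x'" "lower z'"
    "\<And>i. x' $ i $ i = - x $ i $ i" "\<And>i. z' $ i $ i = - z $ i $ i"
    "\<xi> = A ** x - z ** A" "\<xi> = A ** x' - z' ** A"
    using \<xi> hamiltonian_distribution_iff[OF A] by blast
  note U = tri_mult[OF partial_order_rel_le(1)] and L = tri_mult[OF partial_order_rel_le(2)]
  have one_diag [simp]: "(mat 1 :: 'a cmat) $ i $ i = 1" for i by (simp add: mat_def)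
  define u where "u s = mat 1 + s *\<^sub>R z" for s :: real
  define l where "l s = mat 1 - s *\<^sub>R z'" for s :: real
  define G where "G s = matrix_inv A ** (u s ** l s) ** A" for s
  define e where "e s i = exp (- Ln (ul_upper (G s) $ i $ i) / 2)" for s i
  define \<gamma> where "\<gamma> s = l s ** (A ** (ul_lower (G s) ** diagm (e s)))" for s
  have u': "(u has_vector_derivative z) (at 0)"
    unfolding u_def[abs_def] by (auto intro!: derivative_eq_intros)
  have l': "(l has_vector_derivative - z') (at 0)"
    unfolding l_def[abs_def] by (auto intro!: derivative_eq_intros)
  have ul0: "u 0 = mat 1" "l 0 = mat 1" by (simp_all add: u_def l_def)
  define G' where "G' = matrix_inv A ** (z - z') ** A"
  have G': "(G has_vector_derivative G') (at 0)"
  proof -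
    have "((\<lambda>s. u s ** l s) has_vector_derivative u 0 ** - z' + z ** l 0) (at 0)"
      by (rule has_vector_derivative_matrix_mult[OF u' l'])
    then have "((\<lambda>s. u s ** l s) has_vector_derivative z - z') (at 0)" by (simp add: ul0)
    then have "((\<lambda>s. matrix_inv A ** (u s ** l s)) has_vector_derivative matrix_inv A ** (z - z')) (at 0)"
      using has_vector_derivative_matrix_mult[OF has_vector_derivative_const, of "\<lambda>s. u s ** l s"] by fastforce
    then show ?thesis
      unfolding G_def[abs_def] G'_def
      using has_vector_derivative_matrix_mult[OF _ has_vector_derivative_const, of _ _ _ _ A] by fastforce
  qed
  have G0: "G 0 = mat 1" by (simp add: G_def ul0 inverse_matrix[OF A])
  have big1: "(mat 1 :: 'a cmat) \<in> big_cell" by (rule tri_in_big_cell[OF partial_order_rel_le(1)]) auto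
  have low1: "ul_lower (mat 1 :: 'a cmat) = mat 1" by (rule ul_lower_eqI[OF big1]) auto
  have low0: "ul_lower (G 0) = mat 1" by (simp add: G0 low1)
  have up0: "ul_upper (G 0) = mat 1" by (simp add: ul_upper_def low1 G0)
  have e0: "diagm (e 0) = mat 1" by (simp add: e_def[abs_def] up0 diagm_one)
  have "isCont G 0" using G' has_vector_derivative_continuous by blast
  then have "(G \<longlongrightarrow> mat 1) (nhds 0)"
    using tendsto_at_iff_tendsto_nhds[of G 0] G0 by (simp add: isCont_def)
  then have "\<forall>\<^sub>F s in nhds 0. G s \<in> big_cell"
    by (rule topological_tendstoD[OF _ open_big_cell big1])
  moreover have "\<forall>\<^sub>F s in nhds 0. \<forall>i. 1 + of_real s * z $ i $ i \<noteq> 0"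
  proof (intro eventually_all_finite)
    fix i
    have "((\<lambda>s. 1 + complex_of_real s * z $ i $ i) \<longlongrightarrow> 1 + complex_of_real 0 * z $ i $ i) (nhds 0)"
      by (intro tendsto_intros) (simp add: filterlim_ident)
    then show "\<forall>\<^sub>F s in nhds 0. 1 + of_real s * z $ i $ i \<noteq> 0"
      by (rule tendsto_imp_eventually_ne) simp
  qed
  ultimately have "\<forall>\<^sub>F s in nhds 0. G s \<in> big_cell \<and> (\<forall>i. 1 + of_real s * z $ i $ i \<noteq> 0)"
    by (rule eventually_conj)
  then obtain \<epsilon> where \<epsilon>: "\<epsilon> > 0" "\<And>s. \<bar>s\<bar> < \<epsilon> \<Longrightarrow> G s \<in> big_cell"
    "\<And>s i. \<bar>s\<bar> < \<epsilon> \<Longrightarrow> 1 + of_real s * z $ i $ i \<noteq> 0"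
    unfolding eventually_nhds_metric by (auto simp: dist_real_def)
  have dressed: "dressed (\<gamma> s) A" if s: "\<bar>s\<bar> < \<epsilon>" for s
  proof -
    note ul = ul_lower[OF \<epsilon>(2)[OF s]]
    have ud: "u s $ i $ i = 1 + of_real s * z $ i $ i" "l s $ i $ i = 1 + of_real s * z $ i $ i" for i
      by (simp_all add: u_def l_def *(6)) (simp_all add: scaleR_conv_of_real)
    have uB: "u s \<in> B_plus"
      using tri_add[OF tri_mat tri_scaleR[OF *(2)], of 1 s] \<epsilon>(3)[OF s]
      by (simp add: B_plus_iff ud flip: u_def)
    have lB: "l s \<in> B_minus"
      using tri_diff[OF tri_mat tri_scaleR[OF *(4)], of 1 s] \<epsilon>(3)[OF s]
      by (simp add: B_minus_iff ud flip: l_def)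
    have eB: "diagm (e s) \<in> B_plus" "diagm (e s) \<in> B_minus" by (auto intro!: diagm_B simp: e_def)
    define u2 where "u2 = ul_upper (G s) ** diagm (e s)"
    define l2 where "l2 = ul_lower (G s) ** diagm (e s)"
    have "u s ** \<gamma> s = A ** (matrix_inv A ** (u s ** l s) ** A) ** ul_lower (G s) ** diagm (e s)"
      unfolding \<gamma>_def by (simp add: matrix_mul_assoc inverse_matrix[OF A])
    also have "\<dots> = A ** u2" unfolding u2_def ul_upper_def G_def by (simp only: matrix_mul_assoc)
    finally have "\<gamma> s = matrix_inv (u s) ** (A ** u2)" by (rule matrix_solve(1)[OF B_invertible(1)[OF uB]])
    moreover have "\<gamma> s = l s ** A ** l2" by (simp add: \<gamma>_def l2_def matrix_mul_assoc)
    moreover have "matrix_inv (u s) $ i $ i * l s $ i $ i = 1" for i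
      using \<epsilon>(3)[OF s] by (simp add: B_plus_inverse_diag[OF uB] ud)
    moreover have "u2 $ i $ i * l2 $ i $ i = 1" for i
    proof -
      have "e s i * e s i = exp (- Ln (ul_upper (G s) $ i $ i))"
        by (simp add: e_def flip: exp_add)
      then show ?thesis using ul(2,8) by (simp add: u2_def l2_def exp_minus mult.assoc)
    qed
    moreover have "matrix_inv (u s) \<in> B_plus" "u2 \<in> B_plus" "l2 \<in> B_minus"
      unfolding u2_def l2_def using uB eB ul by (auto intro!: B_plus_inverse B_plus_mult B_minus_mult)
    ultimately show ?thesis using lB unfolding dressed_def by (metis matrix_mul_assoc)
  qed
  have Gbig: "G 0 \<in> big_cell" using big1 G0 by simp
  obtain M' where M': "((\<lambda>s. ul_lower (G s)) has_vector_derivative M') (at 0)"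
    by (rule mdiff_curve[OF G' mdiff_ul_lower[OF mdiff_ident Gbig]])
  define B' where "B' = G' + M'"
  have B': "((\<lambda>s. ul_upper (G s)) has_vector_derivative B') (at 0)"
    unfolding ul_upper_def[abs_def] B'_def
    using has_vector_derivative_matrix_mult[OF G' M'] by (simp add: G0 low1 add.commute)
  have M'_tri: "lower M'" "M' $ i $ i = 0" for i
    using tri_derivative[OF M' \<epsilon>(1)] diag_derivative[OF M' \<epsilon>(1), of i 1] ul_lower(1,2)[OF \<epsilon>(2)] by auto
  have B'_tri: "upper B'"
    using tri_derivative[OF B' \<epsilon>(1)] ul_lower(5)[OF \<epsilon>(2)] by auto
  define e' where "e' i = - B' $ i $ i / 2" for i
  have e': "((\<lambda>s. diagm (e s)) has_vector_derivative diagm e') (at 0)"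
  proof -
    have ei: "((\<lambda>s. e s i) has_vector_derivative e' i) (at 0)" for i
    proof -
      have "((\<lambda>w. exp (- Ln w / 2)) has_field_derivative - (1/2)) (at (1::complex))"
        by (auto intro!: derivative_eq_intros)
      then have "((\<lambda>w. exp (- Ln w / 2)) has_derivative (*) (- (1/2))) (at (ul_upper (G 0) $ i $ i))"
        by (simp only: up0 one_diag has_field_derivative_def)
      from has_vector_derivative_chain[OF has_vector_derivative_entry[OF B'] this]
      show ?thesis by (simp add: e_def e'_def)
    qed
    have "((\<lambda>s. diagm (e s)) has_derivative (\<lambda>h. h *\<^sub>R diagm e')) (at 0)"
      unfolding has_derivative_matrix_iff
    proof (intro allI)
      fix i j
      show "((\<lambda>y. diagm (e y) $ i $ j) has_derivative (\<lambda>y. (y *\<^sub>R diagm e') $ i $ j)) (at 0)"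
        using ei[of i] by (cases "i = j") (auto simp: has_vector_derivative_def)
    qed
    then show ?thesis by (simp add: has_vector_derivative_def)
  qed
  have "(\<gamma> has_vector_derivative l 0 ** (A ** (M' + diagm e')) + - z' ** A) (at 0)"
  proof -
    have 1: "((\<lambda>s. ul_lower (G s) ** diagm (e s)) has_vector_derivative diagm e' + M') (at 0)"
      using has_vector_derivative_matrix_mult[OF M' e'] by (simp add: low0 e0)
    have 2: "((\<lambda>s. A ** (ul_lower (G s) ** diagm (e s))) has_vector_derivative A ** (diagm e' + M')) (at 0)"
      using has_vector_derivative_matrix_mult[OF has_vector_derivative_const 1, of A] by simp
    show ?thesis
      unfolding \<gamma>_def[abs_def]
      using has_vector_derivative_matrix_mult[OF l' 2] by (simp add: low0 e0 add.commute)
  qed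
  moreover have "M' + diagm e' = x'"
  proof -
    have "A ** (x - x') = (z - z') ** A"
      using *(7,8) by (simp add: matrix_diff_ldistrib matrix_diff_rdistrib algebra_simps)
    then have "x - x' = matrix_inv A ** ((z - z') ** A)" by (rule matrix_solve(1)[OF A])
    then have xG: "x - x' = B' - M'" by (simp add: B'_def G'_def matrix_mul_assoc)
    \<comment> \<open>Both splittings of \<open>x - x'\<close> into an upper and a lower part have opposite diagonals; they agree.\<close>
    define Y where "Y = x - (B' + diagm e')"
    have Y': "Y = x' - (M' + diagm e')" using xG by (simp add: Y_def algebra_simps)
    have "upper Y" unfolding Y_def by (intro tri_diff tri_add * B'_tri) simp
    moreover have "lower Y" unfolding Y' by (intro tri_diff tri_add * M'_tri) simp
    ultimately have Yd: "Y = diagm (\<lambda>i. Y $ i $ i)" using upper_lower_eq by blast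
    have "Y $ i $ i = x $ i $ i - B' $ i $ i / 2" for i by (simp add: Y_def e'_def field_simps)
    moreover have "Y $ i $ i = - x $ i $ i + B' $ i $ i / 2" for i
      by (simp add: Y' e'_def *(5) M'_tri)
    ultimately have "2 * Y $ i $ i = 0" for i unfolding mult_2 by (metis (no_types) add.commute add.right_inverse minus_diff_eq diff_conv_add_uminus)
    then have "Y $ i $ i = 0" for i by simp
    then have "Y = 0" using Yd by (simp add: vec_eq_iff)
    then show ?thesis using Y' by simp
  qed
  ultimately have "(\<gamma> has_vector_derivative \<xi>) (at 0)"
    using *(8) by (simp add: ul0 matrix_uminus_mult)
  moreover have "\<gamma> 0 = A" by (simp add: \<gamma>_def ul0 low0 e0)
  ultimately show ?thesis using that[of \<epsilon> \<gamma>] \<epsilon>(1) dressed by blast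
qed


section \<open>Holomorphic charts of the level sets\<close>

lemma complex_subspace_imp_subspace: "cmat.subspace S \<Longrightarrow> subspace S"
  unfolding subspace_def cmat.subspace_def scaleR_cscale by blast

context cell_pair
begin

text \<open>
  The entries at which neither triangular shape of \<open>nu A\<close> and \<open>gam A\<close> requires a zero are
  coordinates on the cell; those of \<open>nu A\<close> lie above the diagonal, the other ones on or below it.
\<close>
definition "slots X \<longleftrightarrow> (\<forall>i j. (i < j \<and> inv p i < inv p j \<longrightarrow> X $ i $ j = (0::complex)) \<and>
  (j < i \<and> inv r j < inv r i \<longrightarrow> X $ i $ j = 0))"

definition "coords A = ((\<chi> i j. if i < j then nu A $ i $ j else gam A $ i $ j) :: 'n cmat)"

definition "nu_of X = ((\<chi> i j. if i < j then X $ i $ j else if i = j then 1 else 0) :: 'n cmat)"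
definition "gam_of X = ((\<chi> i j. if j \<le> i then X $ i $ j else 0) :: 'n cmat)"

text \<open>
  The element of the cell with given \<open>\<nu>\<close> and \<open>\<gamma>\<close> is \<open>\<gamma> R m = \<nu>\<^sup>-\<^sup>1 P b\<close>, where \<open>m\<close> and \<open>b\<close> are found by
  factorizing \<open>P\<^sup>-\<^sup>1 \<nu> \<gamma> R = b m\<^sup>-\<^sup>1\<close>.
\<close>
definition "point_dom = {X. (\<forall>i. X $ i $ i \<noteq> 0) \<and> PGR (nu_of X ** gam_of X) \<in> big_cell}"
definition "point X = gam_of X ** R ** ul_lower (PGR (nu_of X ** gam_of X))"

lemma P_PGR: "P ** PGR G = G ** R"
  using perm_inverse(1)[OF p] by (simp add: PGR_def matrix_mul_assoc)

lemma point_cell: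
  assumes X: "X \<in> point_dom" "slots X"
  shows "point X \<in> cell" "coords (point X) = X"
proof -
  define G where "G = PGR (nu_of X ** gam_of X)"
  have G: "G \<in> big_cell" and nz: "\<And>i. X $ i $ i \<noteq> 0" using X by (auto simp: point_dom_def G_def)
  note ul = ul_lower[OF G]
  have tn: "upper (nu_of X)" "tri (\<lambda>i j. inv p j \<le> inv p i) (nu_of X)" "nu_of X $ i $ i = 1" for i
    using X(2) by (auto simp: tri_def nu_of_def slots_def split: if_splits) (meson not_le)
  have tc: "lower (gam_of X)" "tri (\<lambda>i j. inv r i \<le> inv r j) (gam_of X)" "gam_of X $ i $ i \<noteq> 0" for i
    using X(2) nz
    by (auto simp: tri_def gam_of_def slots_def split: if_splits) (metis not_le order_le_less)
  have nA: "nu_of X ** point X = P ** ul_upper G"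
    unfolding ul_upper_def matrix_mul_assoc G_def P_PGR
    by (simp only: point_def matrix_mul_assoc)
  have Am: "point X ** matrix_inv (ul_lower G) = gam_of X ** R"
    unfolding point_def G_def[symmetric] by (rule matrix_cancel(3)[OF ul(4)])
  have m: "lower (matrix_inv (ul_lower G))" "matrix_inv (ul_lower G) $ i $ i = 1" for i
    using B_minus_inverse[OF ul(3)] B_minus_inverse_diag[OF ul(3)] ul(2) by (auto simp: B_minus_iff)
  note u = cell_coords_unique[OF tn ul(6) nA tc m Am]
  show "point X \<in> cell" by (rule u(1))
  show "coords (point X) = X"
    unfolding coords_def u by (auto simp: vec_eq_iff nu_of_def gam_of_def)
qed

lemma coords_diag [simp]: "coords A $ i $ i = gam A $ i $ i"
  by (simp add: coords_def)

lemma coords_cell: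
  assumes A: "A \<in> cell"
  shows "slots (coords A)" "coords A \<in> point_dom" "point (coords A) = A"
proof -
  note f = cell_factors[OF A]
  have up: "upper (nu A)" and lo: "lower (gam A)" using A by (auto simp: cell_iff)
  have n: "nu_of (coords A) = nu A"
    using upperD[OF up] dom_coords_plus(3)[OF f(1)]
    by (auto simp: vec_eq_iff nu_of_def coords_def)
  have c: "gam_of (coords A) = gam A"
    using lowerD[OF lo] by (auto simp: vec_eq_iff gam_of_def coords_def)
  show "slots (coords A)"
    using triD[OF dom_coords_plus(4)[OF f(1)]] triD[OF dom_coords_minus(5)[OF f(1)]]
    by (auto simp: slots_def coords_def)
  show "coords A \<in> point_dom"
    using PGR_cell(1)[OF A] dom_coords_minus(6)[OF f(1)] by (simp add: point_dom_def n c)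
  show "point (coords A) = A"
    using f(7) by (simp add: point_def n c PGR_cell(2)[OF A])
qed

lemma mdiff_coords:
  assumes "A \<in> dom_coords"
  shows "mdiff coords A"
  using dom_coords_diff[OF assms] unfolding mdiff_iff coords_def by (auto intro!: cdiff_if)

lemma mdiff_PGR: "mdiff (\<lambda>X. PGR (nu_of X ** gam_of X)) X"
proof -
  have "mdiff nu_of X" "mdiff gam_of X"
    unfolding mdiff_iff nu_of_def gam_of_def by (auto intro!: cdiff_if)
  then show ?thesis unfolding PGR_def by (intro mdiff_mult mdiff_const)
qed

lemma mdiff_point:
  assumes "X \<in> point_dom"
  shows "mdiff point X"
proof -
  have "mdiff gam_of X" unfolding mdiff_iff gam_of_def by (auto intro!: cdiff_if)
  then show ?thesis
    using assms unfolding point_def[abs_def]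
    by (intro mdiff_mult mdiff_const mdiff_ul_lower mdiff_PGR) (auto simp: point_dom_def)
qed

lemma open_all_preimage:
  assumes "open S" "\<And>x i. x \<in> S \<Longrightarrow> isCont (f i) x" "\<And>i. open (T i)"
  shows "open {x \<in> S. \<forall>i::'n. f i x \<in> T i}"
proof -
  have "open (\<Inter>i\<in>UNIV. {x \<in> S. f i x \<in> T i})"
    using assms by (intro open_INT) (auto intro: open_continuous_preimage)
  moreover have "(\<Inter>i\<in>UNIV. {x \<in> S. f i x \<in> T i}) = {x \<in> S. \<forall>i. f i x \<in> T i}" by auto
  ultimately show ?thesis by simp
qed

lemma open_point_dom: "open point_dom"
proof -
  have "open {X \<in> UNIV :: 'n cmat set. \<forall>i. X $ i $ i \<in> - {0}}"
    by (rule open_all_preimage) (auto intro: cdiff_isCont)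
  moreover have "open {X \<in> UNIV. PGR (nu_of X ** gam_of X) \<in> big_cell}"
    by (rule open_continuous_preimage) (auto intro: mdiff_isCont mdiff_PGR open_big_cell)
  moreover have "point_dom = {X \<in> UNIV. \<forall>i. X $ i $ i \<in> - {0}} \<inter>
      {X \<in> UNIV. PGR (nu_of X ** gam_of X) \<in> big_cell}"
    by (auto simp: point_dom_def)
  ultimately show ?thesis by (simp only:) (rule open_Int)
qed

lemma cdiff_KK: "A \<in> dom_coords \<Longrightarrow> cdiff (\<lambda>A. KK A i) A"
  unfolding KK_def kappa_def using dom_coords_diff[of A]
  by (intro cdiff_prod cdiff_mult mdiff_entry)

end

locale cell_point = cell_pair p r N
  for p r :: "'n::{finite,linorder} \<Rightarrow> 'n" and N +
  fixes q :: "'n cmat"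
  assumes q: "q \<in> cell"
begin

text \<open>
  A chart of the level set of \<open>q\<close>. Diagonal matrices \<open>diagm a\<close> with \<open>a \<circ> tau = a\<close> multiply \<open>KK A i\<close> by
  \<open>a i ^ (2 * N)\<close>, so that \<open>retract\<close> maps a neighbourhood of \<open>q\<close> in the cell to the level set. The
  average \<open>avg\<close> of the relative diagonal of \<open>gam A\<close> is multiplied by \<open>a i\<close>. Therefore the points of the
  cell with average 1 form a slice that is transversal to the action of these matrices, and \<open>rescale\<close>
  inverts \<open>retract\<close> on it. In coordinates the slice is the translate of the linear space \<open>model\<close> by
  \<open>coords q\<close>.
\<close>
definition "scale_to A i = exp (Ln (KK q i / KK A i) / of_nat (2 * N))"
definition "retract A = diagm (scale_to A) ** A"
definition "avg A i = (\<Sum>k<N. gam A $ (tau ^^ k) i $ (tau ^^ k) i / gam q $ (tau ^^ k) i $ (tau ^^ k) i) / of_nat N"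
definition "rescale A = diagm (\<lambda>i. 1 / avg A i) ** A"
definition "chart X = retract (point (coords q + X))"
definition "unchart A = coords (rescale A) - coords q"

definition "model = {X. slots X \<and>
  (\<forall>i. (\<Sum>k<N. X $ (tau ^^ k) i $ (tau ^^ k) i / gam q $ (tau ^^ k) i $ (tau ^^ k) i) = 0)}"

definition "retract_dom = {A \<in> dom_coords. \<forall>i. KK q i / KK A i \<in> - \<real>\<^sub>\<le>\<^sub>0}"
definition "chart_dom = {X. coords q + X \<in> point_dom \<and> point (coords q + X) \<in> retract_dom}"
definition "avg_dom = {A \<in> dom_coords. \<forall>i. avg A i \<in> - {0}}"
definition "unchart_dom = {A \<in> avg_dom. rescale A \<in> dom_coords}"

lemma q_dom: "q \<in> dom_coords" and gam_q: "gam q $ i $ i \<noteq> 0"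
  using cell_factors(1)[OF q] dom_coords_minus(6) by auto

lemma model_subspace: "cmat.subspace model" "subspace model"
proof -
  have s: "slots 0" "slots X \<Longrightarrow> slots Y \<Longrightarrow> slots (X + Y)" "slots X \<Longrightarrow> slots (cscale c X)"
    "slots X \<Longrightarrow> slots (a *\<^sub>R X)" for X Y c a
    by (auto simp: slots_def)
  show c: "cmat.subspace model"
    unfolding cmat.subspace_def model_def using s
    by (auto simp: add_divide_distrib sum.distrib simp flip: sum_distrib_left times_divide_eq_right)
  show "subspace model" by (rule complex_subspace_imp_subspace[OF c])
qed

lemma mdiff_retract:
  assumes "A \<in> retract_dom"
  shows "mdiff retract A"
  unfolding retract_def[abs_def] scale_to_def
  using assms KK_nonzero
  by (intro mdiff_mult mdiff_diagm cdiff_exp cdiff_divide cdiff_Ln cdiff_const cdiff_KK mdiff_ident)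
    (auto simp: retract_dom_def N)

lemma open_retract_dom: "open retract_dom"
  unfolding retract_dom_def
proof (rule open_all_preimage[OF open_dom_coords])
  show "isCont (\<lambda>A. KK q i / KK A i) A" if "A \<in> dom_coords" for A i
    using that KK_nonzero by (intro cdiff_isCont cdiff_divide cdiff_const cdiff_KK) auto
  show "open (- \<real>\<^sub>\<le>\<^sub>0 :: complex set)" by (simp add: open_Compl)
qed

lemma cdiff_avg: "A \<in> dom_coords \<Longrightarrow> cdiff (\<lambda>A. avg A i) A"
  unfolding avg_def using dom_coords_diff(3)[of A] gam_q N(1)
  by (intro cdiff_divide cdiff_sum mdiff_entry cdiff_const) auto

lemma open_avg_dom: "open avg_dom"
  unfolding avg_dom_def
  by (rule open_all_preimage[OF open_dom_coords]) (auto intro: cdiff_isCont cdiff_avg)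

lemma mdiff_rescale:
  assumes "A \<in> avg_dom"
  shows "mdiff rescale A"
  unfolding rescale_def[abs_def] using assms
  by (intro mdiff_mult mdiff_diagm cdiff_divide cdiff_const cdiff_avg mdiff_ident)
    (auto simp: avg_dom_def)

lemma open_unchart_dom: "open unchart_dom"
  unfolding unchart_dom_def
  by (rule open_continuous_preimage[OF open_avg_dom _ open_dom_coords])
    (auto intro: mdiff_isCont mdiff_rescale)

lemma mdiff_unchart:
  assumes "A \<in> unchart_dom"
  shows "mdiff unchart A"
proof -
  have "mdiff (\<lambda>A. coords (rescale A)) A"
    using assms by (intro mdiff_compose[OF mdiff_rescale mdiff_coords]) (auto simp: unchart_dom_def)
  then show ?thesis unfolding unchart_def[abs_def] by (intro mdiff_diff mdiff_const)
qed

lemma open_chart_dom: "open chart_dom"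
proof -
  have 1: "open {X \<in> UNIV. coords q + X \<in> point_dom}"
    by (rule open_continuous_preimage) (auto intro: mdiff_isCont open_point_dom)
  have "open {X \<in> {X \<in> UNIV. coords q + X \<in> point_dom}. point (coords q + X) \<in> retract_dom}"
    by (rule open_continuous_preimage[OF 1 _ open_retract_dom])
      (auto intro!: mdiff_isCont mdiff_compose[OF _ mdiff_point])
  then show ?thesis by (simp add: chart_dom_def)
qed

lemma mdiff_chart:
  assumes "X \<in> chart_dom"
  shows "mdiff chart X"
proof -
  have "mdiff (\<lambda>X. point (coords q + X)) X"
    using assms by (intro mdiff_compose[OF _ mdiff_point]) (auto simp: chart_dom_def)
  then show ?thesis
    unfolding chart_def[abs_def] using assms
    by (intro mdiff_compose[OF _ mdiff_retract]) (auto simp: chart_dom_def)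
qed

lemma avg_q [simp]: "avg q i = 1"
  using gam_q N(1) by (simp add: avg_def)

lemma avg_tau: "avg A (tau i) = avg A i"
  unfolding avg_def
  using cyclic_sum_shift[OF tauN N(1), where h = "\<lambda>i. gam A $ i $ i / gam q $ i $ i"] by simp

lemma avg_torus:
  assumes "A \<in> cell" "\<And>i. a i \<noteq> 0" "\<And>i. a (tau i) = a i"
  shows "avg (diagm a ** A) i = a i * avg A i"
proof -
  have "a ((tau ^^ k) i) = a i" for k i
    by (rule invariant_funpow[where h = a and \<tau> = tau, OF assms(3)])
  then show ?thesis
    by (simp add: avg_def torus_cell(2)[where a = a, OF assms(1,2)] sum_distrib_left)
qed

lemma retract_level:
  assumes B: "B \<in> cell"
  shows "retract B \<in> level q" "scale_to B i \<noteq> 0" "scale_to B (tau i) = scale_to B i"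
proof -
  define a where "a = scale_to B"
  have a: "a i \<noteq> 0" "a (tau i) = a i" for i by (simp_all add: a_def scale_to_def KK_tau)
  then show "scale_to B i \<noteq> 0" "scale_to B (tau i) = scale_to B i" by (simp_all add: a_def)
  have "a i ^ (2 * N) = KK q i / KK B i" for i
  proof -
    have "a i ^ (2 * N) = exp (of_nat (2 * N) * (Ln (KK q i / KK B i) / of_nat (2 * N)))"
      unfolding a_def scale_to_def by (rule exp_of_nat_mult[symmetric])
    also have "\<dots> = exp (Ln (KK q i / KK B i))" using N(1) by simp
    also have "\<dots> = KK q i / KK B i"
      using KK_nonzero[OF q_dom] KK_nonzero[OF cell_factors(1)[OF B]] by simp
    finally show ?thesis .
  qed
  then have "KK (diagm a ** B) i = KK q i" for i
    unfolding KK_torus_invariant[where a = a, OF B a] using KK_nonzero[OF cell_factors(1)[OF B]] by simp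
  then show "retract B \<in> level q"
    using torus_cell(1)[where a = a, OF B a(1)] by (auto simp: level_def retract_def a_def)
qed

lemma chart_level:
  assumes X: "X \<in> chart_dom" "X \<in> model"
  shows "chart X \<in> level q" "avg (chart X) i \<noteq> 0" "rescale (chart X) = point (coords q + X)"
    "unchart (chart X) = X"
proof -
  define B where "B = point (coords q + X)"
  define a where "a = scale_to B"
  have sl: "slots (coords q + X)" using coords_cell(1)[OF q] X(2) by (auto simp: model_def slots_def)
  have pd: "coords q + X \<in> point_dom" and rd: "B \<in> retract_dom" using X(1) by (auto simp: chart_dom_def B_def)
  have B: "B \<in> cell" and cB: "coords B = coords q + X" using point_cell[OF pd sl] by (auto simp: B_def)
  have a: "a i \<noteq> 0" "a (tau i) = a i" for i using retract_level(2,3)[OF B] by (simp_all add: a_def)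
  have ch: "chart X = diagm a ** B" by (simp add: chart_def retract_def a_def B_def)
  show "chart X \<in> level q" using retract_level(1)[OF B] by (simp add: chart_def B_def)
  have "gam B $ i $ i = gam q $ i $ i + X $ i $ i" for i
    using arg_cong[OF cB, of "\<lambda>Z. Z $ i $ i"] by simp
  then have "avg B i = avg q i + (\<Sum>k<N. X $ (tau ^^ k) i $ (tau ^^ k) i / gam q $ (tau ^^ k) i $ (tau ^^ k) i) / of_nat N" for i
    by (simp add: avg_def add_divide_distrib sum.distrib)
  then have "avg B i = 1" for i using X(2) by (simp add: model_def)
  then have av: "avg (chart X) i = a i" for i unfolding ch by (simp add: avg_torus[where a = a, OF B a])
  then show "avg (chart X) i \<noteq> 0" by (simp add: a)
  show nc: "rescale (chart X) = point (coords q + X)"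
    unfolding rescale_def av unfolding ch matrix_mul_assoc
    using diagm_inverse'[of a] a by (simp add: B_def)
  show "unchart (chart X) = X" unfolding unchart_def nc B_def[symmetric] cB by simp
qed

lemma unchart_level:
  assumes A: "A \<in> level q" "A \<in> avg_dom"
  shows "rescale A \<in> cell" "unchart A \<in> model" "point (coords q + unchart A) = rescale A"
    "coords q + unchart A \<in> point_dom"
proof -
  have Ac: "A \<in> cell" and K: "KK A = KK q" using A(1) by (auto simp: level_def)
  define a where "a i = 1 / avg A i" for i
  have a: "a i \<noteq> 0" "a (tau i) = a i" for i using A(2) by (auto simp: a_def avg_tau avg_dom_def)
  have no: "rescale A = diagm a ** A" by (simp add: rescale_def a_def[abs_def])
  show nA: "rescale A \<in> cell" unfolding no by (rule torus_cell(1)[where a = a, OF Ac a(1)])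
  have "avg (rescale A) i = 1" for i
    unfolding no avg_torus[where a = a, OF Ac a] using A(2) by (simp add: a_def avg_dom_def)
  then have "(\<Sum>k<N. gam (rescale A) $ (tau ^^ k) i $ (tau ^^ k) i / gam q $ (tau ^^ k) i $ (tau ^^ k) i) = of_nat N" for i
    using N(1) by (simp add: avg_def)
  then have "(\<Sum>k<N. unchart A $ (tau ^^ k) i $ (tau ^^ k) i / gam q $ (tau ^^ k) i $ (tau ^^ k) i) = 0" for i
    using gam_q by (simp add: unchart_def diff_divide_distrib sum_subtractf)
  moreover have "slots (unchart A)"
    using coords_cell(1)[OF nA] coords_cell(1)[OF q] by (auto simp: unchart_def slots_def)
  ultimately show "unchart A \<in> model" by (simp add: model_def)
  show "point (coords q + unchart A) = rescale A" "coords q + unchart A \<in> point_dom"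
    using coords_cell[OF nA] by (simp_all add: unchart_def)
qed

lemma chart_unchart:
  assumes A: "A \<in> level q" "A \<in> avg_dom"
    and root: "\<And>i. exp (Ln (avg A i ^ (2 * N)) / of_nat (2 * N)) = avg A i"
  shows "chart (unchart A) = A"
proof -
  have Ac: "A \<in> cell" and K: "KK A = KK q" using A(1) by (auto simp: level_def)
  define a where "a i = 1 / avg A i" for i
  have nz: "avg A i \<noteq> 0" for i using A(2) by (auto simp: avg_dom_def)
  have a: "a i \<noteq> 0" "a (tau i) = a i" for i using nz by (auto simp: a_def avg_tau)
  have no: "rescale A = diagm a ** A" by (simp add: rescale_def a_def[abs_def])
  have "KK q i / KK (rescale A) i = avg A i ^ (2 * N)" for i
    unfolding no KK_torus_invariant[where a = a, OF Ac a] K using KK_nonzero[OF q_dom, of i] nz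
    by (simp add: a_def power_divide)
  then have "scale_to (rescale A) = avg A" by (intro ext) (simp add: scale_to_def root del: of_nat_mult of_nat_numeral)
  then have "chart (unchart A) = diagm (avg A) ** (diagm a ** A)"
    unfolding chart_def unchart_level(3)[OF A] retract_def by (simp add: no)
  also have "\<dots> = A"
    unfolding matrix_mul_assoc a_def using diagm_inverse[of "avg A"] nz by simp
  finally show ?thesis .
qed

lemma zero_chart_dom: "0 \<in> chart_dom" "chart 0 = q"
proof -
  have r: "KK q i / KK q i = 1" for i using KK_nonzero[OF q_dom] by simp
  show "0 \<in> chart_dom"
    using coords_cell[OF q] q_dom r by (simp add: chart_dom_def retract_dom_def)
  have "scale_to q = (\<lambda>i. 1)" using r by (simp add: scale_to_def[abs_def])
  then show "chart 0 = q"
    using coords_cell(3)[OF q] by (simp add: chart_def retract_def diagm_one)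
qed

lemma derivative_in_subspace:
  fixes y :: "real \<Rightarrow> 'b::euclidean_space"
  assumes V: "subspace V" and y: "(y has_vector_derivative w) (at t)" and e: "e > 0"
    and yV: "\<And>s. \<bar>s - t\<bar> < e \<Longrightarrow> y s \<in> V"
  shows "w \<in> V"
proof -
  have "w \<bullet> v = 0" if v: "v \<in> V\<^sup>\<bottom>" for v
  proof -
    have "((\<lambda>s. y s \<bullet> v) has_vector_derivative w \<bullet> v) (at t)"
      by (rule bounded_linear.has_vector_derivative[OF bounded_linear_inner_left y])
    then show ?thesis
      by (rule has_vector_derivative_unique_near[OF _ has_vector_derivative_const[of 0] e])
        (use v yV in \<open>auto simp: orthogonal_comp_def orthogonal_def inner_commute\<close>)
  qed
  then have "w \<in> V\<^sup>\<bottom>\<^sup>\<bottom>" by (auto simp: orthogonal_comp_def orthogonal_def inner_commute)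
  then show ?thesis using orthogonal_comp_self[OF V] by simp
qed

text \<open>
  The ball is chosen such that \<open>unchart\<close> is a left inverse of \<open>chart\<close> that is holomorphic near its image and
  the root in \<open>retract\<close> inverts the power. The derivative \<open>D\<close> is injective
  because \<open>unchart\<close> is differentiable. Its image is contained in the distribution by
  \<open>tangent_in_distribution\<close>. Conversely the dressing curve of a vector \<open>\<xi>\<close> stays in the level set, so
  that it is the image of a curve in the model space, whose velocity \<open>D\<close> maps to \<open>\<xi>\<close>.
\<close>

lemma chart_exists:
  obtains E V \<phi> where "integral_chart E V \<phi>" "connected V" "q \<in> \<phi> ` V"
    "openin (top_of_set (level q)) (\<phi> ` V)"
    "homeomorphic_map (top_of_set V) (top_of_set (\<phi> ` V)) \<phi>"
proof -
  have "2 * N > 0" using N(1) by simp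
  from exp_Ln_power_root[OF this] obtain \<epsilon> where \<epsilon>: "\<epsilon> > 0"
    "\<And>z. cmod (z - 1) < \<epsilon> \<Longrightarrow> z \<noteq> 0 \<and> exp (Ln (z ^ (2 * N)) / of_nat (2 * N)) = z"
    by blast
  have root: "z \<noteq> 0 \<and> exp (Ln (z ^ (2 * N)) / of_nat (2 * N)) = z" if "z \<in> ball 1 \<epsilon>" for z
    using \<epsilon>(2)[of z] that by (simp add: dist_norm norm_minus_commute)
  define O1 where "O1 = {A \<in> unchart_dom. \<forall>i. avg A i \<in> ball 1 \<epsilon>}"
  have avg_cont: "isCont (\<lambda>A. avg A i) A" if "A \<in> unchart_dom" for A i
    using that by (intro cdiff_isCont cdiff_avg) (auto simp: unchart_dom_def avg_dom_def)
  have O1: "open O1"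
    unfolding O1_def by (rule open_all_preimage[OF open_unchart_dom avg_cont]) auto
  have qO1: "q \<in> O1"
  proof -
    have "rescale q = q" by (simp add: rescale_def diagm_one)
    then show ?thesis using \<epsilon>(1) q_dom by (simp add: O1_def unchart_dom_def avg_dom_def)
  qed
  have "open {X \<in> chart_dom. chart X \<in> O1}"
    by (rule open_continuous_preimage[OF open_chart_dom _ O1]) (rule mdiff_isCont[OF mdiff_chart])
  then obtain \<delta> where \<delta>: "\<delta> > 0" "ball 0 \<delta> \<subseteq> {X \<in> chart_dom. chart X \<in> O1}"
    using zero_chart_dom qO1 unfolding open_contains_ball by (metis (no_types, lifting) mem_Collect_eq)
  define V where "V = model \<inter> ball 0 \<delta>"
  have V: "X \<in> chart_dom" "chart X \<in> O1" "X \<in> model" if "X \<in> V" for X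
    using that \<delta> by (auto simp: V_def)
  define O2 where "O2 = {A \<in> O1. unchart A \<in> ball 0 \<delta>}"
  have O2: "open O2"
    unfolding O2_def
    by (rule open_continuous_preimage[OF O1]) (auto simp: O1_def intro!: mdiff_isCont[OF mdiff_unchart])
  have image: "chart ` V = level q \<inter> O2"
  proof
    show "chart ` V \<subseteq> level q \<inter> O2"
      using chart_level[OF V(1,3)] V by (auto simp: O2_def V_def)
    show "level q \<inter> O2 \<subseteq> chart ` V"
    proof
      fix A assume A: "A \<in> level q \<inter> O2"
      then have Ad: "A \<in> level q" "A \<in> avg_dom" by (auto simp: O2_def O1_def unchart_dom_def)
      have "chart (unchart A) = A"
        by (rule chart_unchart[OF Ad]) (use A root in \<open>auto simp: O2_def O1_def\<close>)
      moreover have "unchart A \<in> V"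
        using unchart_level(2)[OF Ad] A by (auto simp: V_def O2_def)
      ultimately show "A \<in> chart ` V" by (metis imageI)
    qed
  qed
  have unch: "unchart (chart X) = X" if "X \<in> V" for X using chart_level(4)[OF V(1,3)] that by blast
  show ?thesis
  proof (rule that[of model V chart])
    show "connected V"
      unfolding V_def
      by (intro convex_connected convex_Int subspace_imp_convex model_subspace convex_ball)
    show "q \<in> chart ` V"
      using zero_chart_dom(2) \<delta>(1) subspace_0[OF model_subspace(2)]
      by (intro image_eqI[of _ _ 0]) (auto simp: V_def)
    show "openin (top_of_set (level q)) (chart ` V)"
      unfolding image using O2 by (rule openin_open_Int)
    show "homeomorphic_map (top_of_set V) (top_of_set (chart ` V)) chart"
      unfolding homeomorphic_map_maps homeomorphic_maps_def
    proof (intro exI[of _ unchart] conjI ballI)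
      have "continuous_on V chart"
        using mdiff_isCont[OF mdiff_chart[OF V(1)]] continuous_at_imp_continuous_on by blast
      then show "continuous_map (top_of_set V) (top_of_set (chart ` V)) chart"
        by (auto simp: continuous_map_in_subtopology)
      have "continuous_on (chart ` V) unchart"
        using mdiff_isCont[OF mdiff_unchart] V(2)
        by (intro continuous_at_imp_continuous_on) (auto simp: O1_def)
      then show "continuous_map (top_of_set (chart ` V)) (top_of_set V) unchart"
        using unch by (auto simp: continuous_map_in_subtopology)
    qed (use unch in auto)
    show "integral_chart model V chart"
      unfolding integral_chart_def
    proof (intro conjI ballI model_subspace)
      show "openin (top_of_set model) V" unfolding V_def by (intro openin_open_Int open_ball)
      fix X assume X: "X \<in> V"
      obtain D where D: "(chart has_derivative D) (at X)" "\<And>c y. D (cscale c y) = cscale c (D y)"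
        using mdiff_chart[OF V(1)[OF X]] unfolding mdiff_def by blast
      have linD: "linear D" using D(1) has_derivative_linear by blast
      have curve: "\<exists>e>0. \<forall>s. \<bar>s - 0\<bar> < e \<longrightarrow> X + s *\<^sub>R w \<in> V" if w: "w \<in> model" for w
      proof -
        have "((\<lambda>s. X + s *\<^sub>R w) \<longlongrightarrow> X + 0 *\<^sub>R w) (nhds (0::real))"
          by (intro tendsto_intros) (simp add: filterlim_ident)
        moreover have "X + 0 *\<^sub>R w \<in> ball 0 \<delta>" using X by (simp add: V_def)
        ultimately have "\<forall>\<^sub>F s in nhds (0::real). X + s *\<^sub>R w \<in> ball 0 \<delta>"
          by (metis open_ball topological_tendstoD)
        then obtain e where "e > 0" "\<And>s. \<bar>s\<bar> < e \<Longrightarrow> X + s *\<^sub>R w \<in> ball 0 \<delta>"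
          unfolding eventually_nhds_metric by (auto simp: dist_real_def)
        moreover have "X + s *\<^sub>R w \<in> model" for s
          using X w by (auto simp: V_def intro: subspace_add subspace_scale model_subspace)
        ultimately show ?thesis by (auto simp: V_def)
      qed
      have line: "((\<lambda>s. X + s *\<^sub>R w) has_vector_derivative w) (at 0)" for w
        by (auto intro!: derivative_eq_intros)
      have chain: "((\<lambda>s. chart (X + s *\<^sub>R w)) has_vector_derivative D w) (at 0)" for w
        by (rule has_vector_derivative_chain[OF line]) (simp add: D(1))
      obtain D' where D': "(unchart has_derivative D') (at (chart X))"
        using mdiff_unchart[of "chart X"] V(2)[OF X] unfolding mdiff_def by (auto simp: O1_def)
      have D'D: "D' (D w) = w" if w: "w \<in> model" for w
      proof -
        obtain e where e: "e > 0" "\<And>s. \<bar>s - 0\<bar> < e \<Longrightarrow> X + s *\<^sub>R w \<in> V" using curve[OF w] by blast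
        have "((\<lambda>s. unchart (chart (X + s *\<^sub>R w))) has_vector_derivative D' (D w)) (at 0)"
          by (rule has_vector_derivative_chain[OF chain]) (simp add: D')
        then show ?thesis
          by (rule has_vector_derivative_unique_near[OF _ line e(1)]) (use unch e(2) in auto)
      qed
      have image_D: "D ` model = hamiltonian_distribution (chart X)"
      proof
        show "D ` model \<subseteq> hamiltonian_distribution (chart X)"
        proof
          fix \<xi> assume "\<xi> \<in> D ` model"
          then obtain w where w: "w \<in> model" "\<xi> = D w" by blast
          obtain e where e: "e > 0" "\<And>s. \<bar>s - 0\<bar> < e \<Longrightarrow> X + s *\<^sub>R w \<in> V" using curve[OF w(1)] by blast
          have "D w \<in> hamiltonian_distribution (chart (X + 0 *\<^sub>R w))"
            by (rule tangent_in_distribution[OF chain e(1)]) (use chart_level(1)[OF V(1,3)] e(2) in auto)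
          then show "\<xi> \<in> hamiltonian_distribution (chart X)" using w by simp
        qed
        show "hamiltonian_distribution (chart X) \<subseteq> D ` model"
        proof
          fix \<xi> assume \<xi>: "\<xi> \<in> hamiltonian_distribution (chart X)"
          have lev: "chart X \<in> level q" using chart_level(1)[OF V(1,3)] X by blast
          then have cell: "chart X \<in> cell" by (simp add: level_def)
          obtain \<gamma> e where \<gamma>: "e > 0" "\<gamma> 0 = chart X" "(\<gamma> has_vector_derivative \<xi>) (at 0)"
            "\<And>s. \<bar>s\<bar> < e \<Longrightarrow> dressed (\<gamma> s) (chart X)"
            by (rule distribution_dressing_curve[OF cell_invertible[OF cell] \<xi>]) blast
          have gl: "\<gamma> s \<in> level q" if "\<bar>s\<bar> < e" for s
            using dressed_cell[OF \<gamma>(4)[OF that] cell] lev by (simp add: level_def)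
          have "chart X \<in> O2" using image X by blast
          moreover have "isCont \<gamma> 0" using \<gamma>(3) has_vector_derivative_continuous by blast
          then have "(\<gamma> \<longlongrightarrow> chart X) (nhds 0)"
            using tendsto_at_iff_tendsto_nhds[of \<gamma> 0] \<gamma>(2) by (simp add: isCont_def)
          ultimately have "\<forall>\<^sub>F s in nhds 0. \<gamma> s \<in> O2" using O2 topological_tendstoD by blast
          then obtain e2 where e2: "e2 > 0" "\<And>s. \<bar>s\<bar> < e2 \<Longrightarrow> \<gamma> s \<in> O2"
            unfolding eventually_nhds_metric by (auto simp: dist_real_def)
          define e' where "e' = min e e2"
          have e': "e' > 0" using \<gamma>(1) e2(1) by (simp add: e'_def)
          have inV: "\<exists>Y\<in>V. \<gamma> s = chart Y" if "\<bar>s - 0\<bar> < e'" for s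
          proof -
            have "\<gamma> s \<in> chart ` V" unfolding image using gl[of s] e2(2)[of s] that by (simp add: e'_def)
            then show ?thesis by blast
          qed
          define w where "w = D' \<xi>"
          have y: "((\<lambda>s. unchart (\<gamma> s)) has_vector_derivative w) (at 0)"
            unfolding w_def by (rule has_vector_derivative_chain[OF \<gamma>(3)]) (simp add: D' \<gamma>(2))
          have w: "w \<in> model"
            by (rule derivative_in_subspace[OF model_subspace(2) y e']) (use inV unch V(3) in fastforce)
          have "((\<lambda>s. chart (unchart (\<gamma> s))) has_vector_derivative D w) (at 0)"
            by (rule has_vector_derivative_chain[OF y]) (simp add: \<gamma>(2) unch[OF X] D(1))
          then have "D w = \<xi>"
            by (rule has_vector_derivative_unique_near[OF _ \<gamma>(3) e']) (use inV unch in fastforce)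
          then show "\<xi> \<in> D ` model" using w by blast
        qed
      qed
      show "\<exists>D. (chart has_derivative D) (at X within V) \<and> Vector_Spaces.linear cscale cscale D \<and>
          inj_on D model \<and> D ` model = hamiltonian_distribution (chart X)"
      proof (intro exI conjI)
        show "(chart has_derivative D) (at X within V)" using D(1) by (rule has_derivative_at_withinI)
        show "Vector_Spaces.linear cscale cscale D"
          unfolding linear_cscale_iff using D(2) linear_add[OF linD] by blast
        show "inj_on D model" using D'D by (metis inj_on_inverseI)
        show "D ` model = hamiltonian_distribution (chart X)" by (rule image_D)
      qed
    qed
  qed
qed

end


section \<open>Integral manifolds stay in the level sets\<close>

lemma matrix_ode:
  fixes g :: "real \<Rightarrow> ('n::finite) cmat"
  assumes ab: "a < b" and g: "continuous_on {a..b} g" "\<And>t. t \<in> {a..b} \<Longrightarrow> norm (g t) \<le> M"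
    and C: "0 \<le> C" "\<And>(X :: 'n cmat) (Y :: 'n cmat). norm (X ** Y) \<le> C * norm X * norm Y"
    and short: "0 \<le> M" "C * M * (b - a) < 1"
    and Q: "partial_order_rel Q" "\<And>t. t \<in> {a..b} \<Longrightarrow> tri Q (g t)"
  obtains X Y where "X a = mat 1" "Y a = mat 1" "\<And>t. t \<in> {a..b} \<Longrightarrow> tri Q (X t)"
    "\<And>t. t \<in> {a..b} \<Longrightarrow> tri Q (Y t)"
    "\<And>t. t \<in> {a..b} \<Longrightarrow> (X has_vector_derivative X t ** g t) (at t within {a..b})"
    "\<And>t. t \<in> {a..b} \<Longrightarrow> (Y has_vector_derivative g t ** Y t) (at t within {a..b})"
proof -
  have sub: "subspace {X. tri Q X}"
    by (auto simp: subspace_def intro: tri_add tri_scaleR) (simp add: tri_def)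
  have lin: "linear (\<lambda>x::'n cmat. x ** g t)" "linear (\<lambda>x::'n cmat. g t ** x)" for t
  proof -
    show "linear (\<lambda>x::'n cmat. x ** g t)"
      unfolding linear_conv_bounded_linear
      by (rule bounded_bilinear.bounded_linear_left[OF bounded_bilinear_matrix_mult])
    show "linear (\<lambda>x::'n cmat. g t ** x)"
      unfolding linear_conv_bounded_linear
      by (rule bounded_bilinear.bounded_linear_right[OF bounded_bilinear_matrix_mult])
  qed
  have gc: "continuous_on ({a..b} \<times> UNIV) (\<lambda>w::real \<times> 'n cmat. g (fst w))"
    by (rule continuous_on_compose2[OF g(1)]) (auto intro!: continuous_intros)
  have cont: "continuous_on ({a..b} \<times> UNIV) (\<lambda>(t, x::'n cmat). x ** g t)"
    "continuous_on ({a..b} \<times> UNIV) (\<lambda>(t, x::'n cmat). g t ** x)"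
  proof -
    note [continuous_intros] = bounded_bilinear.continuous_on[OF bounded_bilinear_matrix_mult] gc
    show "continuous_on ({a..b} \<times> UNIV) (\<lambda>(t, x::'n cmat). x ** g t)"
      "continuous_on ({a..b} \<times> UNIV) (\<lambda>(t, x::'n cmat). g t ** x)"
      unfolding case_prod_unfold by (auto intro!: continuous_intros)
  qed
  have bd: "norm (x ** g t) \<le> C * M * norm x" "norm (g t ** x) \<le> C * M * norm x" if "t \<in> {a..b}" for t and x :: "'n cmat"
  proof -
    have "C * (norm x * norm (g t)) \<le> C * (norm x * M)"
      using g(2)[OF that] C(1) by (intro mult_left_mono) auto
    then show "norm (x ** g t) \<le> C * M * norm x" "norm (g t ** x) \<le> C * M * norm x"
      using C(2)[of x "g t"] C(2)[of "g t" x] by (auto simp: mult_ac)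
  qed
  obtain X where X: "X a = mat 1" "\<And>t. t \<in> {a..b} \<Longrightarrow> X t \<in> {X. tri Q X}"
    "\<And>t. t \<in> {a..b} \<Longrightarrow> (X has_vector_derivative X t ** g t) (at t within {a..b})"
    using linear_ode[OF ab cont(1) lin(1) bd(1) _ _ sub, of "mat 1"] C(1) short Q tri_mult(1)[OF Q(1)]
    by auto
  obtain Y where Y: "Y a = mat 1" "\<And>t. t \<in> {a..b} \<Longrightarrow> Y t \<in> {X. tri Q X}"
    "\<And>t. t \<in> {a..b} \<Longrightarrow> (Y has_vector_derivative g t ** Y t) (at t within {a..b})"
    using linear_ode[OF ab cont(2) lin(2) bd(2) _ _ sub, of "mat 1"] C(1) short Q tri_mult(1)[OF Q(1)]
    by auto
  show ?thesis using that[of X Y] X Y by blast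
qed

text \<open>
  The solutions of \<open>w' = w z\<close> and \<open>v' = - x v\<close> make \<open>w \<gamma> v\<close> constant along a curve with
  \<open>\<gamma>' = \<gamma> x - z \<gamma>\<close>. In this way solutions of linear equations turn the velocity into finite factors.
\<close>

lemma conjugated_curve_constant:
  fixes \<gamma> w v x z :: "real \<Rightarrow> ('n::finite) cmat"
  assumes "\<And>t. t \<in> {a..b} \<Longrightarrow> (\<gamma> has_vector_derivative \<gamma> t ** x t - z t ** \<gamma> t) (at t within {a..b})"
    "\<And>t. t \<in> {a..b} \<Longrightarrow> (w has_vector_derivative w t ** z t) (at t within {a..b})"
    "\<And>t. t \<in> {a..b} \<Longrightarrow> (v has_vector_derivative (- x t) ** v t) (at t within {a..b})"
    "w a = mat 1" "v a = mat 1" and t: "t \<in> {a..b}"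
  shows "w t ** \<gamma> t ** v t = \<gamma> a"
proof -
  have "((\<lambda>t. w t ** \<gamma> t ** v t) has_vector_derivative 0) (at t within {a..b})" if "t \<in> {a..b}" for t
  proof -
    have "((\<lambda>t. w t ** \<gamma> t ** v t) has_vector_derivative
        (w t ** \<gamma> t) ** ((- x t) ** v t) +
        (w t ** (\<gamma> t ** x t - z t ** \<gamma> t) + (w t ** z t) ** \<gamma> t) ** v t) (at t within {a..b})"
      by (intro has_vector_derivative_matrix_mult assms(1-3) that)
    moreover have "X ** - Y = - (X ** Y)" for X Y :: "'n cmat"
      by (simp add: vec_eq_iff matrix_matrix_mult_def sum_negf)
    ultimately show ?thesis
      by (simp add: matrix_uminus_mult matrix_diff_ldistrib matrix_mul_assoc)
  qed
  then obtain c where "\<And>t. t \<in> {a..b} \<Longrightarrow> w t ** \<gamma> t ** v t = c"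
    using has_vector_derivative_zero_constant[of "{a..b}" "\<lambda>t. w t ** \<gamma> t ** v t"] by auto
  then show ?thesis using t assms(4,5) by force
qed

lemma opposite_diagonals:
  fixes f g :: "real \<Rightarrow> complex"
  assumes "\<And>t. t \<in> {a..b} \<Longrightarrow> (f has_vector_derivative f t * h t) (at t within {a..b})"
    "\<And>t. t \<in> {a..b} \<Longrightarrow> (g has_vector_derivative - (g t * h t)) (at t within {a..b})"
    "f a = 1" "g a = 1" and t: "t \<in> {a..b}"
  shows "f t * g t = 1"
proof -
  have "((\<lambda>t. f t * g t) has_vector_derivative 0) (at t within {a..b})" if "t \<in> {a..b}" for t
    using has_vector_derivative_mult[OF assms(1,2)[OF that]] by (simp add: mult_ac)
  then obtain c where "\<And>t. t \<in> {a..b} \<Longrightarrow> f t * g t = c"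
    using has_vector_derivative_zero_constant[of "{a..b}" "\<lambda>t. f t * g t"] by auto
  then show ?thesis using t assms(3,4) by force
qed

text \<open>
  The equation \<open>y s = \<gamma> s x - z \<gamma> s = \<gamma> s x' - z' \<gamma> s\<close> holds with continuous triangular coefficients
  by \<open>constant_rank_lift\<close>. The interval is centred at \<open>s0\<close>, but the differential equations are solved
  from its left end, so that one-sided initial value problems suffice.
\<close>

lemma dressed_along_curve:
  fixes \<gamma> :: "real \<Rightarrow> ('n::{finite,linorder}) cmat"
  assumes e: "e > 0" and J: "J = {s0 - e<..<s0 + e}"
    and der: "\<And>s. s \<in> J \<Longrightarrow> (\<gamma> has_vector_derivative y s) (at s)" and y: "continuous_on J y"
    and inD: "\<And>s. s \<in> J \<Longrightarrow> y s \<in> hamiltonian_distribution (\<gamma> s)"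
    and rank: "\<And>s. s \<in> J \<Longrightarrow> dim (hamiltonian_distribution (\<gamma> s)) = k"
  obtains d where "d > 0" "\<And>s. s \<in> {s0 - d..s0 + d} \<Longrightarrow> dressed (\<gamma> (s0 - d)) (\<gamma> s)"
proof -
  have contg: "continuous_on J \<gamma>"
    by (intro continuous_at_imp_continuous_on ballI) (use der has_vector_derivative_continuous in blast)
  have cont_r: "continuous_on S (\<lambda>s. r_upper (f s))" "continuous_on S (\<lambda>s. r_lower (f s))"
    if "continuous_on S f" for S :: "real set" and f :: "real \<Rightarrow> 'n cmat"
  proof -
    have "linear (r_upper :: 'n cmat \<Rightarrow> _)" "linear (r_lower :: 'n cmat \<Rightarrow> _)"
      by (auto intro!: linearI simp: vec_eq_iff r_upper_def r_lower_def algebra_simps)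
    then have "bounded_linear (r_upper :: 'n cmat \<Rightarrow> _)" "bounded_linear (r_lower :: 'n cmat \<Rightarrow> _)"
      by (simp_all add: linear_conv_bounded_linear)
    then show "continuous_on S (\<lambda>s. r_upper (f s))" "continuous_on S (\<lambda>s. r_lower (f s))"
      using that by (auto intro: bounded_linear.continuous_on)
  qed
  note cont_mult = bounded_bilinear.continuous_on[OF bounded_bilinear_matrix_mult]
  obtain d0 F where F: "0 < d0" "d0 < e" "continuous_on {s0 - d0..s0 + d0} F"
    "\<And>s. s \<in> {s0 - d0..s0 + d0} \<Longrightarrow> hamiltonian_map (\<gamma> s) (F s) = y s"
  proof (rule constant_rank_lift[of e J s0 "\<lambda>s. hamiltonian_map (\<gamma> s)" k y, OF e J])
    show "continuous_on J (\<lambda>s. hamiltonian_map (\<gamma> s) X)" for X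
      unfolding hamiltonian_map_def by (intro continuous_on_diff cont_mult contg cont_r continuous_on_const)
    show "linear (hamiltonian_map (\<gamma> s))" for s
    proof (rule linearI)
      show "hamiltonian_map (\<gamma> s) (a *\<^sub>R X) = a *\<^sub>R hamiltonian_map (\<gamma> s) X" for a X
        by (simp only: scaleR_cscale hamiltonian_map_cscale)
    qed (rule hamiltonian_map_add)
    show "dim (range (hamiltonian_map (\<gamma> s))) = k" if "s \<in> J" for s
      using rank[OF that] by (simp add: hamiltonian_distribution_eq)
    show "y s \<in> range (hamiltonian_map (\<gamma> s))" if "s \<in> J" for s
      using inD[OF that] by (simp add: hamiltonian_distribution_eq)
  qed (use y in auto)
  define I where "I = {s0 - d0..s0 + d0}"
  have IJ: "I \<subseteq> J" using F by (auto simp: I_def J)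
  define x where "x s = r_upper (F s ** \<gamma> s)" for s
  define x' where "x' s = r_lower (F s ** \<gamma> s)" for s
  define z where "z s = r_upper (\<gamma> s ** F s)" for s
  define z' where "z' s = r_lower (\<gamma> s ** F s)" for s
  have cI: "continuous_on I x" "continuous_on I x'" "continuous_on I z" "continuous_on I z'"
    unfolding x_def x'_def z_def z'_def
    using F(3) continuous_on_subset[OF contg IJ] by (auto intro!: cont_r cont_mult simp: I_def)
  have "\<exists>M>0. \<forall>s\<in>I. norm (f s) \<le> M" if "continuous_on I f" for f :: "real \<Rightarrow> 'n cmat"
    using compact_imp_bounded[OF compact_continuous_image[OF that]]
    by (auto simp: bounded_pos I_def)
  then obtain M1 M2 M3 M4 where M: "M1 > 0" "\<And>s. s \<in> I \<Longrightarrow> norm (x s) \<le> M1"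
    "M2 > 0" "\<And>s. s \<in> I \<Longrightarrow> norm (x' s) \<le> M2" "M3 > 0" "\<And>s. s \<in> I \<Longrightarrow> norm (z s) \<le> M3"
    "M4 > 0" "\<And>s. s \<in> I \<Longrightarrow> norm (z' s) \<le> M4"
    using cI by metis
  define M where "M = M1 + M2 + M3 + M4"
  have Mb: "norm (x s) \<le> M" "norm (x' s) \<le> M" "norm (z s) \<le> M" "norm (z' s) \<le> M" if "s \<in> I" for s
    using M(2,4,6,8)[OF that] M(1,3,5,7) by (auto simp: M_def)
  have M0: "M > 0" using M by (simp add: M_def)
  obtain C where C: "C > 0" "\<And>(X :: 'n cmat) (Y :: 'n cmat). norm (X ** Y) \<le> norm X * norm Y * C"
    using bounded_bilinear.pos_bounded[OF bounded_bilinear_matrix_mult] by blast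
  have C': "norm (X ** Y) \<le> C * norm X * norm Y" for X Y :: "'n cmat"
    using C(2)[of X Y] by (simp add: mult_ac)
  \<comment> \<open>The interval has length \<open>2 * d\<close>, so that \<open>C * M * (2 * d) \<le> 1 / 2\<close> makes the iteration contract.\<close>
  define d where "d = min d0 (1 / (4 * C * M))"
  have d: "d > 0" "d \<le> d0" using F(1) C(1) M0 by (auto simp: d_def)
  have "C * M * d \<le> C * M * (1 / (4 * C * M))"
    using C(1) M0 by (intro mult_left_mono) (auto simp: d_def)
  also have "\<dots> = 1 / 4" using C(1) M0 by simp
  finally have short: "C * M * (s0 + d - (s0 - d)) < 1" by (simp add: algebra_simps)
  define a where "a = s0 - d"
  define b where "b = s0 + d"
  have ab: "a < b" and abI: "{a..b} \<subseteq> I" using d by (auto simp: a_def b_def I_def)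
  have short': "C * M * (b - a) < 1" using short by (simp add: a_def b_def)
  note cab = cI[THEN continuous_on_subset, OF abI]
  have ode: "\<exists>X Y. X a = mat 1 \<and> Y a = mat 1 \<and> (\<forall>t\<in>{a..b}. tri Q (X t) \<and> tri Q (Y t) \<and>
      (X has_vector_derivative X t ** f t) (at t within {a..b}) \<and>
      (Y has_vector_derivative f t ** Y t) (at t within {a..b}))"
    if f: "continuous_on {a..b} f" "\<And>t. t \<in> {a..b} \<Longrightarrow> norm (f t) \<le> M" "partial_order_rel Q"
      "\<And>t. tri Q (f t)" for f :: "real \<Rightarrow> 'n cmat" and Q
    using matrix_ode[OF ab f(1,2) less_imp_le[OF C(1)] C' less_imp_le[OF M0] short' f(3,4)] by metis
  have tri: "upper (z s)" "lower (z' s)" "upper (- x s)" "lower (- x' s)" for s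
    by (auto simp: z_def z'_def x_def x'_def intro: tri_uminus)
  have bd: "norm (z t) \<le> M" "norm (z' t) \<le> M" "norm (- x t) \<le> M" "norm (- x' t) \<le> M"
    if "t \<in> {a..b}" for t
    using Mb[of t] that abI by auto
  note le = partial_order_rel_le
  obtain w where w: "w a = mat 1" "\<And>t. t \<in> {a..b} \<Longrightarrow> upper (w t)"
    "\<And>t. t \<in> {a..b} \<Longrightarrow> (w has_vector_derivative w t ** z t) (at t within {a..b})"
    using ode[OF cab(3) bd(1) le(1) tri(1)] by blast
  obtain w' where w': "w' a = mat 1" "\<And>t. t \<in> {a..b} \<Longrightarrow> lower (w' t)"
    "\<And>t. t \<in> {a..b} \<Longrightarrow> (w' has_vector_derivative w' t ** z' t) (at t within {a..b})"
    using ode[OF cab(4) bd(2) le(2) tri(2)] by blast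
  have neg: "continuous_on {a..b} (\<lambda>s. - x s)" "continuous_on {a..b} (\<lambda>s. - x' s)"
    using cab by (auto intro: continuous_on_minus)
  obtain v where v: "v a = mat 1" "\<And>t. t \<in> {a..b} \<Longrightarrow> upper (v t)"
    "\<And>t. t \<in> {a..b} \<Longrightarrow> (v has_vector_derivative (- x t) ** v t) (at t within {a..b})"
    using ode[OF neg(1) bd(3) le(1) tri(3)] by blast
  obtain v' where v': "v' a = mat 1" "\<And>t. t \<in> {a..b} \<Longrightarrow> lower (v' t)"
    "\<And>t. t \<in> {a..b} \<Longrightarrow> (v' has_vector_derivative (- x' t) ** v' t) (at t within {a..b})"
    using ode[OF neg(2) bd(4) le(2) tri(4)] by blast
  have g: "(\<gamma> has_vector_derivative \<gamma> t ** x t - z t ** \<gamma> t) (at t within {a..b})"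
    "(\<gamma> has_vector_derivative \<gamma> t ** x' t - z' t ** \<gamma> t) (at t within {a..b})" if "t \<in> {a..b}" for t
  proof -
    have t: "t \<in> I" "t \<in> J" using that abI IJ by auto
    have "y t = \<gamma> t ** x t - z t ** \<gamma> t" "y t = \<gamma> t ** x' t - z' t ** \<gamma> t"
      using F(4)[of t] t(1) hamiltonian_map_lower[of "\<gamma> t" "F t"]
      by (auto simp: I_def hamiltonian_map_def x_def x'_def z_def z'_def)
    then show "(\<gamma> has_vector_derivative \<gamma> t ** x t - z t ** \<gamma> t) (at t within {a..b})"
      "(\<gamma> has_vector_derivative \<gamma> t ** x' t - z' t ** \<gamma> t) (at t within {a..b})"
      using has_vector_derivative_at_within[OF der[OF t(2)]] by metis+
  qed
  have one: "(mat 1 :: 'n cmat) $ i $ i = 1" for i by (simp add: mat_def)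
  note U = tri_mult(2)[OF partial_order_rel_le(1)] and L = tri_mult(2)[OF partial_order_rel_le(2)]
  have dz: "z' s $ i $ i = - z s $ i $ i" "x' s $ i $ i = - x s $ i $ i" for s i
    by (simp_all add: z_def z'_def x_def x'_def)
  have "dressed (\<gamma> a) (\<gamma> t)" if t: "t \<in> {a..b}" for t
  proof -
    have e1: "\<gamma> a = w t ** \<gamma> t ** v t"
      using conjugated_curve_constant[OF g(1) w(3) v(3) w(1) v(1) t] by simp
    have e2: "\<gamma> a = w' t ** \<gamma> t ** v' t"
      using conjugated_curve_constant[OF g(2) w'(3) v'(3) w'(1) v'(1) t] by simp
    have p1: "w t $ i $ i * w' t $ i $ i = 1" for i
    proof (rule opposite_diagonals[OF _ _ _ _ t])
      fix s assume s: "s \<in> {a..b}"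
      show "((\<lambda>s. w s $ i $ i) has_vector_derivative w s $ i $ i * z s $ i $ i) (at s within {a..b})"
        using has_vector_derivative_entry[OF w(3)[OF s], of i i] U[OF w(2)[OF s] tri(1), of s i] by simp
      show "((\<lambda>s. w' s $ i $ i) has_vector_derivative - (w' s $ i $ i * z s $ i $ i)) (at s within {a..b})"
        using has_vector_derivative_entry[OF w'(3)[OF s], of i i] L[OF w'(2)[OF s] tri(2), of s i]
        by (simp add: dz)
    qed (simp_all add: w w' one)
    have p2: "v' t $ i $ i * v t $ i $ i = 1" for i
    proof (rule opposite_diagonals[OF _ _ _ _ t])
      fix s assume s: "s \<in> {a..b}"
      show "((\<lambda>s. v' s $ i $ i) has_vector_derivative v' s $ i $ i * x s $ i $ i) (at s within {a..b})"
        using has_vector_derivative_entry[OF v'(3)[OF s], of i i] L[OF tri(4) v'(2)[OF s], of s i]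
        by (simp add: dz mult.commute)
      show "((\<lambda>s. v s $ i $ i) has_vector_derivative - (v s $ i $ i * x s $ i $ i)) (at s within {a..b})"
        using has_vector_derivative_entry[OF v(3)[OF s], of i i] U[OF tri(3) v(2)[OF s], of s i]
        by (simp add: mult.commute)
    qed (simp_all add: v v' one)
    have "w t \<in> B_plus" "v t \<in> B_plus" "w' t \<in> B_minus" "v' t \<in> B_minus"
      using w(2)[OF t] v(2)[OF t] w'(2)[OF t] v'(2)[OF t] p1 p2
      by (auto simp: B_plus_iff B_minus_iff) (metis mult_zero_left mult_zero_right zero_neq_one)+
    moreover have "\<forall>i. v t $ i $ i * v' t $ i $ i = 1" using p2 by (simp add: mult.commute)
    ultimately show ?thesis unfolding dressed_def using e1 e2 p1 by blast
  qed
  then show ?thesis using that[OF d(1)] by (simp add: a_def b_def)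
qed

lemma norm_cscale: "norm (cscale c A) = cmod c * norm A"
proof -
  have "norm (cscale c A $ i) = cmod c * norm (A $ i)" for i
    by (simp add: norm_vec_def norm_mult L2_set_right_distrib)
  then show ?thesis
    by (simp add: norm_vec_def[of "cscale c A"] norm_vec_def[of A] L2_set_right_distrib)
qed

context cell_pair
begin

lemma dressed_level:
  assumes "dressed A B" "q \<in> cell"
  shows "A \<in> level q \<longleftrightarrow> B \<in> level q"
  using dressed_cell[OF assms(1)] dressed_cell[OF dressed_sym[OF assms(1)]] by (auto simp: level_def)

text \<open>
  Complex lines in the domain of the chart are used because a holomorphic function of one variable
  has a continuous derivative, whereas the derivative of a chart is not assumed to be continuous.
\<close>

lemma integral_chart_level:
  assumes chart: "integral_chart E V \<phi>" and q: "q \<in> cell" and v: "v \<in> V"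
  obtains \<epsilon> where "\<epsilon> > 0" "\<And>v'. v' \<in> V \<Longrightarrow> dist v' v < \<epsilon> \<Longrightarrow> \<phi> v \<in> level q \<longleftrightarrow> \<phi> v' \<in> level q"
proof -
  have E: "cmat.subspace E" "subspace E" and opV: "openin (top_of_set E) V"
    using chart complex_subspace_imp_subspace by (auto simp: integral_chart_def)
  have "\<forall>v\<in>V. \<exists>D. (\<phi> has_derivative D) (at v within V) \<and> Vector_Spaces.linear cscale cscale D \<and>
      inj_on D E \<and> D ` E = hamiltonian_distribution (\<phi> v)"
    using chart by (simp add: integral_chart_def)
  then obtain D where D: "\<And>v. v \<in> V \<Longrightarrow> (\<phi> has_derivative D v) (at v within V)"
    "\<And>v. v \<in> V \<Longrightarrow> Vector_Spaces.linear cscale cscale (D v)" "\<And>v. v \<in> V \<Longrightarrow> inj_on (D v) E"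
    "\<And>v. v \<in> V \<Longrightarrow> D v ` E = hamiltonian_distribution (\<phi> v)"
    by metis
  obtain \<epsilon> where \<epsilon>: "\<epsilon> > 0" "\<And>v'. v' \<in> E \<Longrightarrow> dist v' v < \<epsilon> \<Longrightarrow> v' \<in> V"
    using opV v unfolding openin_euclidean_subtopology_iff by (metis)
  have VE: "V \<subseteq> E" using opV openin_imp_subset by blast
  show ?thesis
  proof (rule that[OF \<epsilon>(1)])
    fix v' assume v': "v' \<in> V" "dist v' v < \<epsilon>"
    define w where "w = v' - v"
    have wE: "w \<in> E" using v' v VE E(2) by (auto simp: w_def intro: subspace_diff)
    have nw: "norm w < \<epsilon>" using v' by (simp add: w_def dist_norm)
    \<comment> \<open>The line reaches beyond \<open>v'\<close>, so that the closed unit interval has a neighbourhood in the disc.\<close>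
    define \<rho> where "\<rho> = (if w = 0 then 2 else \<epsilon> / norm w)"
    have \<rho>: "\<rho> > 1" using nw by (simp add: \<rho>_def)
    define line where "line c = v + cscale c w" for c
    have lineV: "line c \<in> V" if "c \<in> ball 0 \<rho>" for c
    proof (rule \<epsilon>(2))
      show "line c \<in> E" unfolding line_def using v VE wE E(1) by (metis cmat.subspace_def subsetD)
      show "dist (line c) v < \<epsilon>"
        using that \<epsilon>(1) by (auto simp: line_def dist_norm norm_cscale \<rho>_def field_simps split: if_splits)
    qed
    define \<Gamma> where "\<Gamma> c = \<phi> (line c)" for c
    have dG: "((\<lambda>c. \<Gamma> c $ i $ j) has_field_derivative D (line c) w $ i $ j) (at c)" if c: "c \<in> ball 0 \<rho>" for c i j
    proof -
      have "bounded_linear (\<lambda>h. cscale h w)"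
        by (rule linear_conv_bounded_linear[THEN iffD1], rule linearI)
          (simp_all add: vec_eq_iff algebra_simps)
      then have l: "(line has_derivative (\<lambda>h. cscale h w)) (at c within ball 0 \<rho>)"
        unfolding line_def[abs_def] by (auto intro!: derivative_eq_intros bounded_linear_imp_has_derivative)
      have "line ` ball 0 \<rho> \<subseteq> V" using lineV by blast
      then have "((\<lambda>c. \<phi> (line c)) has_derivative (\<lambda>h. D (line c) (cscale h w))) (at c within ball 0 \<rho>)"
        using diff_chain_within[OF l has_derivative_subset[OF D(1)[OF lineV[OF c]]]] lineV
        by (auto simp: o_def)
      then have "(\<Gamma> has_derivative (\<lambda>h. D (line c) (cscale h w))) (at c)"
        using c by (simp add: \<Gamma>_def[abs_def] at_within_open[OF _ open_ball])
      then have "((\<lambda>c. \<Gamma> c $ i $ j) has_derivative (\<lambda>h. D (line c) (cscale h w) $ i $ j)) (at c)"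
        unfolding has_derivative_matrix_iff by blast
      moreover have "D (line c) (cscale h w) $ i $ j = D (line c) w $ i $ j * h" for h
        using D(2)[OF lineV[OF c]] by (simp add: linear_cscale_iff mult.commute)
      ultimately show ?thesis by (simp add: has_field_derivative_def)
    qed
    define y where "y s = (\<chi> i j. deriv (\<lambda>c. \<Gamma> c $ i $ j) (complex_of_real s))" for s
    have yD: "y s = D (line (of_real s)) w" if "\<bar>s\<bar> < \<rho>" for s
      using DERIV_imp_deriv[OF dG] that by (simp add: y_def vec_eq_iff)
    define \<gamma> where "\<gamma> s = \<Gamma> (complex_of_real s)" for s
    have der: "(\<gamma> has_vector_derivative y s) (at s)" if s: "\<bar>s\<bar> < \<rho>" for s
    proof -
      have "((\<lambda>t. \<gamma> t $ i $ j) has_derivative (\<lambda>h. (h *\<^sub>R y s) $ i $ j)) (at s)" for i j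
      proof -
        have "((\<lambda>c. \<Gamma> c $ i $ j) has_derivative (*) (y s $ i $ j)) (at (complex_of_real s))"
          using dG[of "of_real s" i j] s by (simp add: yD has_field_derivative_def)
        moreover have "(complex_of_real has_vector_derivative 1) (at s)"
          using has_vector_derivative_of_real[OF DERIV_ident, of "at s"] by simp
        ultimately have "((\<lambda>t. \<Gamma> (complex_of_real t) $ i $ j) has_vector_derivative y s $ i $ j) (at s)"
          using has_vector_derivative_chain[of complex_of_real 1 s "\<lambda>c. \<Gamma> c $ i $ j" "(*) (y s $ i $ j)"] by simp
        then show ?thesis by (simp add: \<gamma>_def has_vector_derivative_def)
      qed
      then show ?thesis unfolding has_vector_derivative_def has_derivative_matrix_iff by blast
    qed
    have ycont: "continuous_on {s. \<bar>s\<bar> < \<rho>} y"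
      unfolding y_def
    proof (intro continuous_on_vec_lambda)
      fix i j
      have "(\<lambda>c. \<Gamma> c $ i $ j) holomorphic_on ball 0 \<rho>"
        unfolding holomorphic_on_open[OF open_ball] by (intro ballI exI) (rule dG)
      then have "continuous_on (ball 0 \<rho>) (deriv (\<lambda>c. \<Gamma> c $ i $ j))"
        by (intro holomorphic_on_imp_continuous_on holomorphic_deriv) auto
      then show "continuous_on {s. \<bar>s\<bar> < \<rho>} (\<lambda>s. deriv (\<lambda>c. \<Gamma> c $ i $ j) (complex_of_real s))"
        by (rule continuous_on_compose2) (auto intro!: continuous_intros)
    qed
    have inD: "y s \<in> hamiltonian_distribution (\<gamma> s)" if "\<bar>s\<bar> < \<rho>" for s
      using yD[OF that] D(4)[OF lineV[of "of_real s"]] wE that by (auto simp: \<gamma>_def \<Gamma>_def)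
    have rank: "dim (hamiltonian_distribution (\<gamma> s)) = dim E" if "\<bar>s\<bar> < \<rho>" for s
    proof -
      have V: "line (of_real s) \<in> V" using lineV that by simp
      have "linear (D (line (of_real s)))" using D(1)[OF V] has_derivative_linear by blast
      moreover have "inj_on (D (line (of_real s))) (span E)" using D(3)[OF V] E(2) by (simp add: span_eq_iff[THEN iffD2])
      ultimately have "dim (D (line (of_real s)) ` E) = dim E" by (rule dim_image_eq)
      then show ?thesis using D(4)[OF V] by (simp add: \<gamma>_def \<Gamma>_def)
    qed
    have "\<forall>s0\<in>{0..1}. \<forall>\<^sub>F s in at s0 within {0..1}. (\<gamma> s0 \<in> level q) = (\<gamma> s \<in> level q)"
    proof
      fix s0 :: real assume s0: "s0 \<in> {0..1}"
      define J where "J = {s0 - (\<rho> - 1)<..<s0 + (\<rho> - 1)}"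
      have J: "\<bar>s\<bar> < \<rho>" if "s \<in> J" for s using that s0 \<rho> by (auto simp: J_def)
      have JJ: "continuous_on J y" by (rule continuous_on_subset[OF ycont]) (use J in auto)
      obtain d where d: "d > 0" "\<And>s. s \<in> {s0 - d..s0 + d} \<Longrightarrow> dressed (\<gamma> (s0 - d)) (\<gamma> s)"
        by (rule dressed_along_curve[of "\<rho> - 1" J s0 \<gamma> y "dim E"])
          (use \<rho> J_def der inD rank J JJ in auto)
      have "(\<gamma> s0 \<in> level q) = (\<gamma> s \<in> level q)" if "dist s s0 < d" for s
      proof -
        have "s0 \<in> {s0 - d..s0 + d}" "s \<in> {s0 - d..s0 + d}" using that d(1) by (auto simp: dist_real_def)
        then show ?thesis using dressed_level[OF d(2) q] by blast
      qed
      then show "\<forall>\<^sub>F s in at s0 within {0..1}. (\<gamma> s0 \<in> level q) = (\<gamma> s \<in> level q)"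
        unfolding eventually_at using d(1) by blast
    qed
    from connected_local_const[OF _ _ _ this, of 0 1]
    have "(\<gamma> 0 \<in> level q) = (\<gamma> 1 \<in> level q)" by auto
    moreover have "\<gamma> 0 = \<phi> v" "\<gamma> 1 = \<phi> v'"
    proof -
      have "cscale 0 w = 0" "cscale 1 w = w" by (simp_all add: vec_eq_iff)
      then show "\<gamma> 0 = \<phi> v" "\<gamma> 1 = \<phi> v'" by (simp_all add: \<gamma>_def \<Gamma>_def line_def w_def)
    qed
    ultimately show "\<phi> v \<in> level q \<longleftrightarrow> \<phi> v' \<in> level q" by simp
  qed
qed

text \<open>
  The part in the level set and the rest are both open in the manifold topology. This topology is
  finer than the subspace topology, as the charts are continuous.
\<close>

lemma connected_integral_manifold_level:
  assumes N: "connected_integral_manifold S" and q: "q \<in> cell" "q \<in> S"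
  shows "S \<subseteq> level q" "connected S"
proof -
  obtain T where T: "integral_manifold S T" "connected_space T"
    using N by (auto simp: connected_integral_manifold_def)
  have top: "topspace T = S" using T(1) by (simp add: integral_manifold_def)
  \<comment> \<open>A subset of the manifold is open if it is so in every chart.\<close>
  have loc: "openin T {x \<in> S. Pr x}"
    if ext: "\<And>E V \<phi> v. integral_chart E V \<phi> \<Longrightarrow> \<phi> ` V \<subseteq> S \<Longrightarrow> v \<in> V \<Longrightarrow> Pr (\<phi> v) \<Longrightarrow>
      \<exists>W. openin (top_of_set V) W \<and> v \<in> W \<and> (\<forall>u\<in>W. Pr (\<phi> u))" for Pr
  proof (subst openin_subopen, intro ballI)
    fix x assume x: "x \<in> {x \<in> S. Pr x}"
    then obtain U E V \<phi> where c: "openin T U" "x \<in> U" "integral_chart E V \<phi>"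
      "homeomorphic_map (top_of_set V) (subtopology T U) \<phi>"
      using T(1) unfolding integral_manifold_def by blast
    have US: "U \<subseteq> S" using openin_subset[OF c(1)] top by simp
    have img: "\<phi> ` V = U"
      using homeomorphic_imp_surjective_map[OF c(4)] US top by auto
    obtain v where v: "v \<in> V" "x = \<phi> v" using c(2) img by blast
    obtain W where W: "openin (top_of_set V) W" "v \<in> W" "\<forall>u\<in>W. Pr (\<phi> u)"
      using ext[OF c(3)] img US v x by blast
    have "openin (subtopology T U) (\<phi> ` W)"
      using homeomorphic_imp_open_map[OF c(4)] W(1) by (auto simp: open_map_def)
    then have "openin T (\<phi> ` W)" using c(1) by (simp add: openin_open_subtopology)
    moreover have "\<phi> ` W \<subseteq> {x \<in> S. Pr x}"
      using W(3) openin_imp_subset[OF W(1)] img US by auto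
    ultimately show "\<exists>Z. openin T Z \<and> x \<in> Z \<and> Z \<subseteq> {x \<in> S. Pr x}"
      using v W(2) by blast
  qed
  have lev: "\<exists>W. openin (top_of_set V) W \<and> v \<in> W \<and> (\<forall>u\<in>W. (\<phi> v \<in> level q) = (\<phi> u \<in> level q))"
    if c: "integral_chart E V \<phi>" and v: "v \<in> V" for E V \<phi> v
  proof -
    obtain \<epsilon> where \<epsilon>: "\<epsilon> > 0" "\<And>v'. v' \<in> V \<Longrightarrow> dist v' v < \<epsilon> \<Longrightarrow> \<phi> v \<in> level q \<longleftrightarrow> \<phi> v' \<in> level q"
      by (rule integral_chart_level[OF c q(1) v]) blast
    show ?thesis
    proof (intro exI conjI ballI)
      show "openin (top_of_set V) (V \<inter> ball v \<epsilon>)" by (rule openin_open_Int[OF open_ball])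
      show "v \<in> V \<inter> ball v \<epsilon>" using v \<epsilon>(1) by simp
      show "(\<phi> v \<in> level q) = (\<phi> u \<in> level q)" if "u \<in> V \<inter> ball v \<epsilon>" for u
        by (rule \<epsilon>(2)) (use that in \<open>auto simp: dist_commute\<close>)
    qed
  qed
  have "openin T {x \<in> S. x \<in> level q}"
  proof (rule loc)
    show "\<exists>W. openin (top_of_set V) W \<and> v \<in> W \<and> (\<forall>u\<in>W. \<phi> u \<in> level q)"
      if "integral_chart E V \<phi>" "v \<in> V" "\<phi> v \<in> level q" for E V \<phi> v
      using lev[OF that(1,2)] that(3) by simp
  qed
  moreover have "openin T {x \<in> S. x \<notin> level q}"
  proof (rule loc)
    show "\<exists>W. openin (top_of_set V) W \<and> v \<in> W \<and> (\<forall>u\<in>W. \<phi> u \<notin> level q)"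
      if "integral_chart E V \<phi>" "v \<in> V" "\<phi> v \<notin> level q" for E V \<phi> v
      using lev[OF that(1,2)] that(3) by simp
  qed
  then have "closedin T {x \<in> S. x \<in> level q}"
    by (auto simp: closedin_def top set_diff_eq elim: back_subst[of "openin T"])
  moreover have "q \<in> {x \<in> S. x \<in> level q}" using q by (simp add: level_def)
  ultimately have "{x \<in> S. x \<in> level q} = S"
    using T(2) unfolding connected_space_clopen_in top by blast
  then show "S \<subseteq> level q" by blast
  have "continuous_map T euclidean id"
    unfolding continuous_map
  proof (intro conjI allI impI)
    fix O' :: "'n cmat set" assume "openin euclidean O'"
    then have O': "open O'" by simp
    have "openin T {x \<in> S. x \<in> O'}"
    proof (rule loc)
      fix E V v and \<phi> :: "'n cmat \<Rightarrow> 'n cmat"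
      assume *: "integral_chart E V \<phi>" "v \<in> V" "\<phi> v \<in> O'"
      have "continuous_on V \<phi>"
        unfolding continuous_on_eq_continuous_within
      proof
        fix u assume "u \<in> V"
        then obtain D where "(\<phi> has_derivative D) (at u within V)"
          using *(1) unfolding integral_chart_def by blast
        then show "continuous (at u within V) \<phi>" by (rule has_derivative_continuous)
      qed
      then have "openin (top_of_set V) (V \<inter> \<phi> -` O')" using O' continuous_openin_preimage_gen by blast
      then show "\<exists>W. openin (top_of_set V) W \<and> v \<in> W \<and> (\<forall>u\<in>W. \<phi> u \<in> O')" using * by blast
    qed
    then show "openin T {x \<in> topspace T. id x \<in> O'}" by (simp add: top)
  qed auto
  moreover have "connectedin T S" using T(2) top connectedin_topspace by metis
  ultimately have "connectedin euclidean (id ` S)" using connectedin_continuous_map_image by blast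
  then show "connected S" by simp
qed

end


section \<open>Leaves and loaves\<close>

context cell_pair
begin

definition "leaf q = connected_component_set (level q) q"

lemma level_self: "q \<in> cell \<Longrightarrow> q \<in> level q"
  by (simp add: level_def)

lemma leaf_self: "q \<in> cell \<Longrightarrow> q \<in> leaf q"
  by (simp add: leaf_def level_self)

lemma leaf_subset: "leaf q \<subseteq> level q"
  by (simp add: leaf_def connected_component_subset)

lemma level_cell: "level q \<subseteq> cell"
  by (auto simp: level_def)

lemma level_eq: "x \<in> level q \<Longrightarrow> level x = level q"
  by (auto simp: level_def)

lemma leaf_eq: "x \<in> leaf q \<Longrightarrow> leaf x = leaf q"
  using leaf_subset[of q] level_eq[of x q] unfolding leaf_def by (metis connected_component_eq subsetD)

lemma connected_in_leaf:
  assumes "connected S" "q \<in> S" "S \<subseteq> level q"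
  shows "S \<subseteq> leaf q"
  unfolding leaf_def using assms by (intro connected_component_maximal)

lemma cell_point: "q \<in> cell \<Longrightarrow> cell_point p r N q"
  by (intro cell_point.intro cell_pair_axioms) (simp add: cell_point_axioms_def)

lemma leaf_chart:
  assumes q: "q \<in> cell"
  obtains E V \<phi> where "integral_chart E V \<phi>" "q \<in> \<phi> ` V" "\<phi> ` V \<subseteq> leaf q"
    "openin (top_of_set (level q)) (\<phi> ` V)"
    "homeomorphic_map (top_of_set V) (top_of_set (\<phi> ` V)) \<phi>"
proof -
  interpret cell_point p r N q by (rule cell_point[OF q])
  obtain E V \<phi> where c: "integral_chart E V \<phi>" "connected V" "q \<in> \<phi> ` V"
    "openin (top_of_set (level q)) (\<phi> ` V)"
    "homeomorphic_map (top_of_set V) (top_of_set (\<phi> ` V)) \<phi>"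
    by (rule chart_exists) blast
  have "continuous_on V \<phi>"
    using homeomorphic_imp_continuous_map[OF c(5)] by (simp add: continuous_map_in_subtopology)
  then have "\<phi> ` V \<subseteq> leaf q"
    using c(2,3) openin_imp_subset[OF c(4)] by (intro connected_in_leaf connected_continuous_image)
  then show ?thesis using that c by blast
qed

lemma leaf_integral_manifold:
  assumes q: "q \<in> cell"
  shows "connected_integral_manifold (leaf q)"
  unfolding connected_integral_manifold_def
proof (intro exI conjI)
  have "connected (leaf q)" by (simp add: leaf_def)
  then show "connected_space (top_of_set (leaf q))" by (simp add: connected_space_subtopology)
  show "integral_manifold (leaf q) (top_of_set (leaf q))"
    unfolding integral_manifold_def
  proof (intro conjI ballI)
    show "leaf q \<subseteq> GL" using subset_trans[OF leaf_subset level_cell] cell_invertible by (auto simp: GL_def)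
    show "Hausdorff_space (top_of_set (leaf q))" by (intro Hausdorff_space_subtopology Hausdorff_space_euclidean)
    have "second_countable (euclidean :: 'n cmat topology)"
    proof -
      obtain \<B> :: "'n cmat set set" where \<B>: "countable \<B>" "\<And>C. C \<in> \<B> \<Longrightarrow> open C"
        "\<And>S. open S \<Longrightarrow> \<exists>U. U \<subseteq> \<B> \<and> S = \<Union>U"
        using univ_second_countable by blast
      show ?thesis unfolding second_countable_def
      proof (intro exI conjI allI impI ballI)
        show "countable \<B>" by (rule \<B>(1))
        show "openin euclidean V" if "V \<in> \<B>" for V using \<B>(2) that by simp
        fix U x assume "openin euclidean U \<and> x \<in> (U :: 'n cmat set)"
        then show "\<exists>V\<in>\<B>. x \<in> V \<and> V \<subseteq> U" using \<B>(3)[of U] by auto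
      qed
    qed
    then show "second_countable (top_of_set (leaf q))" by (rule second_countable_subtopology)
    fix x assume x: "x \<in> leaf q"
    then have xc: "x \<in> cell" and lx: "level x = level q" and le: "leaf x = leaf q"
      using leaf_subset level_cell level_eq leaf_eq by blast+
    obtain E V \<phi> where c: "integral_chart E V \<phi>" "x \<in> \<phi> ` V" "\<phi> ` V \<subseteq> leaf x"
      "openin (top_of_set (level x)) (\<phi> ` V)"
      "homeomorphic_map (top_of_set V) (top_of_set (\<phi> ` V)) \<phi>"
      by (rule leaf_chart[OF xc]) blast
    show "\<exists>U E V \<phi>. openin (top_of_set (leaf q)) U \<and> x \<in> U \<and> integral_chart E V \<phi> \<and>
        homeomorphic_map (top_of_set V) (subtopology (top_of_set (leaf q)) U) \<phi>"
    proof (intro exI conjI)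
      show "openin (top_of_set (leaf q)) (\<phi> ` V)"
        using c(3,4) leaf_subset[of q] unfolding lx le by (rule_tac openin_subset_trans) auto
      have "subtopology (top_of_set (leaf q)) (\<phi> ` V) = top_of_set (\<phi> ` V)"
        using c(3) le by (simp add: subtopology_subtopology Int_absorb1)
      then show "homeomorphic_map (top_of_set V) (subtopology (top_of_set (leaf q)) (\<phi> ` V)) \<phi>"
        using c(5) by simp
    qed (use c in auto)
  qed simp
qed

text \<open>
  A larger connected integral manifold would be a connected subset of the same level set.
\<close>

lemma leaf_symplectic:
  assumes q: "q \<in> cell"
  shows "symplectic_leaf (leaf q)"
  unfolding symplectic_leaf_def
proof (intro conjI allI impI leaf_integral_manifold[OF q])
  fix S assume S: "connected_integral_manifold S \<and> leaf q \<subseteq> S"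
  then have "q \<in> S" using leaf_self[OF q] by blast
  then have "S \<subseteq> leaf q"
    using connected_in_leaf connected_integral_manifold_level[of S q] S q by blast
  then show "S = leaf q" using S by blast
qed

lemma symplectic_leaf_eq:
  assumes L: "symplectic_leaf L" and q: "q \<in> cell" "q \<in> L"
  shows "L = leaf q"
proof -
  have "L \<subseteq> leaf q"
    using connected_in_leaf connected_integral_manifold_level[of L q] L q
    by (auto simp: symplectic_leaf_def)
  then show ?thesis using L leaf_integral_manifold[OF q(1)] by (auto simp: symplectic_leaf_def)
qed

lemma torus_leaf:
  assumes x: "x \<in> cell" and a: "\<And>i. a i \<noteq> 0" and A: "A \<in> leaf x"
  shows "diagm a ** A \<in> leaf (diagm a ** x)"
proof -
  have "KK (diagm a ** B) = KK (diagm a ** x)" if "B \<in> leaf x" for B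
  proof -
    have "B \<in> cell" "KK B = KK x" using that leaf_subset by (auto simp: level_def)
    then show ?thesis by (auto simp: torus_cell(3)[where a = a, OF _ a] x)
  qed
  then have "(\<lambda>B. diagm a ** B) ` leaf x \<subseteq> level (diagm a ** x)"
    using leaf_subset torus_cell(1)[where a = a, OF _ a] by (auto simp: level_def)
  moreover have "connected ((\<lambda>B. diagm a ** B) ` leaf x)"
    by (intro connected_continuous_image bounded_linear.continuous_on[OF
          bounded_bilinear.bounded_linear_right[OF bounded_bilinear_matrix_mult]] continuous_on_id)
      (simp add: leaf_def)
  ultimately show ?thesis
    using connected_in_leaf[of "(\<lambda>B. diagm a ** B) ` leaf x" "diagm a ** x"] A leaf_self[OF x] by blast
qed

text \<open>
  The torus moves the leaf through \<open>x\<close> over a neighbourhood of \<open>x\<close> in the cell, since the retraction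
  onto the level set of \<open>x\<close> only multiplies by torus elements.
\<close>

lemma torus_leaf_neighbourhood:
  assumes x: "x \<in> cell"
  obtains S where "open S" "x \<in> S"
    "\<And>A. A \<in> cell \<Longrightarrow> A \<in> S \<Longrightarrow> \<exists>a. (\<forall>i. a i \<noteq> 0) \<and> diagm a ** A \<in> leaf x"
proof -
  interpret cell_point p r N x by (rule cell_point[OF x])
  obtain E V \<phi> where c: "integral_chart E V \<phi>" "x \<in> \<phi> ` V" "\<phi> ` V \<subseteq> leaf x"
    "openin (top_of_set (level x)) (\<phi> ` V)"
    "homeomorphic_map (top_of_set V) (top_of_set (\<phi> ` V)) \<phi>"
    by (rule leaf_chart[OF x]) blast
  obtain O' where O': "open O'" "\<phi> ` V = level x \<inter> O'" using c(4) by (auto simp: openin_open)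
  have r: "KK x i / KK x i = 1" for i using KK_nonzero[OF cell_factors(1)[OF x]] by simp
  have x0: "x \<in> retract_dom" using cell_factors(1)[OF x] r by (simp add: retract_dom_def)
  have "scale_to x = (\<lambda>i. 1)" using r by (simp add: scale_to_def[abs_def])
  then have rx: "retract x = x" by (simp add: retract_def diagm_one)
  show ?thesis
  proof (rule that[of "{A \<in> retract_dom. retract A \<in> O'}"])
    show "open {A \<in> retract_dom. retract A \<in> O'}"
      by (rule open_continuous_preimage[OF open_retract_dom _ O'(1)]) (rule mdiff_isCont[OF mdiff_retract])
    show "x \<in> {A \<in> retract_dom. retract A \<in> O'}" using x0 c(2) O'(2) by (simp add: rx)
    fix A assume A: "A \<in> cell" "A \<in> {A \<in> retract_dom. retract A \<in> O'}"
    have "retract A \<in> leaf x" using retract_level(1)[OF A(1)] A(2) O'(2) c(3) by blast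
    then show "\<exists>a. (\<forall>i. a i \<noteq> 0) \<and> diagm a ** A \<in> leaf x"
      using retract_level(2)[OF A(1)] by (auto simp: retract_def)
  qed
qed

text \<open>
  Whether a translate of \<open>x\<close> lies on the leaf of \<open>q\<close> is a locally constant property of \<open>x\<close>, since
  points near \<open>x\<close> have translates on the leaf of \<open>x\<close>, and the torus permutes the leaves.
\<close>

lemma torus_leaf_covers:
  assumes q: "q \<in> cell" and x: "x \<in> cell"
  shows "\<exists>a. (\<forall>i. a i \<noteq> 0) \<and> diagm a ** x \<in> leaf q"
proof -
  define W where "W x \<longleftrightarrow> (\<exists>a. (\<forall>i. a i \<noteq> 0) \<and> diagm a ** x \<in> leaf q)" for x :: "'n cmat"
  have "\<forall>x\<in>cell. \<forall>\<^sub>F A in at x within cell. W x = W A"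
  proof
    fix x assume x: "x \<in> cell"
    obtain S where S: "open S" "x \<in> S"
      "\<And>A. A \<in> cell \<Longrightarrow> A \<in> S \<Longrightarrow> \<exists>a. (\<forall>i. a i \<noteq> 0) \<and> diagm a ** A \<in> leaf x"
      by (rule torus_leaf_neighbourhood[OF x]) blast
    have "W x = W A" if A: "A \<in> cell" "A \<in> S" for A
    proof -
      obtain a where a: "\<And>i. a i \<noteq> 0" "diagm a ** A \<in> leaf x" using S(3)[OF A] by blast
      show ?thesis
      proof
        assume "W x"
        then obtain b where b: "\<And>i. b i \<noteq> 0" "diagm b ** x \<in> leaf q" unfolding W_def by blast
        have "diagm b ** (diagm a ** A) \<in> leaf (diagm b ** x)" by (rule torus_leaf[OF x b(1) a(2)])
        then have "diagm (\<lambda>i. b i * a i) ** A \<in> leaf q"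
          using leaf_eq[OF b(2)] by (simp add: matrix_mul_assoc diagm_diagm)
        then show "W A" unfolding W_def using a(1) b(1) by (intro exI[of _ "\<lambda>i. b i * a i"]) auto
      next
        assume "W A"
        then obtain b where b: "\<And>i. b i \<noteq> 0" "diagm b ** A \<in> leaf q" unfolding W_def by blast
        define d where "d i = b i / a i" for i
        have d: "d i \<noteq> 0" for i using a(1) b(1) by (simp add: d_def)
        have "diagm d ** (diagm a ** A) = diagm b ** A"
          using a(1) by (simp add: matrix_mul_assoc diagm_diagm d_def)
        then have "diagm b ** A \<in> leaf (diagm d ** x)" using torus_leaf[where a = d, OF x d a(2)] by simp
        then have "leaf (diagm d ** x) = leaf q" using leaf_eq b(2) by metis
        moreover have "diagm d ** x \<in> leaf (diagm d ** x)"
          by (rule leaf_self[OF torus_cell(1)[where a = d, OF x d]])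
        ultimately show "W x" unfolding W_def using d by blast
      qed
    qed
    then show "\<forall>\<^sub>F A in at x within cell. W x = W A"
      unfolding eventually_at_topological using S(1,2) by blast
  qed
  from connected_local_const[OF cell_connected_nonempty(1) q x this] have "W q = W x" .
  moreover have "W q"
    unfolding W_def using leaf_self[OF q] by (intro exI[of _ "\<lambda>i. 1"]) (simp add: diagm_one)
  ultimately show ?thesis by (simp add: W_def)
qed

lemma loaf_eq_cell:
  assumes q: "q \<in> cell"
  shows "(\<Union>\<sigma>\<in>S_mult. \<sigma> ` leaf q) = cell"
proof
  show "(\<Union>\<sigma>\<in>S_mult. \<sigma> ` leaf q) \<subseteq> cell"
  proof safe
    fix \<sigma> A assume "\<sigma> \<in> (S_mult :: ('n cmat \<Rightarrow> 'n cmat) set)" and A: "A \<in> leaf q"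
    then obtain \<psi> \<phi> where s: "\<sigma> = (\<lambda>A. \<chi> i j. \<psi> i * \<phi> j * A $ i $ j)" "\<And>i. \<psi> i \<noteq> 0" "\<And>j. \<phi> j \<noteq> 0"
      unfolding S_mult_def by blast
    have "\<sigma> A = diagm \<psi> ** A ** diagm \<phi>" by (simp add: s vec_eq_iff mult_ac)
    moreover have "A \<in> cell" using A leaf_subset level_cell by blast
    ultimately show "\<sigma> A \<in> cell"
      unfolding cell_def using s(2,3)
      by (auto intro!: double_coset_mult B_plus_mult B_minus_mult diagm_B)
  qed
  show "cell \<subseteq> (\<Union>\<sigma>\<in>S_mult. \<sigma> ` leaf q)"
  proof
    fix A assume "A \<in> cell"
    then obtain a where a: "\<And>i. a i \<noteq> 0" "diagm a ** A \<in> leaf q" using torus_leaf_covers[OF q] by blast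
    define \<sigma> :: "'n cmat \<Rightarrow> 'n cmat" where "\<sigma> = (\<lambda>A. \<chi> i j. (1 / a i) * 1 * A $ i $ j)"
    have "\<sigma> (diagm a ** A) = A" using a(1) by (simp add: \<sigma>_def vec_eq_iff)
    moreover have "\<sigma> \<in> S_mult"
      unfolding S_mult_def \<sigma>_def using a(1) by (intro CollectI exI[of _ "\<lambda>i. 1 / a i"] exI[of _ "\<lambda>j. 1"]) auto
    ultimately show "A \<in> (\<Union>\<sigma>\<in>S_mult. \<sigma> ` leaf q)" using a(2) by (metis UN_iff imageI)
  qed
qed

end

lemma cell_pair_exists:
  fixes p r :: "'n::{finite,linorder} \<Rightarrow> 'n"
  assumes "p permutes UNIV" "r permutes UNIV"
  obtains N where "cell_pair p r N"
proof -
  have "permutation (p \<circ> inv r)"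
    using assms permutes_compose[OF permutes_inv[OF assms(2)] assms(1)] permutes_imp_permutation[OF finite]
    by blast
  then obtain N where "(p \<circ> inv r) ^^ N = id" "N > 0" by (rule permutation_is_nilpotent)
  then show ?thesis using that assms by (simp add: cell_pair_def)
qed

lemma in_some_cell:
  fixes A :: "('n::{finite,linorder}) cmat"
  assumes "invertible A"
  obtains p r N where "cell_pair p r N" "A \<in> cell_pair.cell p r"
proof -
  obtain p where p: "p permutes UNIV" "A \<in> double_coset B_plus (permutation_matrix p)"
    using bruhat_plus[OF assms] by blast
  obtain r where r: "r permutes UNIV" "A \<in> double_coset B_minus (permutation_matrix r)"
    using bruhat_minus[OF assms] by blast
  obtain N where N: "cell_pair p r N" using cell_pair_exists[OF p(1) r(1)] by blast
  have "A \<in> cell_pair.cell p r" using p r by (simp add: cell_pair.cell_def[OF N])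
  then show ?thesis using that N by blast
qed

theorem corollary9p2:
  shows "{K :: ('n::{finite,linorder}) cmat set. symplectic_loaf K} =
    {double_coset B_plus \<omega>1 \<inter> double_coset B_minus \<omega>2 | \<omega>1 \<omega>2.
      \<omega>1 \<in> Weyl_group \<and> \<omega>2 \<in> Weyl_group}"
proof (intro set_eqI iffI)
  fix K :: "'n cmat set"
  assume "K \<in> {K. symplectic_loaf K}"
  then obtain L where L: "symplectic_leaf L" "K = (\<Union>\<sigma>\<in>S_mult. \<sigma> ` L)"
    unfolding symplectic_loaf_def by blast
  have "L \<noteq> {}"
  proof
    assume "L = {}"
    obtain p r N where c: "cell_pair p r N" "(mat 1 :: 'n cmat) \<in> cell_pair.cell p r"
      using in_some_cell[of "mat 1"] by (metis invertible_def matrix_mul_lid)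
    show False
      using cell_pair.leaf_integral_manifold[OF c] cell_pair.leaf_self[OF c] L(1) \<open>L = {}\<close>
      unfolding symplectic_leaf_def by blast
  qed
  then obtain q where q: "q \<in> L" by blast
  have "invertible q"
    using L(1) q by (auto simp: symplectic_leaf_def connected_integral_manifold_def
        integral_manifold_def GL_def)
  then obtain p r N where c: "cell_pair p r N" "q \<in> cell_pair.cell p r" by (rule in_some_cell)
  interpret cell_pair p r N by (rule c(1))
  have "K = cell"
    using L(2) symplectic_leaf_eq[OF L(1) c(2) q] loaf_eq_cell[OF c(2)] by simp
  then show "K \<in> {double_coset B_plus \<omega>1 \<inter> double_coset B_minus \<omega>2 | \<omega>1 \<omega>2.
      \<omega>1 \<in> Weyl_group \<and> \<omega>2 \<in> Weyl_group}"
    unfolding cell_def Weyl_group_def using p r by blast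
next
  fix K :: "'n cmat set"
  assume "K \<in> {double_coset B_plus \<omega>1 \<inter> double_coset B_minus \<omega>2 | \<omega>1 \<omega>2.
      \<omega>1 \<in> Weyl_group \<and> \<omega>2 \<in> Weyl_group}"
  then obtain p r where p: "p permutes UNIV" and r: "r permutes UNIV" and
    K: "K = double_coset B_plus (permutation_matrix p) \<inter> double_coset B_minus (permutation_matrix r)"
    unfolding Weyl_group_def by blast
  obtain N where "cell_pair p r N" using cell_pair_exists[OF p r] by blast
  then interpret cell_pair p r N .
  obtain q where q: "q \<in> cell" using cell_connected_nonempty(2) by blast
  have "symplectic_loaf cell"
    unfolding symplectic_loaf_def using leaf_symplectic[OF q] loaf_eq_cell[OF q] by blast
  then show "K \<in> {K. symplectic_loaf K}" by (simp add: K cell_def)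
qed


end
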